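(* There are no $5$-vertex-critical $(\text{co-gem}, K_4)$-free graphs.
   Context: All graphs are finite and simple. $\chi(G)$ denotes the chromatic number of $G$. A graph $G$ is $k$-vertex-critical if $\chi(G)=k$ and $\chi(G-v)<k$ for every $v\in V(G)$. $P_n$ denotes the path on $n$ vertices, $K_n$ the complete graph on $n$ vertices, and $G+H$ the disjoint union of graphs $G$ and $H$. The co-gem is the graph $P_4+P_1$. A graph is $(H_1,\dots,H_m)$-free if none of $H_1,\dots,H_m$ is isomorphic to an induced subgraph of it. *)

theory Defs
  imports "Graph_Theory.Graph_Theory"
begin

text \<open>
  Finite simple graphs are the symmetric digraphs of locale \<^locale>\<open>graph\<close>: finite,
  loop-free, without parallel arcs, an undirected edge being a pair of opposite arcs.
\<close>

definition colourable :: "nat \<Rightarrow> ('a, 'b) pre_digraph \<Rightarrow> bool" where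
  "colourable k G \<longleftrightarrow>
     (\<exists>c :: 'a \<Rightarrow> nat. (\<forall>v \<in> verts G. c v < k) \<and> (\<forall>(u, v) \<in> arcs_ends G. c u \<noteq> c v))"

text \<open>
  Every finite loop-free graph has a proper colouring (lemma \<open>colourable_card_verts\<close> below), so
  the least element exists whenever \<^locale>\<open>graph\<close> holds.
\<close>
definition chromatic_number :: "('a, 'b) pre_digraph \<Rightarrow> nat" where
  "chromatic_number G = (LEAST k. colourable k G)"

definition vertex_critical :: "nat \<Rightarrow> ('a, 'b) pre_digraph \<Rightarrow> bool" where
  "vertex_critical k G \<longleftrightarrow>
     chromatic_number G = k \<and>
     (\<forall>v \<in> verts G. chromatic_number (pre_digraph.del_vert G v) < k)"

definition induced_free :: "('c, 'd) pre_digraph \<Rightarrow> ('a, 'b) pre_digraph \<Rightarrow> bool" where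
  "induced_free H G \<longleftrightarrow> \<not> (\<exists>I. induced_subgraph I G \<and> digraph_iso I H)"

definition path_graph :: "nat \<Rightarrow> nat pair_pre_digraph" where
  "path_graph n =
     \<lparr> pverts = {..<n}, parcs = {(i, j). i < n \<and> j < n \<and> (j = Suc i \<or> i = Suc j)} \<rparr>"

definition complete_graph :: "nat \<Rightarrow> nat pair_pre_digraph" where
  "complete_graph n = \<lparr> pverts = {..<n}, parcs = {(i, j). i < n \<and> j < n \<and> i \<noteq> j} \<rparr>"

definition disjoint_union ::
    "'a pair_pre_digraph \<Rightarrow> 'b pair_pre_digraph \<Rightarrow> ('a + 'b) pair_pre_digraph" where
  "disjoint_union G H =
     \<lparr> pverts = pverts G <+> pverts H,
       parcs = map_prod Inl Inl ` parcs G \<union> map_prod Inr Inr ` parcs H \<rparr>"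

definition co_gem :: "(nat + nat) pair_pre_digraph" where
  "co_gem = disjoint_union (path_graph 4) (path_graph 1)"

lemma colourable_card_verts:
  assumes "graph G"
  shows "colourable (card (verts G)) G"
proof -
  interpret graph G by fact
  obtain c where c: "bij_betw c (verts G) {0..<card (verts G)}"
    using ex_bij_betw_finite_nat[OF finite_verts] by blast
  have "c u \<noteq> c v" if "(u, v) \<in> arcs_ends G" for u v
  proof -
    have "u \<in> verts G" "v \<in> verts G" "u \<noteq> v"
      using that adj_in_verts adj_not_same by auto
    then show ?thesis using c by (auto simp: bij_betw_def inj_on_def)
  qed
  moreover have "\<forall>v \<in> verts G. c v < card (verts G)"
    using c by (auto simp: bij_betw_def)
  ultimately show ?thesis unfolding colourable_def by blast
qed

lemma complete_digraph_complete_graph: "complete_digraph n (with_proj (complete_graph n))"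
  unfolding complete_digraph_pair_def by (auto simp: complete_graph_def)

lemma pair_graph_path_graph: "pair_graph (path_graph n)"
proof -
  have "finite (parcs (path_graph n))"
    by (rule finite_subset[of _ "{..<n} \<times> {..<n}"]) (auto simp: path_graph_def)
  then show ?thesis
    by unfold_locales (auto simp: path_graph_def symmetric_def intro: symI)
qed

lemma pair_graph_disjoint_union:
  assumes "pair_graph G" "pair_graph H"
  shows "pair_graph (disjoint_union G H)"
proof -
  interpret G: pair_graph G by fact
  interpret H: pair_graph H by fact
  show ?thesis
  proof unfold_locales
    show "symmetric (with_proj (disjoint_union G H))"
      using G.sym_arcs H.sym_arcs
      by (auto simp: symmetric_def disjoint_union_def image_iff intro!: symI dest: symD)
  qed (auto simp: disjoint_union_def dest: G.wellformed' H.wellformed' G.pair_no_loops H.pair_no_loops)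
qed

end

theory Submission
  imports Defs
begin

text \<open>
  In an induced copy of a small graph \<open>F\<close>, every vertex outside the copy has a type, its
  neighbourhood in the copy. Since the co-gem and \<open>K\<^sub>4\<close> are forbidden, few types occur, and
  vertices of many pairs of types cannot be adjacent. If colours can be assigned to \<open>F\<close> and to the
  types such that possibly adjacent types get disjoint sets of colours, then \<open>G\<close> is 4-colourable, so
  \<open>F\<close> does not occur in a 5-vertex-critical \<open>G\<close>. One colour suffices for a type whose vertices are
  pairwise non-adjacent. Two suffice for a type that has both a neighbour and a non-neighbour in
  \<open>F\<close>: its vertices induce a graph without triangle and induced \<open>P\<^sub>4\<close>, which is bipartite. If some
  types resist, one extends \<open>F\<close> by a vertex of such a type. Alternatively one extends \<open>F\<close> by a vertex
  that exists by criticality: if \<open>u\<close> and \<open>v\<close> are non-adjacent, then some neighbour of \<open>u\<close> is not a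
  neighbour of \<open>v\<close>; and every vertex has at least four neighbours. Graphs excluded in this way become
  forbidden in turn. A computer search found a chain of such exclusions which starts from the co-gem
  and \<open>K\<^sub>4\<close> and ends with the one-vertex graph; the simplifier replays it with a verified checker.
\<close>

section \<open>Copies of small graphs\<close>

text \<open>A finite check settles graphs of every order because the size of a type class never
  enters: a class gets its colours as a whole, and a clash between two classes holds for all their
  vertices at once. The obstacle is the two uniform types. Vertices adjacent to all of a nonempty
  \<open>F\<close> span no triangle but may span an induced P_4, and vertices adjacent to none of
  \<open>F\<close> span no induced P_4 but may span triangles, so in neither case is a bipartition
  available. Such a class must be shown independent by means of an excluded graph, or a vertex of it
  must be added to \<open>F\<close>, which splits the remaining vertices into finer types. This is
  why graphs are excluded in a chain: each of them, once absent, removes types and edges between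
  classes in all later steps. Both facts drawn from criticality are recolouring arguments: a
  colouring of G - u would extend to u if u could copy the colour of a non-neighbour or if a colour
  were free at u.\<close>

text \<open>
  A graph on a list of vertices is given by its rows: the row of a vertex records its adjacency
  to the vertices after it in the list, so a new vertex is added in front, together with its
  row.
\<close>

type_synonym rows = "bool list list"

text \<open>Adjacency is read only inside \<open>S\<close>, so deleting a vertex shrinks the set and
  leaves \<open>E\<close> as it is.\<close>

definition four_colourable :: "'a set \<Rightarrow> ('a \<Rightarrow> 'a \<Rightarrow> bool) \<Rightarrow> bool" where
  "four_colourable S E \<longleftrightarrow>
     (\<exists>c :: 'a \<Rightarrow> nat. (\<forall>v \<in> S. c v < 4) \<and> (\<forall>u \<in> S. \<forall>v \<in> S. E u v \<longrightarrow> c u \<noteq> c v))"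

fun adj :: "rows \<Rightarrow> nat \<Rightarrow> nat \<Rightarrow> bool" where
  "adj (t # F) 0 (Suc j) = t ! j"
| "adj (t # F) (Suc i) 0 = t ! i"
| "adj (t # F) (Suc i) (Suc j) = adj F i j"
| "adj _ _ _ = False"

text \<open>Every realized graph has this shape. For an excluded pattern it has to be checked:
  misshapen rows are vacuously \<open>absent\<close>, although \<open>adj\<close> still assigns them
  adjacencies, so a witness citing them would be unsound.\<close>

fun triangular :: "rows \<Rightarrow> bool" where
  "triangular [] = True"
| "triangular (t # F) = (if length t = length F then triangular F else False)"

lemma adj_sym: "adj F i j = adj F j i"
  by (induction F i j rule: adj.induct) auto

lemma adj_refl [simp]: "\<not> adj F i i"
proof (induction F arbitrary: i)
  case (Cons t F)
  then show ?case by (cases i) auto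
qed simp

locale simple_graph =
  fixes V :: "'a set" and E :: "'a \<Rightarrow> 'a \<Rightarrow> bool"
  assumes finite_V: "finite V"
    and E_sym: "E x y \<Longrightarrow> E y x"
    and E_irrefl: "\<not> E x x"
begin

lemma E_commute: "E x y = E y x"
  using E_sym by blast

fun realizes :: "'a list \<Rightarrow> rows \<Rightarrow> bool" where
  "realizes [] F = (F = [])"
| "realizes (x # xs) [] = False"
| "realizes (x # xs) (t # F) =
     (x \<in> V \<and> x \<notin> set xs \<and> map (E x) xs = t \<and> realizes xs F)"

definition absent :: "rows \<Rightarrow> bool" where
  "absent F \<longleftrightarrow> (\<nexists>xs. realizes xs F)"

lemma realizesD:
  assumes "realizes xs F"
  shows "length xs = length F" "distinct xs" "set xs \<subseteq> V"
  using assms by (induction xs F rule: realizes.induct) auto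

lemma realizes_adj:
  assumes "realizes xs F" "i < length xs" "j < length xs"
  shows "E (xs ! i) (xs ! j) = adj F i j"
  using assms
proof (induction xs F arbitrary: i j rule: realizes.induct)
  case (3 x xs t F)
  then show ?case
    using E_irrefl E_commute by (cases i; cases j) auto
qed auto

text \<open>Recognizes a copy by its adjacency matrix, so that its vertices may have been found in
  any order.\<close>

lemma realizesI:
  assumes "triangular F" "length xs = length F" "distinct xs" "set xs \<subseteq> V"
    and "\<And>i j. i < length xs \<Longrightarrow> j < length xs \<Longrightarrow> E (xs ! i) (xs ! j) = adj F i j"
  shows "realizes xs F"
  using assms
proof (induction xs F rule: realizes.induct)
  case (3 x xs t F)
  have "E x (xs ! j) = t ! j" if "j < length xs" for j
    using "3.prems"(5)[of 0 "Suc j"] that by simp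
  then have "map (E x) xs = t"
    using 3 by (intro nth_equalityI) (auto split: if_splits)
  moreover have "realizes xs F"
    using 3 "3.prems"(5)[of "Suc i" "Suc j" for i j] by (auto split: if_splits)
  ultimately show ?case using 3 by auto
qed auto

text \<open>A partial induced embedding of \<open>P\<close>, given as a set of pairs. The
  equivalence of \<open>j = k\<close> and \<open>x = y\<close> makes it single-valued and injective
  at once.\<close>

definition partial_copy :: "rows \<Rightarrow> (nat \<times> 'a) set \<Rightarrow> bool" where
  "partial_copy P L \<longleftrightarrow>
     (\<forall>j x. (j, x) \<in> L \<longrightarrow> j < length P \<and> x \<in> V) \<and>
     (\<forall>j x k y. (j, x) \<in> L \<longrightarrow> (k, y) \<in> L \<longrightarrow> (j = k \<longleftrightarrow> x = y) \<and> E x y = adj P j k)"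

lemma partial_copy_insert:
  assumes "partial_copy P L" "k < length P" "y \<in> V"
    and "\<And>j x. (j, x) \<in> L \<Longrightarrow> j \<noteq> k \<and> x \<noteq> y \<and> E y x = adj P k j"
  shows "partial_copy P (insert (k, y) L)"
proof -
  have new: "j \<noteq> k \<and> x \<noteq> y \<and> E y x = adj P k j \<and> E x y = adj P j k" if "(j, x) \<in> L" for j x
    using assms(4)[OF that] E_commute[of x y] adj_sym[of P j k] by simp
  show ?thesis
    unfolding partial_copy_def
  proof (intro conjI allI impI)
    fix i x j z
    assume "(i, x) \<in> insert (k, y) L" "(j, z) \<in> insert (k, y) L"
    then consider "(i, x) = (k, y)" "(j, z) = (k, y)" | "(i, x) = (k, y)" "(j, z) \<in> L"
      | "(i, x) \<in> L" "(j, z) = (k, y)" | "(i, x) \<in> L" "(j, z) \<in> L"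
      by blast
    then have "(i = j \<longleftrightarrow> x = z) \<and> E x z = adj P i j"
    proof cases
      case 1
      then show ?thesis using E_irrefl by simp
    next
      case 2
      then show ?thesis using new[of j z] by auto
    next
      case 3
      then show ?thesis using new[of i x] by auto
    next
      case 4
      then show ?thesis using assms(1) unfolding partial_copy_def by blast
    qed
    then show "i = j \<longleftrightarrow> x = z" "E x z = adj P i j" by auto
  qed (use assms in \<open>auto simp: partial_copy_def\<close>)
qed

text \<open>An embedding that reaches every vertex of the pattern is a copy; each use of an excluded
  graph ends here.\<close>

lemma partial_copy_total:
  assumes "absent P" "triangular P" "partial_copy P L" "{..<length P} \<subseteq> fst ` L"
  shows False
proof -
  have "\<exists>x. (j, x) \<in> L" if "j < length P" for j
    using that assms(4) by fastforce
  then obtain g where g: "\<And>j. j < length P \<Longrightarrow> (j, g j) \<in> L" by metis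
  have L: "j < length P \<and> x \<in> V" "(i, z) \<in> L \<Longrightarrow> (j = i \<longleftrightarrow> x = z) \<and> E x z = adj P j i"
    if "(j, x) \<in> L" for j x i z
    using assms(3) that unfolding partial_copy_def by blast+
  have "realizes (map g [0..<length P]) P"
  proof (rule realizesI)
    have "inj_on g {0..<length P}"
      using L(2)[OF g g] by (auto simp: inj_on_def)
    then show "distinct (map g [0..<length P])" by (simp add: distinct_map)
    show "set (map g [0..<length P]) \<subseteq> V"
      using L(1)[OF g] by auto
    show "E (map g [0..<length P] ! i) (map g [0..<length P] ! j) = adj P i j"
      if "i < length (map g [0..<length P])" "j < length (map g [0..<length P])" for i j
      using that L(2)[OF g g, of i j] by simp
  qed (use assms in auto)
  then show False using assms(1) by (auto simp: absent_def)
qed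

end

section \<open>Vertex types\<close>

text \<open>
  Let \<open>xs\<close> be a copy of \<open>F\<close>. The type of a vertex \<open>y\<close>
  outside \<open>xs\<close> is the list \<open>map (E y) xs\<close>. A cube prescribes some
  entries of a type; entries beyond the end of the cube are free.
\<close>

type_synonym cube = "bool option list"

fun matches :: "cube \<Rightarrow> bool list \<Rightarrow> bool" where
  "matches [] t = True"
| "matches (q # qs) [] = False"
| "matches (None # qs) (b # t) = matches qs t"
| "matches (Some True # qs) (True # t) = matches qs t"
| "matches (Some False # qs) (False # t) = matches qs t"
| "matches (Some True # qs) (False # t) = False"
| "matches (Some False # qs) (True # t) = False"

lemma matches_Some: "matches (Some c # qs) (b # t) \<longleftrightarrow> b = c \<and> matches qs t"
  by (cases c; cases b) auto

lemma matches_map_Some: "length t' = length t \<Longrightarrow> matches (map Some t) t' \<longleftrightarrow> t' = t"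
  by (induction t' t rule: list_induct2) (auto simp: matches_Some)

section \<open>Enumeration of the types that match none of the given cubes\<close>

fun restrict_cubes :: "bool \<Rightarrow> cube list \<Rightarrow> cube list" where
  "restrict_cubes b [] = []"
| "restrict_cubes b ([] # C) = [] # restrict_cubes b C"
| "restrict_cubes b ((None # q) # C) = q # restrict_cubes b C"
| "restrict_cubes True ((Some True # q) # C) = q # restrict_cubes True C"
| "restrict_cubes False ((Some False # q) # C) = q # restrict_cubes False C"
| "restrict_cubes True ((Some False # q) # C) = restrict_cubes True C"
| "restrict_cubes False ((Some True # q) # C) = restrict_cubes False C"

fun has_Nil :: "'b list list \<Rightarrow> bool" where
  "has_Nil [] = False"
| "has_Nil ([] # C) = True"
| "has_Nil ((a # b) # C) = has_Nil C"

text \<open>A descent through the binary tree of types. A cube that has become empty matches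
  everything below, so the subtree is dropped without listing it. Only the length of the first
  argument counts, which allows \<open>F\<close> itself to be passed.\<close>

fun types :: "'b list \<Rightarrow> cube list \<Rightarrow> bool list list" where
  "types [] C = (if has_Nil C then [] else [[]])"
| "types (x # xs) C =
     (if has_Nil C then []
      else map (Cons False) (types xs (restrict_cubes False C)) @
           map (Cons True) (types xs (restrict_cubes True C)))"

lemma has_Nil_iff: "has_Nil C \<longleftrightarrow> [] \<in> set C"
  by (induction C rule: has_Nil.induct) auto

lemma restrict_cubes_matches:
  "q \<in> set (restrict_cubes b C) \<Longrightarrow> matches q t \<Longrightarrow> \<exists>q \<in> set C. matches q (b # t)"
  by (induction b C rule: restrict_cubes.induct) auto

lemma types_complete:
  "length t = length xs \<Longrightarrow> \<forall>q \<in> set C. \<not> matches q t \<Longrightarrow> t \<in> set (types xs C)"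
proof (induction xs C arbitrary: t rule: types.induct)
  case (1 C)
  then show ?case by (auto simp: has_Nil_iff)
next
  case (2 x xs C)
  then obtain b t' where t: "t = b # t'" "length t' = length xs" using "2.prems"(1) by (auto simp: length_Suc_conv)
  have nil: "\<not> has_Nil C" using "2.prems"(2) by (auto simp: has_Nil_iff)
  have "\<forall>q \<in> set (restrict_cubes b C). \<not> matches q t'"
    using restrict_cubes_matches "2.prems"(2) t by blast
  then show ?case using "2.IH"[OF nil] t nil by (cases b) auto
qed

text \<open>
  A list \<open>ls\<close> of labels embeds part of a pattern \<open>P\<close> into
  \<open>F\<close>: label \<open>Suc j\<close> means that a vertex of \<open>F\<close> plays
  vertex \<open>j\<close> of \<open>P\<close>, label \<open>0\<close> that it is unused. A
  vertex outside can then play vertex \<open>k\<close> of \<open>P\<close> iff its type matches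
  \<open>cube_of P k ls\<close>.
\<close>

fun cube_of :: "rows \<Rightarrow> nat \<Rightarrow> nat list \<Rightarrow> cube" where
  "cube_of P k [] = []"
| "cube_of P k (0 # ls) = None # cube_of P k ls"
| "cube_of P k (Suc j # ls) = Some (adj P k j) # cube_of P k ls"

fun mem :: "nat \<Rightarrow> nat list \<Rightarrow> bool" where
  "mem k [] = False"
| "mem k (l # ls) = (if k = l then True else mem k ls)"

lemma mem_iff [simp]: "mem k ls \<longleftrightarrow> k \<in> set ls"
  by (induction ls) auto

text \<open>A row records the adjacency to later vertices, so comparing it with the cube of the
  later labels examines each pair of labelled vertices exactly once. The labels may stop before the
  end of \<open>F\<close>.\<close>

fun fits :: "rows \<Rightarrow> nat list \<Rightarrow> rows \<Rightarrow> bool" where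
  "fits P [] F = True"
| "fits P (l # ls) [] = False"
| "fits P (0 # ls) (t # F) = fits P ls F"
| "fits P (Suc k # ls) (t # F) =
     (if mem (Suc k) ls then False
      else if k < length P then if matches (cube_of P k ls) t then fits P ls F else False
      else False)"

fun covers :: "nat \<Rightarrow> nat list \<Rightarrow> bool" where
  "covers 0 ls = True"
| "covers (Suc n) ls = (if mem (Suc n) ls then covers n ls else False)"

lemma covers_iff: "covers n ls \<longleftrightarrow> (\<forall>k < n. Suc k \<in> set ls)"
  by (induction n) (auto simp: less_Suc_eq)

text \<open>
  A witness \<open>(p, k, ls)\<close> shows that a vertex whose type matches the cube would
  complete a copy of \<open>K ! p\<close>; a witness \<open>(p, k, l, ls)\<close> does so for
  two adjacent vertices outside, one for each of the two cubes.
\<close>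

type_synonym witness = "nat \<times> nat \<times> nat list"

type_synonym pair_witness = "nat \<times> nat \<times> nat \<times> nat list"

text \<open>\<open>fits\<close> makes the labelled vertices a partial copy, and
  \<open>covers\<close> ensures that vertex \<open>k\<close> is its only gap.\<close>

definition single_ok :: "rows list \<Rightarrow> rows \<Rightarrow> witness \<Rightarrow> bool" where
  "single_ok K F w = (case w of (p, k, ls) \<Rightarrow>
     p < length K \<and> k < length (K ! p) \<and> \<not> mem (Suc k) ls \<and>
     covers (length (K ! p)) (Suc k # ls) \<and> fits (K ! p) ls F)"

definition pair_ok :: "rows list \<Rightarrow> rows \<Rightarrow> pair_witness \<Rightarrow> bool" where
  "pair_ok K F w = (case w of (p, k, l, ls) \<Rightarrow>
     p < length K \<and> k < length (K ! p) \<and> l < length (K ! p) \<and> adj (K ! p) k l \<and>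
     \<not> mem (Suc k) ls \<and> \<not> mem (Suc l) ls \<and>
     covers (length (K ! p)) (Suc k # Suc l # ls) \<and> fits (K ! p) ls F)"

definition single_cube :: "rows list \<Rightarrow> witness \<Rightarrow> cube" where
  "single_cube K w = (case w of (p, k, ls) \<Rightarrow> cube_of (K ! p) k ls)"

definition pair_cube :: "rows list \<Rightarrow> pair_witness \<Rightarrow> cube \<times> cube" where
  "pair_cube K w = (case w of (p, k, l, ls) \<Rightarrow> (cube_of (K ! p) k ls, cube_of (K ! p) l ls))"

text \<open>An edge has no direction, so each pair of cubes is tried both ways round.\<close>

fun clash :: "(cube \<times> cube) list \<Rightarrow> bool list \<Rightarrow> bool list \<Rightarrow> bool" where
  "clash [] t t' = False"
| "clash ((q, r) # Q) t t' =
     (if (if matches q t then matches r t' else False) then True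
      else if (if matches r t then matches q t' else False) then True
      else clash Q t t')"

section \<open>Completing an excluded pattern by vertices outside the copy\<close>

context simple_graph
begin

definition labelled :: "nat list \<Rightarrow> 'a list \<Rightarrow> (nat \<times> 'a) set" where
  "labelled ls xs = {(j, x). (Suc j, x) \<in> set (zip ls xs)}"

lemma labelled_simps [simp]:
  "labelled [] xs = {}"
  "labelled (0 # ls) (x # xs) = labelled ls xs"
  "labelled (Suc k # ls) (x # xs) = insert (k, x) (labelled ls xs)"
  by (auto simp: labelled_def)

lemma labelledD:
  assumes "(j, x) \<in> labelled ls xs"
  shows "Suc j \<in> set ls" "x \<in> set xs"
  using assms by (auto simp: labelled_def dest: set_zip_leftD set_zip_rightD)

lemma matches_cube_of:
  "matches (cube_of P k ls) (map (E y) xs) \<Longrightarrow> (j, x) \<in> labelled ls xs \<Longrightarrow> E y x = adj P k j"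
proof (induction P k ls arbitrary: xs rule: cube_of.induct)
  case (2 P k ls)
  then show ?case by (cases xs) auto
next
  case (3 P k j' ls)
  then show ?case by (cases xs) (auto simp: matches_Some)
qed simp

lemma fits_length: "fits P ls F \<Longrightarrow> length ls \<le> length F"
  by (induction P ls F rule: fits.induct) (auto split: if_splits)

lemma fits_partial_copy: "fits P ls F \<Longrightarrow> realizes xs F \<Longrightarrow> partial_copy P (labelled ls xs)"
proof (induction P ls F arbitrary: xs rule: fits.induct)
  case (1 P F)
  then show ?case by (simp add: partial_copy_def)
next
  case (3 P ls t F)
  then show ?case by (cases xs) auto
next
  case (4 P k ls t F)
  then obtain x xs' where xs: "xs = x # xs'" by (cases xs) auto
  have m: "Suc k \<notin> set ls" "k < length P" "matches (cube_of P k ls) t" "fits P ls F"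
    using 4(2) by (auto split: if_splits)
  have r: "x \<in> V" "x \<notin> set xs'" "map (E x) xs' = t" "realizes xs' F"
    using 4(3) xs by auto
  have "partial_copy P (labelled ls xs')" using 4(1) m r by simp
  then have "partial_copy P (insert (k, x) (labelled ls xs'))"
  proof (rule partial_copy_insert)
    fix j z assume jz: "(j, z) \<in> labelled ls xs'"
    show "j \<noteq> k \<and> z \<noteq> x \<and> E x z = adj P k j"
      using labelledD[OF jz] matches_cube_of[of P k ls x xs', OF _ jz] m r by auto
  qed (use m r in auto)
  then show ?case by (simp add: xs)
qed simp

lemma fst_labelled: "length ls \<le> length xs \<Longrightarrow> fst ` labelled ls xs = {j. Suc j \<in> set ls}"
proof -
  assume "length ls \<le> length xs"
  then have "set ls = fst ` set (zip ls xs)"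
    by (metis map_fst_zip_take min.absorb1 set_map take_all_iff order_refl)
  then show ?thesis by (force simp: labelled_def)
qed

definition known :: "rows list \<Rightarrow> bool" where
  "known K \<longleftrightarrow> (\<forall>P \<in> set K. absent P \<and> triangular P)"

lemma single_sound:
  assumes "known K" "single_ok K F w" "realizes xs F" "y \<in> V - set xs"
  shows "\<not> matches (single_cube K w) (map (E y) xs)"
proof
  obtain p k ls where w: "w = (p, k, ls)" using prod_cases3 by blast
  define P where "P = K ! p"
  assume "matches (single_cube K w) (map (E y) xs)"
  then have m: "matches (cube_of P k ls) (map (E y) xs)"
    by (simp add: single_cube_def w P_def)
  have ok: "k < length P" "Suc k \<notin> set ls" "covers (length P) (Suc k # ls)" "fits P ls F"
    and P: "absent P" "triangular P"
    using assms(1,2) by (auto simp: single_ok_def w P_def known_def)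
  have "partial_copy P (insert (k, y) (labelled ls xs))"
    using fits_partial_copy[OF ok(4) assms(3)]
  proof (rule partial_copy_insert)
    fix j z assume "(j, z) \<in> labelled ls xs"
    then show "j \<noteq> k \<and> z \<noteq> y \<and> E y z = adj P k j"
      using matches_cube_of[OF m] labelledD ok(2) assms(4) by blast
  qed (use ok assms in auto)
  moreover have "length ls \<le> length xs"
    using fits_length[OF ok(4)] realizesD(1)[OF assms(3)] by simp
  then have "{..<length P} \<subseteq> fst ` insert (k, y) (labelled ls xs)"
    using ok(3) by (auto simp: fst_labelled covers_iff)
  ultimately show False using partial_copy_total P by blast
qed

lemma pair_sound:
  assumes "known K" "pair_ok K F w" "realizes xs F" "y \<in> V - set xs" "z \<in> V - set xs"
    and "matches (fst (pair_cube K w)) (map (E y) xs)"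
    and "matches (snd (pair_cube K w)) (map (E z) xs)"
  shows "\<not> E y z"
proof
  assume yz: "E y z"
  obtain p k l ls where w: "w = (p, k, l, ls)" using prod_cases4 by blast
  define P where "P = K ! p"
  have m: "matches (cube_of P k ls) (map (E y) xs)" "matches (cube_of P l ls) (map (E z) xs)"
    using assms(6,7) by (simp_all add: pair_cube_def w P_def)
  have ok: "k < length P" "l < length P" "adj P k l" "Suc k \<notin> set ls" "Suc l \<notin> set ls"
    "covers (length P) (Suc k # Suc l # ls)" "fits P ls F"
    and P: "absent P" "triangular P"
    using assms(1,2) by (auto simp: pair_ok_def w P_def known_def)
  have "partial_copy P (insert (k, y) (labelled ls xs))"
    using fits_partial_copy[OF ok(7) assms(3)]
  proof (rule partial_copy_insert)
    fix j v assume "(j, v) \<in> labelled ls xs"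
    then show "j \<noteq> k \<and> v \<noteq> y \<and> E y v = adj P k j"
      using matches_cube_of[OF m(1)] labelledD ok(4) assms(4) by blast
  qed (use ok assms in auto)
  \<comment> \<open>The second insertion also has to account for the pair \<open>z\<close>,
    \<open>y\<close>; here the assumed edge meets \<open>adj P k l\<close>.\<close>
  then have "partial_copy P (insert (l, z) (insert (k, y) (labelled ls xs)))"
  proof (rule partial_copy_insert)
    fix j v assume "(j, v) \<in> insert (k, y) (labelled ls xs)"
    then show "j \<noteq> l \<and> v \<noteq> z \<and> E z v = adj P l j"
      using matches_cube_of[OF m(2)] labelledD ok(3,5) assms(5) yz E_commute[of y z]
        adj_sym[of P k l] E_irrefl adj_refl by blast
  qed (use ok assms in auto)
  moreover have "length ls \<le> length xs"
    using fits_length[OF ok(7)] realizesD(1)[OF assms(3)] by simp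
  then have "{..<length P} \<subseteq> fst ` insert (l, z) (insert (k, y) (labelled ls xs))"
    using ok(6) by (auto simp: fst_labelled covers_iff)
  ultimately show False using partial_copy_total P by blast
qed

lemma clash_sound:
  assumes "clash (map (pair_cube K) Q) (map (E y) xs) (map (E z) xs)"
    and "known K" "list_all (pair_ok K F) Q" "realizes xs F" "y \<in> V - set xs" "z \<in> V - set xs"
  shows "\<not> E y z"
  using assms(1,3)
proof (induction Q)
  case (Cons w Q)
  obtain q r where w: "pair_cube K w = (q, r)" by fastforce
  show ?case
    using Cons pair_sound[OF assms(2) _ assms(4-6), of w] pair_sound[OF assms(2) _ assms(4,6,5), of w]
      E_commute[of y z] by (auto simp: w split: if_splits)
qed simp

end

section \<open>Critical graphs\<close>

context simple_graph
begin

text \<open>In such a graph two vertices with a common neighbour have the same neighbourhood, so its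
  components are complete bipartite or single vertices. Around an edge \<open>x y\<close> only the
  neighbourhoods \<open>N x\<close> and \<open>N y\<close> occur, and singling out one of them gives
  the bipartition.\<close>

lemma P4_triangle_free_bipartite:
  assumes S: "S \<subseteq> V"
    and triangle: "\<And>x y z. \<lbrakk>x \<in> S; y \<in> S; z \<in> S; E x y; E y z; E x z\<rbrakk> \<Longrightarrow> False"
    and P4: "\<And>w x y z. \<lbrakk>w \<in> S; x \<in> S; y \<in> S; z \<in> S; E w x; E x y; E y z;
        \<not> E w y; \<not> E w z; \<not> E x z\<rbrakk> \<Longrightarrow> False"
  shows "\<exists>\<beta> :: 'a \<Rightarrow> bool. \<forall>x \<in> S. \<forall>y \<in> S. E x y \<longrightarrow> \<beta> x \<noteq> \<beta> y"
proof -
  define N where "N x = {y \<in> S. E x y}" for x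
  \<comment> \<open>For a path \<open>w\<close>, \<open>z\<close>, \<open>y\<close> and a neighbour
    \<open>u\<close> of \<open>w\<close>, the absence of triangles separates \<open>u\<close> from
    \<open>z\<close> and \<open>w\<close> from \<open>y\<close>. Unless \<open>u\<close> is adjacent
    to \<open>y\<close>, the vertices \<open>u\<close>, \<open>w\<close>, \<open>z\<close>,
    \<open>y\<close> form an induced P_4.\<close>
  have sub: "N w \<subseteq> N y" if "y \<in> S" "z \<in> S" "E y z" "w \<in> N z" for w y z
  proof
    fix u assume "u \<in> N w"
    then have u: "u \<in> S" "E u w" using E_sym by (auto simp: N_def)
    have w: "w \<in> S" "E w z" using that E_sym by (auto simp: N_def)
    have "\<not> E u z" using triangle[of u w z] u w that by auto
    moreover have "\<not> E w y" using triangle[of w z y] w that E_sym by auto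
    ultimately have "E u y" using P4[of u w z y] u w that E_sym by auto
    then show "u \<in> N y" using u E_sym by (auto simp: N_def)
  qed
  have twin: "N w = N y" if "y \<in> S" "z \<in> S" "E y z" "w \<in> N z" for w y z
  proof
    show "N w \<subseteq> N y" using sub that by blast
    show "N y \<subseteq> N w"
      using sub[of w z y] that E_sym by (auto simp: N_def)
  qed
  \<comment> \<open>For both ends of an edge \<open>x y\<close> the set in the choice turns out to
    be {N x, N y}. Hence both ends see the same chosen neighbourhood, and it belongs to exactly one
    of them.\<close>
  define \<beta> where "\<beta> x \<longleftrightarrow> N x = (SOME X. X \<in> insert (N x) (N ` N x))" for x
  have "\<beta> x \<noteq> \<beta> y" if xy: "x \<in> S" "y \<in> S" "E x y" for x y
  proof -
    have in_N: "y \<in> N x" "x \<in> N y" using xy E_sym[OF xy(3)] by (auto simp: N_def)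
    have "N w = N y" if "w \<in> N x" for w using twin[of y x w] that xy E_sym[OF xy(3)] by simp
    then have "N ` N x \<subseteq> {N y}" by blast
    then have x: "insert (N x) (N ` N x) = {N x, N y}" using in_N by blast
    have "N w = N x" if "w \<in> N y" for w using twin[of x y w] that xy by simp
    then have "N ` N y \<subseteq> {N x}" by blast
    then have y: "insert (N y) (N ` N y) = {N x, N y}" using in_N by blast
    have "N x \<noteq> N y" using in_N E_irrefl by (auto simp: N_def)
    moreover have "(SOME X. X \<in> {N x, N y}) \<in> {N x, N y}"
      by (rule someI[of _ "N x"]) simp
    ultimately show ?thesis unfolding \<beta>_def x y by auto
  qed
  then show ?thesis by blast
qed

end

section \<open>Local consequences of criticality and of the two forbidden graphs\<close>

definition K4_rows :: rows where
  "K4_rows = [[True, True, True], [True, True], [True], []]"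

text \<open>The isolated vertex stands first, and the path follows in its order.\<close>

definition co_gem_rows :: rows where
  "co_gem_rows =
     [[False, False, False, False], [True, False, False], [True, False], [True], []]"

locale critical_graph = simple_graph +
  assumes absent_K4: "absent K4_rows"
    and absent_co_gem: "absent co_gem_rows"
    and not_four_colourable: "\<not> four_colourable V E"
    and critical: "v \<in> V \<Longrightarrow> four_colourable (V - {v}) E"
begin

lemma no_K4:
  assumes "{w, x, y, z} \<subseteq> V" "E w x" "E w y" "E w z" "E x y" "E x z" "E y z"
  shows False
proof -
  have "realizes [w, x, y, z] K4_rows"
    using assms E_irrefl by (auto simp: K4_rows_def)
  then show False using absent_K4 by (auto simp: absent_def)
qed

lemma no_co_gem:
  assumes "{v, w, x, y, z} \<subseteq> V" "v \<notin> {w, x, y, z}" "E w x" "E x y" "E y z"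
    and "\<not> E w y" "\<not> E w z" "\<not> E x z" "\<not> E v w" "\<not> E v x" "\<not> E v y" "\<not> E v z"
  shows False
proof -
  have "realizes [v, w, x, y, z] co_gem_rows"
    using assms E_irrefl E_sym by (auto simp: co_gem_rows_def)
  then show False using absent_co_gem by (auto simp: absent_def)
qed

text \<open>If every neighbour of \<open>u\<close> were a neighbour of \<open>v\<close>, a
  4-colouring of the graph without \<open>u\<close> would extend to \<open>u\<close> by giving it
  the colour of \<open>v\<close>.\<close>

lemma private_neighbour:
  assumes "u \<in> V" "v \<in> V" "u \<noteq> v" "\<not> E u v"
  shows "\<exists>w \<in> V. E w u \<and> \<not> E w v"
proof (rule ccontr)
  assume dom: "\<not> (\<exists>w \<in> V. E w u \<and> \<not> E w v)"
  obtain c :: "'a \<Rightarrow> nat" where c: "\<forall>w \<in> V - {u}. c w < 4"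
    "\<forall>w \<in> V - {u}. \<forall>z \<in> V - {u}. E w z \<longrightarrow> c w \<noteq> c z"
    using critical[OF assms(1)] unfolding four_colourable_def by blast
  have "(c(u := c v)) w \<noteq> (c(u := c v)) z" if "w \<in> V" "z \<in> V" "E w z" for w z
  proof -
    have "z \<noteq> v" if "w = u" using that \<open>E w z\<close> assms(4) by auto
    moreover have "w \<noteq> v" if "z = u" using that \<open>E w z\<close> assms(4) E_sym by auto
    ultimately show ?thesis
      using that c(2) dom assms(2,3) E_irrefl E_commute by (metis DiffI fun_upd_apply singletonD)
  qed
  moreover have "\<forall>w \<in> V. (c(u := c v)) w < 4" using c(1) assms by auto
  ultimately show False using not_four_colourable unfolding four_colourable_def by blast
qed

text \<open>If \<open>X\<close> contained all neighbours of \<open>u\<close>, at most three colours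
  would occur among them in a 4-colouring of the graph without \<open>u\<close>, and a fourth would
  be free for \<open>u\<close>.\<close>

lemma outside_neighbour:
  assumes "u \<in> V" "finite X" "card X < 4"
  shows "\<exists>w \<in> V - X. E w u"
proof (rule ccontr)
  assume dom: "\<not> (\<exists>w \<in> V - X. E w u)"
  obtain c :: "'a \<Rightarrow> nat" where c: "\<forall>w \<in> V - {u}. c w < 4"
    "\<forall>w \<in> V - {u}. \<forall>z \<in> V - {u}. E w z \<longrightarrow> c w \<noteq> c z"
    using critical[OF assms(1)] unfolding four_colourable_def by blast
  have "card (c ` X) < card {..<4::nat}" using card_image_le[OF assms(2), of c] assms(3) by simp
  then have "\<not> {..<4} \<subseteq> c ` X" using assms(2) by (meson card_mono finite_imageI not_le)
  then obtain k where k: "k < 4" "k \<notin> c ` X" by auto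
  have nb: "w \<in> X" if "w \<in> V" "E w u" for w using dom that by blast
  have "(c(u := k)) w \<noteq> (c(u := k)) z" if wz: "w \<in> V" "z \<in> V" "E w z" for w z
  proof -
    consider "w = u" "z = u" | "w = u" "z \<noteq> u" | "w \<noteq> u" "z = u" | "w \<noteq> u" "z \<noteq> u" by blast
    then show ?thesis
    proof cases
      case 1
      then show ?thesis using wz E_irrefl by simp
    next
      case 2
      then have "c z \<in> c ` X" using nb[of z] wz E_sym by auto
      then show ?thesis using 2 k by auto
    next
      case 3
      then have "c w \<in> c ` X" using nb[of w] wz by auto
      then show ?thesis using 3 k by auto
    next
      case 4
      then show ?thesis using c(2) wz by simp
    qed
  qed
  moreover have "\<forall>w \<in> V. (c(u := k)) w < 4" using c(1) k by auto
  ultimately show False using not_four_colourable unfolding four_colourable_def by blast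
qed

text \<open>An entry \<open>True\<close> provides a vertex adjacent to the whole class, which turns
  a triangle into a K_4. An entry \<open>False\<close> provides a vertex adjacent to none of it,
  which turns an induced P_4 into a co-gem.\<close>

lemma type_class_bipartite:
  assumes "set xs \<subseteq> V" "length t = length xs" "True \<in> set t" "False \<in> set t"
  shows "\<exists>\<beta> :: 'a \<Rightarrow> bool. \<forall>y \<in> V - set xs. \<forall>z \<in> V - set xs.
    map (E y) xs = t \<longrightarrow> map (E z) xs = t \<longrightarrow> E y z \<longrightarrow> \<beta> y \<noteq> \<beta> z"
proof -
  define S where "S = {y \<in> V - set xs. map (E y) xs = t}"
  obtain i j where ij: "i < length t" "t ! i" "j < length t" "\<not> t ! j"
    using assms(3,4) by (metis in_set_conv_nth)
  define a where "a = xs ! i"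
  define b where "b = xs ! j"
  have ab: "a \<in> set xs" "b \<in> set xs" using ij assms(2) by (auto simp: a_def b_def)
  have adj_ab: "E y a" "\<not> E y b" if "y \<in> S" for y
    using that ij assms(2) by (auto simp: S_def a_def b_def)
  have "\<exists>\<beta> :: 'a \<Rightarrow> bool. \<forall>x \<in> S. \<forall>y \<in> S. E x y \<longrightarrow> \<beta> x \<noteq> \<beta> y"
  proof (rule P4_triangle_free_bipartite)
    show "S \<subseteq> V" by (auto simp: S_def)
    show False if "x \<in> S" "y \<in> S" "z \<in> S" "E x y" "E y z" "E x z" for x y z
      using no_K4[of x y z a] that ab adj_ab assms(1) by (auto simp: S_def)
    show False if "w \<in> S" "x \<in> S" "y \<in> S" "z \<in> S" "E w x" "E x y" "E y z"
      "\<not> E w y" "\<not> E w z" "\<not> E x z" for w x y z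
      using no_co_gem[of b w x y z] that ab adj_ab E_sym assms(1) unfolding S_def by blast
  qed
  then show ?thesis unfolding S_def by blast
qed

end

section \<open>Certificates\<close>

text \<open>
  \<open>Colour S Q cF cs chs\<close>: the single witnesses \<open>S\<close> and the pair
  witnesses \<open>Q\<close> restrict the types and the adjacencies between them,
  \<open>cF\<close> colours the copy of \<open>F\<close>, and \<open>cs\<close> lists the colour
  sets of the remaining types in the order of \<open>types\<close>; an empty set leaves the type
  uncoloured, and for each such type there is a certificate in \<open>chs\<close> for
  \<open>F\<close> extended by a vertex of this type. \<open>Compare S u v chs\<close> branches
  over the types of a vertex that is adjacent to \<open>u\<close> but not to the non-neighbour
  \<open>v\<close> of \<open>u\<close>, \<open>Degree S u chs\<close> over the types of a
  further neighbour of a vertex \<open>u\<close> that has less than four neighbours in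
  \<open>F\<close>.
\<close>

datatype cert =
    Colour "witness list" "pair_witness list"
      "nat list" "nat list list" "cert list"
  | Compare "witness list" nat nat "cert list"
  | Degree "witness list" nat "cert list"

text \<open>
  The simplifier, which evaluates the checker, has no lazy conjunction; hence the conditionals.
\<close>

fun row_coloured :: "bool list \<Rightarrow> nat list \<Rightarrow> nat \<Rightarrow> bool" where
  "row_coloured (True # t) (d # ds) c = (if c = d then False else row_coloured t ds c)"
| "row_coloured (False # t) (d # ds) c = row_coloured t ds c"
| "row_coloured [] ds c = True"
| "row_coloured (b # t) [] c = False"

fun properly_coloured :: "rows \<Rightarrow> nat list \<Rightarrow> bool" where
  "properly_coloured [] cs = (cs = [])"
| "properly_coloured (t # F) [] = False"
| "properly_coloured (t # F) (c # cs) =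
     (if c < 4 then if row_coloured t cs c then properly_coloured F cs else False else False)"

fun disjoint_lists :: "nat list \<Rightarrow> nat list \<Rightarrow> bool" where
  "disjoint_lists [] ds = True"
| "disjoint_lists (c # cs) ds = (if mem c ds then False else disjoint_lists cs ds)"

text \<open>A single colour requires an independent class, which is certified by a clash of the type
  with itself. A pair of colours requires a mixed type, as in
  \<open>type_class_bipartite\<close>.\<close>

fun class_ok :: "nat list \<Rightarrow> (cube \<times> cube) list \<Rightarrow> bool list \<times> nat list \<Rightarrow> bool" where
  "class_ok cF Q (t, [a]) = (if a < 4 then if row_coloured t cF a then clash Q t t else False else False)"
| "class_ok cF Q (t, [a, b]) =
     (if a < 4 \<and> b < 4 \<and> a \<noteq> b \<and> True \<in> set t \<and> False \<in> set t
      then if row_coloured t cF a then row_coloured t cF b else False else False)"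
| "class_ok cF Q (t, _) = False"

fun compatible_with :: "(cube \<times> cube) list \<Rightarrow> bool list \<Rightarrow> nat list \<Rightarrow> (bool list \<times> nat list) list \<Rightarrow> bool" where
  "compatible_with Q t c [] = True"
| "compatible_with Q t c ((t', c') # T) =
     (if (if disjoint_lists c c' then True else clash Q t t')
      then compatible_with Q t c T else False)"

fun classes_ok :: "nat list \<Rightarrow> (cube \<times> cube) list \<Rightarrow> (bool list \<times> nat list) list \<Rightarrow> bool" where
  "classes_ok cF Q [] = True"
| "classes_ok cF Q ((t, c) # T) =
     (if class_ok cF Q (t, c) then
        if compatible_with Q t c T then classes_ok cF Q T else False
      else False)"

text \<open>Types beyond the end of the colour list count as uncoloured, so a truncated list cannot
  hide any. Both results are accumulated in reverse; hence the subcertificates of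
  \<open>Colour\<close> follow the uncoloured types backwards.\<close>

fun partition_types ::
    "bool list list \<Rightarrow> nat list list \<Rightarrow> (bool list \<times> nat list) list \<Rightarrow> bool list list \<Rightarrow>
     (bool list \<times> nat list) list \<times> bool list list" where
  "partition_types (t # ts) ([] # cs) T U = partition_types ts cs T (t # U)"
| "partition_types (t # ts) ((c # c') # cs) T U = partition_types ts cs ((t, c # c') # T) U"
| "partition_types [] cs T U = (T, U)"
| "partition_types (t # ts) [] T U = partition_types ts [] T (t # U)"

definition witnesses_ok :: "rows list \<Rightarrow> rows \<Rightarrow> witness list \<Rightarrow> bool" where
  "witnesses_ok K F S = list_all (single_ok K F) S"

text \<open>
  \<open>K\<close> lists graphs that are already excluded, and \<open>D\<close> consists of
  cubes matched by no vertex outside the copy of \<open>F\<close>. Once a type is refuted it is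
  added to \<open>D\<close>.
\<close>

fun check :: "rows list \<Rightarrow> rows \<Rightarrow> cube list \<Rightarrow> cert \<Rightarrow> bool"
  and branch :: "rows list \<Rightarrow> rows \<Rightarrow> cube list \<Rightarrow> bool list list \<Rightarrow> cert list \<Rightarrow> bool" where
  "check K F D (Colour S Q cF cs chs) =
     (if witnesses_ok K F S \<and> list_all (pair_ok K F) Q \<and> properly_coloured F cF
      then case partition_types (types F (D @ map (single_cube K) S)) cs [] [] of (T, U) \<Rightarrow>
             if classes_ok cF (map (pair_cube K) Q) T then branch K F D U chs else False
      else False)"
| "check K F D (Compare S u v chs) =
     (if witnesses_ok K F S \<and> u < length F \<and> v < length F \<and> u \<noteq> v \<and> \<not> adj F u v \<and>
        list_all (\<lambda>w. adj F w u \<longrightarrow> adj F w v) [0..<length F]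
      then branch K F D (filter (\<lambda>t. t ! u \<and> \<not> t ! v) (types F (D @ map (single_cube K) S))) chs
      else False)"
| "check K F D (Degree S u chs) =
     (if witnesses_ok K F S \<and> u < length F \<and>
        length (filter (\<lambda>w. adj F w u) [0..<length F]) < 4
      then branch K F D (filter (\<lambda>t. t ! u) (types F (D @ map (single_cube K) S))) chs
      else False)"
| "branch K F D [] chs = True"
| "branch K F D (t # ts) [] = False"
| "branch K F D (t # ts) (ch # chs) =
     (if length t = length F
      then if check K (t # F) (map (Cons None) D) ch then branch K F (map Some t # D) ts chs else False
      else False)"

section \<open>Soundness of the checker\<close>

lemma row_colouredD:
  "row_coloured t ds c \<Longrightarrow> i < length t \<Longrightarrow> t ! i \<Longrightarrow> i < length ds \<and> ds ! i \<noteq> c"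
proof (induction t ds c arbitrary: i rule: row_coloured.induct)
  case (1 t d ds c)
  then show ?case by (cases i) (auto split: if_splits)
next
  case (2 t d ds c)
  then show ?case by (cases i) auto
qed auto

lemma disjoint_lists_iff: "disjoint_lists cs ds \<longleftrightarrow> set cs \<inter> set ds = {}"
  by (induction cs ds rule: disjoint_lists.induct) auto

lemma class_okD:
  assumes "class_ok cF Q (t, c)"
  shows "\<forall>a \<in> set c. a < 4 \<and> row_coloured t cF a"
    and "(\<exists>a. c = [a] \<and> clash Q t t) \<or>
      (\<exists>a b. c = [a, b] \<and> a \<noteq> b \<and> True \<in> set t \<and> False \<in> set t)"
  using assms
  by (induction cF Q "(t, c)" rule: class_ok.induct) (auto split: if_splits)

lemma compatible_withD:
  "compatible_with Q t c T \<Longrightarrow> (t', c') \<in> set T \<Longrightarrow> set c \<inter> set c' = {} \<or> clash Q t t'"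
  by (induction Q t c T rule: compatible_with.induct) (auto split: if_splits simp: disjoint_lists_iff)

text \<open>Each pair of entries is compared once, in the order of the list, so the clash may come
  out with the two types in either order.\<close>

lemma classes_okD:
  assumes "classes_ok cF Q T"
  shows "(t, c) \<in> set T \<Longrightarrow> class_ok cF Q (t, c)"
    and "(t, c) \<in> set T \<Longrightarrow> (t', c') \<in> set T \<Longrightarrow> t \<noteq> t' \<Longrightarrow>
      set c \<inter> set c' = {} \<or> clash Q t t' \<or> clash Q t' t"
proof -
  show "(t, c) \<in> set T \<Longrightarrow> class_ok cF Q (t, c)"
    using assms by (induction cF Q T rule: classes_ok.induct) (auto split: if_splits)
  show "(t, c) \<in> set T \<Longrightarrow> (t', c') \<in> set T \<Longrightarrow> t \<noteq> t' \<Longrightarrow>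
      set c \<inter> set c' = {} \<or> clash Q t t' \<or> clash Q t' t"
    using assms
  proof (induction cF Q T rule: classes_ok.induct)
    case (2 cF Q s d T)
    then show ?case
      using compatible_withD[of Q s d T t c] compatible_withD[of Q s d T t' c']
      by (auto split: if_splits)
  qed simp
qed

lemma partition_types_complete:
  assumes "partition_types ts cs T U = (T', U')"
  shows "set ts \<union> fst ` set T \<union> set U \<subseteq> fst ` set T' \<union> set U'"
  using assms by (induction ts cs T U rule: partition_types.induct) auto

lemma properly_colouredD:
  assumes "properly_coloured F cs" "triangular F"
  shows "length cs = length F" "\<forall>c \<in> set cs. c < 4"
    and "i < length F \<Longrightarrow> j < length F \<Longrightarrow> adj F i j \<Longrightarrow> cs ! i \<noteq> cs ! j"
  using assms
proof (induction F cs arbitrary: i j rule: properly_coloured.induct)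
  case (3 t F c cs)
  {
    case 1
    then show ?case using 3 by (auto split: if_splits)
  next
    case 2
    then show ?case using 3 by (auto split: if_splits)
  next
    case prems: 3
    then have row: "row_coloured t cs c" "length t = length F"
      and IH: "\<And>i j. i < length F \<Longrightarrow> j < length F \<Longrightarrow> adj F i j \<Longrightarrow> cs ! i \<noteq> cs ! j"
      using 3 by (auto split: if_splits)
    show ?case
      using prems row_colouredD[OF row(1)] row(2) IH
      by (cases i; cases j) fastforce+
  }
qed auto

section \<open>From an accepted certificate to a contradiction\<close>

context critical_graph
begin

lemma realizes_triangular: "realizes xs F \<Longrightarrow> triangular F"
  by (induction xs F rule: realizes.induct) (auto dest: realizesD(1))

definition avoids :: "'a list \<Rightarrow> cube list \<Rightarrow> bool" where
  "avoids xs D \<longleftrightarrow> (\<forall>y \<in> V - set xs. \<forall>q \<in> set D. \<not> matches q (map (E y) xs))"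

text \<open>The colours of the copy and those of the classes are glued to a 4-colouring of the whole
  graph. In a class with two colours the bipartition of the class decides between them.\<close>

lemma colouring_contradiction:
  assumes xs: "realizes xs F" and cF: "properly_coloured F cF" and T: "classes_ok cF Q T"
    and cover: "\<And>y. y \<in> V - set xs \<Longrightarrow> map (E y) xs \<in> fst ` set T"
    and clash: "\<And>y z. y \<in> V - set xs \<Longrightarrow> z \<in> V - set xs \<Longrightarrow>
      clash Q (map (E y) xs) (map (E z) xs) \<Longrightarrow> \<not> E y z"
  shows False
proof -
  define ty where "ty y = map (E y) xs" for y
  \<comment> \<open>Fixes one entry of \<open>T\<close> for each type, so that all vertices of a
    type draw on the same colours.\<close>
  define ct where "ct t = the (map_of T t)" for t
  have len: "length cF = length xs" "\<forall>c \<in> set cF. c < 4" "distinct xs"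
    using properly_colouredD(1,2)[OF cF realizes_triangular[OF xs]] realizesD(1,2)[OF xs] by auto
  have ct: "(ty y, ct (ty y)) \<in> set T" if "y \<in> V - set xs" for y
    using cover[OF that] unfolding ct_def ty_def
    by (metis map_of_SomeD map_of_eq_None_iff option.collapse)
  have cls: "class_ok cF Q (ty y, ct (ty y))" if "y \<in> V - set xs" for y
    using classes_okD(1)[OF T ct[OF that]] .
  have "\<forall>t. \<exists>\<beta> :: 'a \<Rightarrow> bool. length t = length xs \<longrightarrow> True \<in> set t \<longrightarrow> False \<in> set t \<longrightarrow>
      (\<forall>y \<in> V - set xs. \<forall>z \<in> V - set xs. ty y = t \<longrightarrow> ty z = t \<longrightarrow> E y z \<longrightarrow> \<beta> y \<noteq> \<beta> z)"
    using type_class_bipartite[OF realizesD(3)[OF xs]] unfolding ty_def by blast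
  then obtain \<beta> :: "bool list \<Rightarrow> 'a \<Rightarrow> bool" where
    \<beta>: "\<And>t y z. \<lbrakk>length t = length xs; True \<in> set t; False \<in> set t; y \<in> V - set xs; z \<in> V - set xs;
      ty y = t; ty z = t; E y z\<rbrakk> \<Longrightarrow> \<beta> t y \<noteq> \<beta> t z"
    by metis
  \<comment> \<open>The last branch serves the classes with one colour, whose only element is
    \<open>hd c\<close>.\<close>
  define pick where "pick y = (case ct (ty y) of [a, b] \<Rightarrow> if \<beta> (ty y) y then a else b | c \<Rightarrow> hd c)" for y
  define \<chi> where "\<chi> y = (if y \<in> set xs then the (map_of (zip xs cF) y) else pick y)" for y
  have inner: "\<chi> (xs ! i) = cF ! i" if "i < length xs" for i
    using that len by (simp add: \<chi>_def map_of_zip_nth)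
  have pick_in: "pick y \<in> set (ct (ty y))" if "y \<in> V - set xs" for y
    using class_okD(2)[OF cls[OF that]] by (auto simp: pick_def)
  have outer: "\<chi> y = pick y" if "y \<in> V - set xs" for y using that by (simp add: \<chi>_def)
  have "\<chi> v < 4" if "v \<in> V" for v
  proof (cases "v \<in> set xs")
    case True
    then show ?thesis using inner len by (metis in_set_conv_nth nth_mem)
  next
    case False
    then show ?thesis
      using that pick_in[of v] class_okD(1)[OF cls[of v]] outer[of v] by auto
  qed
  moreover
  have mixed: "\<chi> y \<noteq> \<chi> x" if yx: "y \<in> V - set xs" "x \<in> set xs" "E y x" for x y
  proof -
    obtain i where i: "i < length xs" "x = xs ! i" using yx(2) by (metis in_set_conv_nth)
    have "row_coloured (ty y) cF (pick y)"
      using class_okD(1)[OF cls[OF yx(1)]] pick_in[OF yx(1)] by blast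
    then have "cF ! i \<noteq> pick y"
      using row_colouredD[of "ty y" cF "pick y" i] i yx(3) by (simp add: ty_def)
    then show ?thesis using inner i outer[OF yx(1)] by simp
  qed
  have "\<chi> u \<noteq> \<chi> v" if uv: "u \<in> V" "v \<in> V" "E u v" for u v
  proof -
    consider "u \<in> set xs" "v \<in> set xs" | "u \<in> set xs" "v \<notin> set xs" | "u \<notin> set xs" "v \<in> set xs"
      | "u \<notin> set xs" "v \<notin> set xs" by blast
    then show ?thesis
    proof cases
      case 1
      then obtain i j where ij: "i < length xs" "u = xs ! i" "j < length xs" "v = xs ! j"
        by (metis in_set_conv_nth)
      then have "adj F i j" using realizes_adj[OF xs] uv(3) by blast
      then have "cF ! i \<noteq> cF ! j"
        using properly_colouredD(3)[OF cF realizes_triangular[OF xs]] ij realizesD(1)[OF xs] by simp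
      then show ?thesis using ij inner by simp
    next
      case 2
      then show ?thesis using mixed[of v u] uv E_sym[OF uv(3)] by simp
    next
      case 3
      then show ?thesis using mixed[of u v] uv by simp
    next
      case 4
      then have o: "u \<in> V - set xs" "v \<in> V - set xs" using uv by auto
      show ?thesis
      proof (cases "ty u = ty v")
        case True
        \<comment> \<open>An edge inside the class shows that it was not certified as independent,
          so it has two colours.\<close>
        have nc: "\<not> clash Q (ty u) (ty u)"
          using clash[OF o] uv(3) True unfolding ty_def by metis
        then obtain a b where ab: "ct (ty u) = [a, b]" "a \<noteq> b" "True \<in> set (ty u)" "False \<in> set (ty u)"
          using class_okD(2)[OF cls[OF o(1)]] by blast
        have "length (ty u) = length xs" by (simp add: ty_def)
        then have "\<beta> (ty u) u \<noteq> \<beta> (ty u) v"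
          using \<beta>[OF _ ab(3,4) o refl True[symmetric] uv(3)] by blast
        moreover have "pick u = (if \<beta> (ty u) u then a else b)"
          using ab(1) by (simp add: pick_def)
        moreover have "pick v = (if \<beta> (ty u) v then a else b)"
          using ab(1) True[symmetric] by (simp add: pick_def)
        ultimately show ?thesis using ab(2) outer[OF o(1)] outer[OF o(2)] by auto
      next
        case False
        have "\<not> clash Q (ty u) (ty v)" "\<not> clash Q (ty v) (ty u)"
          using clash[OF o] clash[OF o(2,1)] uv(3) E_sym[OF uv(3)] unfolding ty_def by blast+
        then have "set (ct (ty u)) \<inter> set (ct (ty v)) = {}"
          using classes_okD(2)[OF T ct[OF o(1)] ct[OF o(2)] False] by blast
        then show ?thesis using pick_in[OF o(1)] pick_in[OF o(2)] outer o by auto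
      qed
    qed
  qed
  ultimately show False using not_four_colourable unfolding four_colourable_def by blast
qed

lemma type_in_types:
  assumes "known K" "witnesses_ok K F S" "realizes xs F" "avoids xs D" "y \<in> V - set xs"
  shows "map (E y) xs \<in> set (types F (D @ map (single_cube K) S))"
proof (rule types_complete)
  show "length (map (E y) xs) = length F" using realizesD(1)[OF assms(3)] by simp
  show "\<forall>q \<in> set (D @ map (single_cube K) S). \<not> matches q (map (E y) xs)"
    using assms single_sound[OF assms(1) _ assms(3,5)]
    by (auto simp: avoids_def witnesses_ok_def list_all_iff)
qed

text \<open>\<open>avoids\<close> is the invariant of the simultaneous induction. Refuting a type
  concerns all vertices outside the given copy, so the refutation may be used for the remaining
  types, and it stays valid when the copy grows.\<close>

lemma check_sound:
  assumes "known K"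
  shows "check K F D ch \<Longrightarrow> realizes xs F \<Longrightarrow> avoids xs D \<Longrightarrow> False"
    and "branch K F D ts chs \<Longrightarrow> realizes xs F \<Longrightarrow> avoids xs D \<Longrightarrow> y \<in> V - set xs \<Longrightarrow>
      map (E y) xs \<in> set ts \<Longrightarrow> False"
  using assms
proof (induction K F D ch and K F D ts chs arbitrary: xs and xs y rule: check_branch.induct)
  case (1 K F D S Q cF cs chs)
  obtain T U where TU: "partition_types (types F (D @ map (single_cube K) S)) cs [] [] = (T, U)"
    by fastforce
  have ok: "witnesses_ok K F S" "list_all (pair_ok K F) Q" "properly_coloured F cF"
    "classes_ok cF (map (pair_cube K) Q) T" "branch K F D U chs"
    using "1.prems"(1) TU by (auto split: if_splits)
  \<comment> \<open>Each uncoloured type is refuted by its own branch, so the vertices outside the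
    copy all have coloured types.\<close>
  have U: "map (E y) xs \<notin> set U" if "y \<in> V - set xs" for y
    using "1.IH"[OF _ TU[symmetric] _ ok(5) "1.prems"(2,3) that _ "1.prems"(4)] ok by auto
  show ?case
  proof (rule colouring_contradiction[OF "1.prems"(2) ok(3,4)])
    show "map (E y) xs \<in> fst ` set T" if "y \<in> V - set xs" for y
      using type_in_types[OF "1.prems"(4) ok(1) "1.prems"(2,3) that] U[OF that]
        partition_types_complete[OF TU] by auto
    show "\<not> E y z" if "y \<in> V - set xs" "z \<in> V - set xs"
      "clash (map (pair_cube K) Q) (map (E y) xs) (map (E z) xs)" for y z
      using clash_sound[OF that(3) "1.prems"(4) ok(2) "1.prems"(2) that(1,2)] .
  qed
next
  case (2 K F D S u v chs)
  have ok: "witnesses_ok K F S" "u < length F" "v < length F" "u \<noteq> v" "\<not> adj F u v"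
    and dom: "\<And>w. w < length F \<Longrightarrow> adj F w u \<Longrightarrow> adj F w v"
    and br: "branch K F D (filter (\<lambda>t. t ! u \<and> \<not> t ! v) (types F (D @ map (single_cube K) S))) chs"
    using "2.prems"(1) by (auto split: if_splits simp: list_all_iff)
  note xs = realizesD[OF "2.prems"(2)]
  have uv: "xs ! u \<in> V" "xs ! v \<in> V" using ok xs by auto
  have "xs ! u \<noteq> xs ! v" using ok xs by (simp add: nth_eq_iff_index_eq)
  moreover have "\<not> E (xs ! u) (xs ! v)" using realizes_adj[OF "2.prems"(2)] ok xs(1) by simp
  ultimately obtain w where w: "w \<in> V" "E w (xs ! u)" "\<not> E w (xs ! v)"
    using private_neighbour[OF uv] by blast
  \<comment> \<open>The checker has verified that inside the copy every neighbour of
    \<open>xs ! u\<close> is a neighbour of \<open>xs ! v\<close>, so the private neighbour is a new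
    vertex.\<close>
  have "w \<notin> set xs"
  proof
    assume "w \<in> set xs"
    then obtain i where i: "i < length xs" "w = xs ! i" by (metis in_set_conv_nth)
    then show False
      using w dom[of i] ok xs(1) realizes_adj[OF "2.prems"(2)] by auto
  qed
  then have o: "w \<in> V - set xs" using w by simp
  have "map (E w) xs \<in> set (filter (\<lambda>t. t ! u \<and> \<not> t ! v) (types F (D @ map (single_cube K) S)))"
    using type_in_types[OF "2.prems"(4) ok(1) "2.prems"(2,3) o] w ok xs(1) by simp
  then show ?case
    using "2.IH"[OF _ br "2.prems"(2,3) o _ "2.prems"(4)] "2.prems"(1) by (auto split: if_splits)
next
  case (3 K F D S u chs)
  have ok: "witnesses_ok K F S" "u < length F"
    and deg: "length (filter (\<lambda>w. adj F w u) [0..<length F]) < 4"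
    and br: "branch K F D (filter (\<lambda>t. t ! u) (types F (D @ map (single_cube K) S))) chs"
    using "3.prems"(1) by (auto split: if_splits)
  note xs = realizesD[OF "3.prems"(2)]
  have uV: "xs ! u \<in> V" using ok xs by auto
  \<comment> \<open>The neighbours of \<open>xs ! u\<close> inside the copy; a neighbour outside
    this set is therefore a new vertex.\<close>
  define X where "X = (!) xs ` set (filter (\<lambda>w. adj F w u) [0..<length F])"
  have "card X < 4"
    unfolding X_def
    using deg le_trans[OF card_image_le[OF finite_set] card_length] le_less_trans by blast
  then obtain w where w: "w \<in> V" "w \<notin> X" "E w (xs ! u)"
    using outside_neighbour[OF uV, of X] by (auto simp: X_def)
  have "w \<notin> set xs"
  proof
    assume "w \<in> set xs"
    then obtain i where i: "i < length xs" "w = xs ! i" by (metis in_set_conv_nth)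
    then show False
      using w ok xs(1) realizes_adj[OF "3.prems"(2)] by (auto simp: X_def)
  qed
  then have o: "w \<in> V - set xs" using w by simp
  have "map (E w) xs \<in> set (filter (\<lambda>t. t ! u) (types F (D @ map (single_cube K) S)))"
    using type_in_types[OF "3.prems"(4) ok(1) "3.prems"(2,3) o] w ok xs(1) by simp
  then show ?case
    using "3.IH"[OF _ br "3.prems"(2,3) o _ "3.prems"(4)] "3.prems"(1) by (auto split: if_splits)
next
  case (4 K F D chs)
  then show ?case by simp
next
  case (5 K F D t ts)
  then show ?case by simp
next
  case (6 K F D t ts ch chs)
  have ok: "length t = length F" "check K (t # F) (map (Cons None) D) ch" "branch K F (map Some t # D) ts chs"
    using "6.prems"(1) by (auto split: if_splits)
  \<comment> \<open>Proved for every vertex outside the copy and not just for \<open>y\<close>,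
    because the type is then added to \<open>D\<close>.\<close>
  have no_t: "map (E z) xs \<noteq> t" if z: "z \<in> V - set xs" for z
  proof
    assume "map (E z) xs = t"
    then have "realizes (z # xs) (t # F)" using z "6.prems"(2) by simp
    \<comment> \<open>The new vertex stands in front, so each old cube gets a free first
      entry.\<close>
    moreover have "avoids (z # xs) (map (Cons None) D)"
      using "6.prems"(3) by (auto simp: avoids_def)
    ultimately show False using "6.IH"(1)[OF ok(1,2)] "6.prems"(6) by blast
  qed
  show ?case
  proof (cases "map (E y) xs = t")
    case True
    then show ?thesis using no_t "6.prems"(4) by blast
  next
    case False
    have "\<not> matches (map Some t) (map (E z) xs)" if "z \<in> V - set xs" for z
      using no_t[OF that] ok(1) realizesD(1)[OF "6.prems"(2)] by (simp add: matches_map_Some)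
    then have "avoids xs (map Some t # D)" using "6.prems"(3) by (auto simp: avoids_def)
    then show ?thesis
      using "6.IH"(2)[OF ok "6.prems"(2) _ "6.prems"(4) _ "6.prems"(6)] False "6.prems"(5) by auto
  qed
qed

end

section \<open>The certificate\<close>

fun rows_of :: "nat list list \<Rightarrow> rows" where
  "rows_of [] = []"
| "rows_of (t # F) = map (\<lambda>b. b = 1) t # rows_of F"

text \<open>
  A step \<open>(F, ps, ch)\<close> excludes \<open>F\<close> by means of the patterns at the
  positions \<open>ps\<close> among the two forbidden graphs and the graphs of the preceding
  steps.
\<close>

fun check_steps :: "rows list \<Rightarrow> (nat list list \<times> nat list \<times> cert) list \<Rightarrow> bool" where
  "check_steps K [] = True"
| "check_steps K ((F, ps, ch) # steps) =
     (if triangular (rows_of F) \<and> list_all (\<lambda>p. p < length K) ps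
      then if check (map ((!) K) ps) (rows_of F) [] ch then check_steps (K @ [rows_of F]) steps else False
      else False)"

text \<open>A graph joins \<open>K\<close> only after its own step has succeeded, and
  \<open>ps\<close> is restricted to positions already in \<open>K\<close>, so the exclusions are
  not circular.\<close>

lemma (in critical_graph) check_steps_sound:
  "check_steps K steps \<Longrightarrow> known K \<Longrightarrow> (F, ps, ch) \<in> set steps \<Longrightarrow> absent (rows_of F)"
proof (induction K steps rule: check_steps.induct)
  case (2 K F' ps' ch' steps)
  have ok: "triangular (rows_of F')" "list_all (\<lambda>p. p < length K) ps'"
    "check (map ((!) K) ps') (rows_of F') [] ch'" "check_steps (K @ [rows_of F']) steps"
    using "2.prems"(1) by (auto split: if_splits)
  have "known (map ((!) K) ps')"
    using "2.prems"(2) ok(2) by (auto simp: known_def list_all_iff)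
  then have F': "absent (rows_of F')"
    using check_sound(1)[OF _ ok(3)] by (auto simp: absent_def avoids_def)
  then have "known (K @ [rows_of F'])" using "2.prems"(2) ok(1) by (auto simp: known_def)
  then show ?case using "2.IH" ok F' "2.prems"(3) by auto
qed simp

text \<open>A witness counts positions in the selection \<open>ps\<close>. Every selection begins
  with 0 and 1, so in all witnesses 0 stands for K_4 and 1 for the co-gem. Twenty graphs on six
  vertices are followed by K_3 + K_1, K_2 + 2K_1, the triangle with a pendant edge, P_3 + K_1, and
  K_1.\<close>

definition steps :: "(nat list list \<times> nat list \<times> cert) list" where
  "steps = [
    ([[1,0,0,0,0], [1,0,0,1], [0,0,0], [1,1], [1], []], [0,1],
      Compare [(1,4,[2,3,4,1]), (1,3,[1,0,5,3,2]), (1,3,[1,0,5,0,3,2]), (0,3,[0,0,0,1,2,3]),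
      (1,3,[1,0,5,2,0,3])] 2 0 [Colour [(0,3,[1,0,2,3]), (0,3,[0,0,0,0,1,2,3]), (1,4,[0,2,3,4,1]),
      (1,4,[0,4,3,2,1]), (1,3,[2,5,0,3,1]), (1,3,[0,5,0,1,3,2]), (1,3,[2,1,0,3,5]),
      (1,3,[3,1,0,2,5]), (1,3,[0,5,0,1,0,3,2]), (1,4,[4,2,3,0,1]), (1,3,[1,5,0,0,3,2]),
      (1,3,[0,5,0,1,2,0,3]), (1,0,[0,2,3,0,0,5,4]), (1,3,[2,1,0,3,0,5]), (1,3,[3,1,0,2,0,5]),
      (1,3,[0,1,0,5,0,2,3]), (1,3,[1,5,0,0,0,3,2]), (1,3,[3,5,0,2,1]), (1,3,[3,1,0,2,0,0,5]),
      (1,3,[0,1,0,5,0,3,2]), (1,0,[0,0,3,2,5,0,4])] [(0,3,2,[1,0,0,2]), (1,4,3,[0,0,0,1,3,2]),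
      (1,4,3,[0,1,0,0,2,0,3]), (1,4,3,[1,0,0,0,0,3,2]), (1,4,3,[0,0,3,2,1]),
      (0,3,2,[0,0,0,0,1,2]), (0,3,2,[0,0,0,0,1,0,2]), (0,3,2,[0,0,0,0,0,1,2]),
      (1,4,3,[0,0,0,1,0,2,3]), (1,4,3,[0,0,0,1,3,0,2]), (0,3,2,[0,1,2]), (0,3,2,[1,0,2]),
      (0,3,2,[0,0,1,2]), (1,4,3,[2,1,0,3]), (1,4,3,[3,1,0,2]), (1,4,3,[0,0,0,1,2,3]),
      (0,3,2,[0,0,1,0,0,0,2])] [2,1,3,1,2,1,0]
      [[1,2],[2],[1],[0],[1,2],[1],[0,2],[2],[0,1],[1],[0],[2],[0],[1],[3],[3],[3],[3],[3],[3],[3]]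
      []]),
    ([[0,0,0,0,1], [1,0,0,1], [0,0,0], [1,1], [1], []], [0,1,2],
      Compare [(1,3,[5,2,3,1]), (1,3,[5,1,0,3,2]), (1,3,[5,0,1,2,3]), (0,3,[0,0,0,1,2,3]),
      (1,4,[4,0,1,0,2,3])] 0 1 [Colour [(0,3,[0,0,0,0,1,2,3]), (0,3,[1,2,0,0,0,0,3]),
      (1,3,[2,3,0,5,1]), (1,3,[3,2,0,5,1]), (1,3,[0,1,0,5,3,2]), (1,4,[0,2,0,1,0,4,3]),
      (1,4,[0,4,0,1,0,2,3]), (1,3,[2,3,0,1,0,5]), (1,3,[1,0,5,0,3,2]), (1,3,[1,0,2,3,5]),
      (1,3,[3,2,0,1,5]), (1,3,[5,0,3,2,1]), (1,3,[0,1,0,5,2,3]), (1,3,[5,0,1,0,2,3]),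
      (1,0,[0,0,3,2,0,5,4]), (1,3,[0,5,1,0,3,2]), (1,3,[0,1,2,3,5]), (1,3,[2,3,5,0,1]),
      (1,3,[0,5,2,3,1]), (1,3,[0,1,3,2,0,5]), (2,4,[0,1,6,4,0,3,2]), (2,2,[0,0,2,1,4,5,6])]
      [(0,3,2,[1,2]), (0,3,2,[0,0,1,2]), (0,3,2,[0,0,0,0,1,2]), (1,4,3,[1,0,2,3]),
      (1,4,3,[0,1,3,2]), (1,4,3,[2,3,1]), (1,4,3,[3,2,1]), (1,4,3,[0,0,0,1,2,3]),
      (1,4,3,[0,0,0,1,3,2]), (0,3,2,[0,0,0,0,0,1,2]), (0,3,2,[0,0,0,0,1,0,2]),
      (0,3,2,[0,0,1,0,0,0,2]), (0,3,2,[0,1,0,0,0,0,2]), (0,3,2,[1,0,0,0,0,0,2]),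
      (2,5,4,[0,1,0,4,0,3,2])] [1,2,3,2,2,1,0]
      [[2,3],[2],[3],[1,3],[1,3],[2],[],[0],[3],[0],[2],[0],[0],[0],[0],[0],[0],[0],[0]] [Colour
      [(0,3,[1,0,0,2,3]), (0,3,[0,0,0,0,0,1,2,3]), (0,3,[0,1,2,0,0,0,0,3]),
      (1,4,[0,0,2,0,1,0,4,3]), (1,4,[0,0,4,0,1,0,2,3]), (1,3,[0,0,1,2,3,5]), (1,3,[0,2,3,0,5,1]),
      (1,3,[0,3,2,0,5,1]), (1,3,[0,2,3,0,1,0,5]), (1,3,[0,0,1,5,0,3,2]), (1,3,[0,2,3,1,0,5]),
      (1,3,[0,5,0,3,2,1]), (1,0,[0,0,0,3,2,0,5,4]), (1,3,[2,0,1,0,3,0,5]), (1,3,[0,2,3,5,0,0,1]),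
      (1,3,[0,5,0,1,0,2,3]), (1,3,[0,0,5,2,3,0,1]), (1,3,[5,0,1,0,0,2,3]), (1,3,[0,3,2,0,1,5]),
      (1,3,[2,0,5,0,3,1]), (1,3,[2,1,0,3,0,0,5]), (1,3,[3,0,1,0,2,5]), (1,3,[3,0,5,0,2,1]),
      (1,3,[3,5,0,0,2,1]), (1,3,[1,0,5,0,0,3,2]), (0,3,[1,0,0,2,0,0,0,3]),
      (1,0,[3,0,0,0,2,0,5,4]), (2,1,[4,0,1,5,6,3]), (2,1,[4,0,1,6,5,3]), (2,1,[6,0,1,4,5,3]),
      (2,4,[0,0,1,6,4,0,3,2]), (2,4,[6,0,1,0,4,0,3,2]), (2,2,[0,0,0,2,1,4,5,6])] [(0,3,2,[0,1,2]),
      (1,4,3,[2,1,0,0,3]), (1,4,3,[3,0,0,2,0,0,1]), (1,4,3,[2,0,1,3]), (1,4,3,[1,3,2]),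
      (0,3,2,[0,0,0,1,0,0,0,2]), (0,3,2,[1,0,0,0,0,0,0,2]), (1,4,3,[1,2,3]),
      (1,4,3,[0,0,0,0,1,3,2]), (0,3,2,[0,0,0,0,0,0,1,2]), (0,3,2,[0,0,0,0,0,1,0,2]),
      (0,3,2,[0,0,1,0,0,0,0,2]), (0,3,2,[0,1,0,0,0,0,0,2]), (2,5,4,[0,0,1,0,4,0,3,2])]
      [2,3,1,3,1,2,1,0] [[1,3],[2],[1],[2,3],[2,3],[2],[2],[3],[1],[0],[0],[1],[3],[0],[0]] []],
      Colour [(0,3,[1,0,0,0,2,3]), (1,4,[3,2,0,1,4]), (1,3,[0,5,2,3,1]), (1,3,[0,5,3,2,1]),
      (1,3,[0,1,0,5,2,3]), (1,3,[0,1,0,5,3,2]), (1,3,[0,5,0,1,3,2]), (1,0,[0,0,3,2,5,0,4]),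
      (0,3,[0,0,0,0,1,2,3]), (1,4,[2,0,0,1,3,0,4]), (1,3,[0,5,1,0,3,2]), (1,4,[4,3,0,1,0,0,2]),
      (1,4,[1,0,3,4,0,0,2]), (1,3,[0,1,3,2,0,5]), (1,3,[0,1,3,2,5]), (1,3,[0,5,0,1,2,3]),
      (2,5,[2,1,4,5,3]), (2,4,[0,1,6,4,0,3,2]), (2,2,[0,0,2,1,4,5,6])] [(0,3,2,[0,0,1,2]),
      (1,4,3,[0,1,2,3]), (0,3,2,[0,0,0,0,1,2]), (1,4,3,[3,2,1]), (0,3,2,[1,0,0,0,2]),
      (0,3,2,[1,0,0,0,0,2]), (1,4,3,[0,0,0,1,2,3]), (1,4,3,[0,0,0,1,3,2]),
      (2,5,4,[0,1,0,4,0,3,2])] [0,1,1,0,2,1,0]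
      [[1,2],[3],[3],[0],[0],[3],[3],[3],[3],[3],[3],[3],[1,2],[2],[1],[1,2],[1,2],[],[3],[3],[3],[3],[3],[3]]
      [Colour [(0,3,[0,1,0,0,0,2,3]), (0,3,[1,0,0,2,0,0,0,3]), (1,0,[4,3,2,5]),
      (1,3,[0,0,5,2,3,1]), (1,3,[2,0,5,3,0,1]), (1,3,[0,0,5,1,0,3,2]), (1,4,[4,0,0,0,1,2,0,3]),
      (1,3,[2,0,1,3,0,5]), (1,3,[3,0,1,2,0,5]), (1,3,[0,0,1,0,5,2,3]), (1,4,[2,3,4,0,1]),
      (1,4,[3,4,0,0,1,0,0,2]), (1,4,[4,0,0,3,2,1]), (1,3,[1,0,0,0,5,3,2]), (1,3,[0,0,1,3,2,0,5]),
      (1,3,[0,0,1,5,0,3,2]), (0,3,[0,0,0,0,0,1,2,3]), (1,3,[0,0,5,0,1,3,2]),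
      (1,4,[0,1,0,3,4,0,0,2]), (1,4,[2,0,1,3,4]), (1,3,[0,0,5,0,1,2,3]), (1,4,[0,2,0,0,1,0,3,4]),
      (2,4,[0,0,1,6,4,0,3,2]), (2,5,[0,2,1,4,5,3]), (2,2,[2,6,0,1,0,4,5]),
      (2,2,[0,0,0,2,1,4,5,6])] [(0,3,2,[0,0,0,1,2]), (0,3,2,[1,0,0,2]), (1,4,3,[2,0,1,3]),
      (1,4,3,[3,0,1,2]), (0,3,2,[1,2]), (0,3,2,[0,0,0,0,0,1,2]), (0,3,2,[0,1,0,0,0,2]),
      (0,3,2,[0,1,0,0,0,0,2]), (1,4,3,[0,0,0,0,1,2,3]), (1,4,3,[0,0,0,0,1,3,2]),
      (0,3,2,[0,0,0,1,0,0,0,2]), (2,5,4,[0,2,1,0,4,3])] [1,3,1,3,1,2,1,0]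
      [[2],[0],[1,2],[2],[1],[1],[0],[3],[0],[0],[0],[0],[0],[2],[2],[0],[0],[0]] []], Colour
      [(0,3,[0,0,0,0,1,2,3]), (1,3,[0,5,2,3,1]), (1,3,[0,5,3,2,1]), (1,3,[0,1,0,5,2,3]),
      (1,3,[0,1,0,5,3,2]), (1,3,[0,5,0,1,3,2]), (1,4,[0,2,0,1,0,4,3]), (1,0,[4,0,2,3,5]),
      (0,3,[1,0,0,0,2,3]), (1,3,[0,1,3,2,5]), (1,3,[0,5,1,0,3,2]), (1,0,[0,0,3,2,0,5,4]),
      (1,4,[3,2,1,0,4]), (1,3,[0,1,3,2,0,5]), (1,3,[0,5,0,1,2,3]), (1,0,[3,0,0,2,0,4,5]),
      (1,0,[2,0,5,0,0,3,4]), (2,4,[2,1,4,6,3]), (2,2,[6,0,1,2,4,5]), (2,4,[0,1,6,4,0,3,2]),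
      (2,2,[0,0,2,1,4,5,6])] [(0,3,2,[0,0,1,2]), (0,3,2,[0,0,0,0,1,2]), (1,4,3,[0,1,2,3]),
      (1,4,3,[0,1,3,2]), (0,3,2,[1,0,0,2]), (0,3,2,[0,0,1,0,0,0,2]), (1,4,3,[2,0,0,3,0,0,1]),
      (1,4,3,[1,0,3,0,0,0,2]), (0,3,2,[1,0,0,0,2]), (0,3,2,[1,0,0,0,0,2]), (1,4,3,[0,0,0,1,2,3]),
      (1,4,3,[0,0,0,1,3,2])] [0,2,2,1,2,1,0]
      [[1],[0],[0],[0],[0],[3],[0],[3],[0],[3],[0],[1,2],[2],[1],[2],[2],[1],[3],[3],[3],[3],[3],[3],[3]]
      []]),
    ([[0,0,0,0,1], [0,1,0,0], [0,0,0], [0,0], [1], []], [0,1,2,3],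
      Compare [(1,3,[1,2,0,3,5]), (1,3,[1,3,0,2,5]), (1,4,[2,0,0,1,4,3]), (1,4,[2,0,1,0,4,3]),
      (1,3,[2,0,1,5,0,3]), (1,3,[2,0,5,1,0,3]), (3,5,[0,4,1,5,2,3]), (3,5,[3,4,1,5,0,2])] 4 0
      [Compare [(1,3,[0,1,3,5,2]), (1,3,[0,3,0,5,1,0,2]), (1,3,[0,0,0,5,1,2,3]),
      (1,3,[2,0,0,5,1,3]), (0,3,[1,0,0,0,0,2,3]), (1,4,[4,2,0,0,1,0,3])] 3 4 [Compare
      [(1,3,[0,0,5,2,0,3,1]), (1,3,[0,0,5,3,0,2,1]), (1,3,[2,0,5,0,3,0,1]), (1,3,[0,3,5,0,1,0,2]),
      (1,3,[3,1,5,0,2]), (1,4,[0,0,4,0,0,1,2,3]), (1,3,[0,0,0,0,5,1,2,3]),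
      (1,4,[0,0,4,0,1,0,2,3]), (1,3,[0,0,0,0,1,5,2,3]), (3,5,[0,2,0,4,1,5,3]),
      (2,1,[0,4,0,0,1,3,5,6]), (3,5,[0,0,2,4,1,5,0,3])] 2 6 [Degree [(0,3,[0,0,1,0,0,0,0,2,3]),
      (1,3,[0,0,2,0,0,1,5,3]), (1,3,[0,0,2,0,0,5,1,3]), (1,3,[0,0,0,0,3,1,2,5]),
      (1,4,[0,0,0,2,1,0,0,4,3]), (1,3,[0,1,0,0,0,0,5,3,2]), (1,3,[0,0,2,5,1,0,0,3]),
      (1,3,[0,0,0,0,0,5,1,3,2]), (1,3,[0,0,2,1,0,0,5,3]), (1,3,[0,3,0,0,1,2,0,5]),
      (1,3,[0,0,0,0,0,1,5,3,2]), (1,3,[2,0,1,3,5]), (1,3,[2,0,5,3,1]), (1,3,[5,1,2,0,0,0,0,3]),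
      (0,3,[1,0,0,2,0,0,0,0,3]), (1,3,[0,0,0,0,1,5,0,3,2]), (3,5,[0,0,0,0,4,1,5,2,3])] 7 [Compare
      [(1,3,[1,2,0,5,3]), (1,3,[1,3,0,5,2]), (1,3,[1,0,2,5,0,0,3]), (1,3,[1,0,3,5,0,0,2]),
      (1,3,[1,0,0,5,0,2,0,3]), (1,3,[1,0,0,5,0,3,0,2]), (1,4,[2,0,0,4,0,0,0,1,3]),
      (0,3,[0,0,0,1,0,0,0,0,2,3]), (1,4,[2,0,0,4,0,0,1,0,0,3]), (1,4,[2,0,0,4,1,0,0,0,3]),
      (1,3,[2,0,0,0,0,0,5,1,3]), (0,3,[0,1,0,0,2,0,0,0,0,3]), (1,3,[2,0,0,0,1,0,0,5,3]),
      (3,5,[0,0,0,0,2,4,1,5,0,3])] 3 0 [], Compare [(0,3,[0,0,0,1,0,0,0,0,2,3]),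
      (1,4,[2,0,0,0,0,0,0,1,3,4]), (1,3,[1,0,0,0,0,2,0,3,0,5]), (1,4,[2,0,0,3,0,0,0,1,0,4]),
      (1,4,[2,0,0,0,0,0,1,0,3,4]), (1,3,[1,0,2,0,0,5,3]), (1,3,[0,0,0,2,0,0,1,5,3]),
      (0,3,[0,1,0,0,2,0,0,0,0,3]), (1,3,[0,2,5,1,3]), (1,3,[0,3,5,1,2]),
      (1,3,[0,0,0,3,1,0,0,5,2]), (1,3,[0,0,0,2,1,0,0,5,3]), (1,3,[0,2,0,0,3,0,0,5,1]),
      (2,5,[0,0,0,0,1,4,0,5,3,2])] 9 0 []]]]]),
    ([[0,0,0,0,0], [0,0,0,0], [0,0,0], [1,1], [1], []], [0,1,3,4],
      Compare [(1,3,[0,1,5,2,3]), (1,3,[0,1,5,3,2]), (0,3,[0,0,0,1,2,3]), (1,3,[0,1,5,0,2,3]),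
      (1,3,[0,1,5,0,3,2]), (3,5,[1,3,5,2,4])] 2 1 [Degree [(0,3,[0,0,0,0,1,2,3]),
      (1,3,[0,0,1,5,0,2,3]), (1,3,[0,0,5,1,0,2,3]), (1,3,[3,0,1,2,0,0,5]), (1,3,[0,1,0,5,2,0,3]),
      (1,3,[1,5,0,0,2,0,3]), (1,3,[0,0,5,1,2,3]), (1,3,[0,1,0,5,3,2]), (1,3,[1,5,0,0,3,2]),
      (1,3,[0,0,1,5,2,3]), (2,5,[4,0,1,5,0,3,2]), (3,4,[2,0,3,4,0,1,6]), (2,5,[4,0,1,5,3,2]),
      (3,4,[2,0,3,4,1,6])] 6 []]),
    ([[1,0,1,1,0], [0,0,0,1], [0,0,0], [1,1], [1], []], [0,1,2,3,4],
      Compare [(1,3,[0,1,5,2,3]), (1,3,[0,1,5,3,2]), (0,3,[1,0,0,2,3]), (0,3,[0,0,0,1,2,3]),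
      (3,1,[6,1,3,4,5]), (3,1,[0,1,3,4,5,6])] 2 1 [Colour [(0,3,[0,1,0,0,2,3]), (1,4,[0,3,2,1,4]),
      (1,4,[0,3,4,1,2]), (1,3,[2,0,5,3,1]), (1,3,[0,0,1,5,2,3]), (1,3,[0,0,1,5,3,2]),
      (1,3,[0,0,5,1,3,2]), (1,4,[0,4,0,1,3,0,2]), (0,3,[0,0,0,0,1,2,3]), (1,4,[0,3,2,1,0,4]),
      (1,3,[1,0,5,0,3,2]), (1,3,[3,0,1,2,5]), (1,3,[3,0,5,2,1]), (1,4,[0,2,0,1,0,3,4]),
      (1,4,[1,0,2,0,4,0,3]), (1,3,[3,0,1,2,0,5]), (1,3,[0,0,5,1,2,3]), (1,4,[1,2,0,0,0,3,4]),
      (1,4,[1,4,0,0,0,3,2]), (3,5,[4,0,1,5,2,3]), (3,5,[4,0,1,5,3,2]), (3,1,[0,6,1,3,4,5]),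
      (4,4,[6,0,3,1,2,4]), (2,5,[4,1,0,5,0,2,3]), (4,2,[2,6,1,4,5]), (3,5,[2,0,1,3,4,5]),
      (3,5,[3,0,1,2,4,5]), (4,4,[2,0,3,4,1,6]), (4,4,[2,0,3,4,6,1]), (4,4,[1,0,3,6,2,4]),
      (2,5,[4,1,2,5,0,0,3]), (2,5,[4,0,1,5,0,3,2])] [(0,3,2,[1,0,0,2]), (0,3,2,[0,1,2]),
      (1,3,2,[0,0,2,5,1]), (0,3,2,[0,0,0,0,1,2]), (0,3,2,[0,0,1,0,0,0,2])] [0,0,1,3,2,1,0]
      [[0],[1,3],[2],[2],[2],[2],[2]] [], Compare [(0,3,[0,0,0,0,1,2,3]), (1,4,[0,2,0,1,0,3,4]),
      (1,3,[2,1,0,3,0,0,5]), (1,4,[0,2,0,1,3,0,4]), (1,3,[0,0,1,5,2,3]), (1,3,[0,0,1,5,3,2]),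
      (3,1,[0,0,1,3,4,5,6])] 6 1 [Colour [(0,3,[0,0,1,0,0,2,3]), (0,3,[1,0,0,2,0,0,0,3]),
      (0,3,[1,2,0,0,3]), (1,0,[4,0,2,3,5]), (1,4,[3,0,0,4,2,1]), (1,4,[0,3,0,1,4,2]),
      (1,4,[0,0,4,0,1,0,3,2]), (1,4,[3,0,1,0,4,0,0,2]), (1,3,[0,0,0,1,5,3,2]),
      (0,3,[0,0,0,0,0,1,2,3]), (1,4,[0,0,3,4,1,0,2]), (1,4,[0,0,0,2,1,0,4,3]),
      (1,4,[3,0,0,2,4,1]), (1,4,[0,0,2,3,1,0,0,4]), (1,3,[0,2,5,0,3,0,0,1]),
      (1,3,[0,0,0,5,1,2,3]), (1,4,[0,3,0,1,2,4]), (1,4,[3,2,1,0,0,0,0,4]), (1,0,[3,4,0,2,0,5]),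
      (0,3,[0,1,0,0,0,2,3]), (1,4,[3,0,0,4,2,0,1]), (1,4,[0,0,3,2,1,4]), (1,0,[0,4,2,0,5,3]),
      (1,4,[0,3,0,1,2,0,4]), (2,2,[6,4,1,2,5]), (2,2,[1,0,6,2,0,4,5]), (2,2,[2,6,0,1,0,4,5]),
      (3,0,[3,0,6,2,0,4,5]), (2,2,[2,0,0,0,1,4,5,6])] [(0,3,2,[0,0,1,2]), (0,3,2,[1,0,0,2]),
      (0,3,2,[0,1,0,0,0,2]), (0,3,2,[0,1,0,0,2]), (1,4,3,[0,1,2,3]), (0,3,2,[0,0,0,0,0,0,1,2]),
      (0,3,2,[1,2]), (0,3,2,[0,0,0,1,0,0,0,2]), (0,3,2,[1,0,0,0,2]), (1,4,3,[3,0,0,0,2,1])]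
      [3,0,0,2,2,2,1,0]
      [[3],[3],[3],[3],[1],[2],[1],[3],[3],[3],[3],[3],[1],[0],[0],[0],[0],[0],[0],[2],[2],[1]]
      [], Colour [(0,3,[0,0,1,0,0,2,3]), (0,3,[1,0,0,2,0,0,0,3]), (0,3,[1,2,0,0,3]),
      (1,0,[4,0,2,3,5]), (1,4,[3,0,0,4,2,1]), (1,4,[0,3,0,1,4,2]), (1,4,[0,0,4,0,1,0,3,2]),
      (1,4,[3,0,1,0,4,0,0,2]), (1,3,[0,0,0,1,5,3,2]), (0,3,[1,2,0,0,0,0,3]),
      (1,4,[0,3,0,1,2,0,4]), (1,4,[0,0,3,4,1,0,2]), (0,3,[0,0,0,0,0,1,2,3]), (1,4,[3,0,0,2,4,1]),
      (1,3,[0,2,5,0,3,0,0,1]), (1,4,[0,0,3,2,1,4]), (1,0,[0,4,2,0,5,3]), (1,4,[3,2,1,0,0,0,0,4]),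
      (1,4,[0,3,0,1,2,4]), (1,3,[0,0,0,5,1,3,2]), (1,0,[3,0,0,0,2,5,4]), (1,4,[0,0,4,0,1,3,0,2]),
      (0,3,[0,1,0,0,0,2,3]), (1,4,[0,0,2,0,1,0,3,4]), (2,2,[6,4,1,2,5]), (2,2,[2,0,4,0,1,5,6])]
      [(0,3,2,[0,0,1,2]), (0,3,2,[1,0,0,2]), (0,3,2,[0,1,0,0,2]), (0,3,2,[0,0,0,1,0,0,0,2]),
      (1,4,3,[0,1,2,3]), (0,3,2,[1,0,0,0,0,0,0,2]), (0,3,2,[0,0,1,0,0,2]), (1,4,3,[3,0,0,0,2,1]),
      (0,3,2,[1,0,0,0,2]), (0,3,2,[0,0,1,0,0,0,2])] [3,0,0,1,2,2,1,0]
      [[3],[3],[3],[3],[3],[2],[1],[3],[3],[3],[3],[3],[3],[0],[0],[0],[0],[0],[0],[2],[2],[1]]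
      [], Colour [(0,3,[1,2,0,0,0,3]), (0,3,[0,0,1,0,0,2,3]), (0,3,[1,0,0,2,0,0,0,3]),
      (1,0,[4,0,2,3,5]), (1,4,[3,0,0,4,2,0,1]), (1,3,[0,0,0,1,5,2,3]), (1,4,[0,3,0,1,4,0,2]),
      (1,4,[0,0,4,0,1,3,0,2]), (1,4,[3,0,1,0,4,0,0,2]), (1,4,[0,3,0,1,2,4]), (1,4,[0,0,3,4,1,2]),
      (0,3,[1,2,0,0,3]), (0,3,[0,0,0,0,0,1,2,3]), (1,4,[3,0,0,2,4,0,1]), (1,3,[0,2,5,0,3,0,0,1]),
      (1,0,[0,4,2,0,5,3]), (1,4,[3,2,1,0,0,0,0,4]), (1,4,[0,0,3,2,1,0,4]), (1,4,[0,3,0,1,2,0,4]),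
      (1,3,[0,0,0,5,1,2,3]), (1,3,[0,0,0,5,1,3,2]), (1,0,[3,0,0,0,2,4,5]), (0,3,[0,1,0,0,0,2,3]),
      (1,4,[0,0,2,0,1,0,3,4]), (1,4,[0,0,0,2,1,4,0,3]), (2,2,[6,4,1,2,5]), (2,2,[2,0,4,0,1,6,5])]
      [(0,3,2,[0,0,1,2]), (0,3,2,[1,0,0,2]), (0,3,2,[1,0,0,0,0,0,0,2]), (1,4,3,[0,1,2,3]),
      (0,3,2,[0,1,0,0,0,2]), (0,3,2,[0,0,1,0,0,0,2]), (1,4,3,[0,0,0,0,1,2,3]),
      (0,3,2,[0,1,0,0,2]), (0,3,2,[1,0,0,0,2]), (1,4,3,[2,0,0,0,3,0,1])] [3,0,0,2,2,2,1,0]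
      [[3],[3],[3],[1],[2],[1],[1],[3],[3],[3],[3],[3],[0],[0],[0],[0],[0],[0],[2],[2],[2]] []]]),
    ([[0,0,1,1,0], [1,0,0,1], [0,0,0], [1,1], [1], []], [0,1,2,3,6],
      Colour [(0,3,[1,0,0,2,3]), (0,3,[0,0,0,1,2,3]), (1,4,[2,0,1,0,3,4]), (1,4,[1,3,4,0,0,2]),
      (1,4,[4,0,1,0,3,2]), (1,0,[0,3,2,5,0,4]), (1,4,[2,0,1,3,0,4]), (1,4,[4,0,1,3,0,2]),
      (1,0,[0,3,2,0,5,4]), (4,1,[1,0,3,4,5,6]), (2,2,[0,2,1,4,5,6])] [(0,3,2,[0,1,2]),
      (1,4,3,[0,1,0,2,3]), (1,4,3,[0,1,0,3,2]), (0,3,2,[1,0,0,2]), (0,3,2,[1,0,0,0,2]),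
      (1,4,3,[3,1,0,2]), (1,4,3,[1,3,2]), (1,4,3,[3,1,0,0,2]), (1,4,3,[2,0,1,3]),
      (0,3,2,[0,0,0,1,2]), (1,4,3,[2,0,1,0,3]), (0,3,2,[0,0,0,0,1,2]), (0,3,2,[0,0,0,1,0,2]),
      (3,4,3,[3,1,0,0,2,6]), (3,4,3,[0,6,1,0,3,2]), (3,4,3,[0,6,1,3,0,2]), (3,2,1,[0,1,0,4,5,6])]
      [0,2,0,2,1,0]
      [[0],[2],[2],[1],[0],[0],[0],[3],[3],[3],[3],[3],[3],[3],[2],[1],[1,2],[1,2],[2],[2],[1],[1],[],[],[3],[3],[3],[3],[3],[3]]
      [Colour [(0,3,[1,2,0,0,3]), (0,3,[0,0,0,0,1,2,3]), (0,3,[1,0,2,0,0,0,3]), (1,0,[4,0,3,2,5]),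
      (1,4,[2,0,3,4,0,1]), (1,4,[4,0,0,1,3,2]), (1,4,[2,0,0,1,0,4,3]), (1,4,[0,1,3,4,0,0,2]),
      (1,4,[0,2,0,1,0,3,4]), (1,4,[0,4,0,1,0,3,2]), (0,3,[0,1,0,0,2,3]), (1,4,[2,0,0,1,3,4]),
      (1,4,[4,3,0,1,0,2]), (1,4,[0,4,0,1,3,0,2]), (1,0,[3,2,4,5]), (0,3,[1,0,0,0,2,0,3]),
      (1,4,[0,2,0,1,3,0,4]), (1,0,[0,0,3,2,5,0,4]), (2,2,[6,4,2,1,5]), (4,1,[1,4,0,3,5,6]),
      (4,1,[0,1,0,3,4,5,6])] [(0,3,2,[0,0,1,2]), (1,4,3,[0,3,1,0,2]), (0,3,2,[1,2]),
      (0,3,2,[0,1,0,0,0,2]), (0,3,2,[1,0,0,0,2]), (1,4,3,[0,0,1,0,2,3]), (0,3,2,[0,1,0,0,2]),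
      (0,3,2,[0,0,0,0,0,1,2]), (1,4,3,[0,1,3,0,0,0,2]), (0,3,2,[1,0,2]), (1,4,3,[2,3,0,1]),
      (0,3,2,[0,0,0,0,1,2]), (0,3,2,[1,0,0,0,0,0,2]), (3,4,3,[2,3,6,1])] [1,0,2,1,2,1,0]
      [[2],[1],[3],[3],[3],[3],[3],[3],[0],[1],[2],[2],[1],[3],[3],[3],[3],[3],[3],[0],[2],[2],[0],[0],[0],[0],[0],[2],[2],[2],[2],[2],[3],[3]]
      [], Colour [(0,3,[0,1,0,0,2,3]), (0,3,[1,0,2,0,0,0,3]), (1,0,[3,2,4,5]), (1,4,[2,0,3,4,1]),
      (1,4,[4,0,3,2,1]), (1,4,[0,4,0,1,0,3,2]), (1,4,[0,1,3,4,0,0,2]), (0,3,[0,0,0,0,1,2,3]),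
      (0,3,[1,2,0,0,0,3]), (1,4,[2,3,0,1,4]), (1,4,[4,3,0,1,2]), (1,0,[4,0,3,2,0,5]),
      (1,4,[0,2,0,1,0,3,4]), (1,4,[0,4,0,1,3,0,2]), (0,3,[1,0,0,0,0,2,3]), (1,4,[0,2,0,1,3,0,4]),
      (1,0,[0,0,3,2,0,5,4]), (2,2,[6,4,2,1,0,5]), (4,1,[1,4,0,3,6,5]), (4,1,[0,1,0,3,4,5,6])]
      [(0,3,2,[0,0,1,2]), (1,4,3,[0,0,1,0,3,2]), (0,3,2,[0,1,0,0,2]), (1,4,3,[0,3,1,0,0,2]),
      (1,4,3,[0,1,3,0,0,0,2]), (0,3,2,[1,2]), (0,3,2,[0,1,0,0,0,2]), (0,3,2,[0,0,0,0,1,0,2]),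
      (1,4,3,[2,3,0,1]), (0,3,2,[0,0,0,0,1,2]), (0,3,2,[1,0,0,0,0,0,2]), (3,4,3,[2,3,6,1])]
      [2,0,1,2,2,1,0]
      [[1],[2],[3],[3],[0],[3],[0],[3],[0],[2],[1],[1],[2],[3],[3],[3],[3],[3],[3],[0],[1],[1],[],[0],[3],[0],[0],[1],[1],[1],[1],[1],[3],[3]]
      [Colour [(0,3,[0,0,1,0,0,2,3]), (0,3,[1,2,0,3]), (0,3,[0,1,0,0,0,0,2,3]), (1,4,[4,3,2,0,1]),
      (1,4,[0,2,0,3,4,1]), (1,0,[4,0,0,3,2,0,5]), (1,4,[0,0,1,3,4,0,0,2]),
      (1,4,[0,0,4,0,1,3,0,2]), (1,4,[2,3,0,0,1,0,0,4]), (1,4,[0,4,3,0,1,2]),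
      (0,3,[0,1,0,2,0,0,0,3]), (1,4,[0,2,0,0,1,4,0,3]), (1,4,[2,0,1,3,4]), (0,3,[1,0,0,0,0,2,3]),
      (0,3,[0,1,2,0,0,0,3]), (1,4,[4,0,1,3,2]), (1,0,[0,4,0,3,2,0,5]), (1,4,[0,0,4,0,1,0,3,2]),
      (1,0,[0,3,2,4,5]), (1,4,[0,4,0,3,2,1]), (0,3,[0,0,0,0,0,1,2,3]), (2,2,[0,6,4,2,1,0,5]),
      (4,1,[0,1,4,0,3,6,5]), (4,1,[1,0,6,0,3,4,5]), (4,2,[1,0,0,2,0,4,5,6])] [(0,3,2,[0,0,0,1,2]),
      (0,3,2,[0,0,1,0,0,2]), (1,4,3,[0,0,0,1,0,3,2]), (1,4,3,[0,0,3,1,0,0,2]),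
      (0,3,2,[0,0,0,0,0,1,2]), (0,3,2,[0,1,2]), (0,3,2,[0,1,0,2]), (1,4,3,[2,0,1,3]),
      (0,3,2,[1,0,0,0,0,2]), (0,3,2,[0,0,1,0,0,0,2]), (1,4,3,[0,2,3,0,1]), (0,3,2,[1,2]),
      (3,4,3,[0,2,3,6,1])] [0,2,0,1,2,2,1,0]
      [[2],[3],[3],[3],[3],[3],[3],[0],[1],[1],[3],[3],[3],[3],[3],[3],[0],[0],[0],[0],[0],[0],[1],[1],[1],[3],[3],[1],[3],[3],[3],[3],[3],[3],[2],[1],[1],[2],[3],[3],[3],[3],[3],[3],[1],[1],[1],[1],[1],[1],[1]]
      []]]),
    ([[0,1,0,0,1], [0,1,1,0], [0,0,0], [0,1], [1], []], [0,1,2,3,4,6,7],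
      Colour [(1,4,[0,3,1,2,4]), (1,4,[0,3,1,4,2]), (1,3,[2,0,3,1,5]), (1,3,[2,0,3,5,1]),
      (1,4,[0,4,1,0,3,2]), (1,3,[3,0,2,1,5]), (1,4,[0,2,1,0,3,4]), (1,4,[3,1,4,0,0,2]),
      (1,0,[3,0,2,5,0,4]), (1,3,[3,0,2,5,1]), (1,4,[3,1,2,0,0,4]), (2,5,[4,2,5,1,3]),
      (5,4,[0,4,3,1,6,2]), (6,4,[2,1,3,0,4,6]), (6,4,[4,3,1,0,2,6]), (2,4,[6,0,4,1,3,2]),
      (3,4,[2,0,3,4,1,6]), (5,4,[0,2,3,1,6,4]), (6,4,[4,3,1,2,0,6])] [(0,3,2,[1,0,2]),
      (0,3,2,[0,1,0,2]), (0,3,2,[0,0,0,0,1,2]), (0,3,2,[0,1,0,0,2]), (1,4,3,[3,1,2]),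
      (1,4,3,[2,0,3,1]), (1,4,3,[0,2,1,3]), (1,4,3,[1,3,0,2]), (0,3,2,[0,0,0,1,0,2]),
      (5,5,4,[1,3,4,0,0,2]), (5,4,3,[0,2,3,1,6]), (4,3,1,[0,6,3,1,5]), (4,3,1,[3,6,0,1,5]),
      (3,4,3,[2,0,3,0,1,6]), (6,4,3,[2,1,6,0,0,3])] [1,0,0,1,1,0]
      [[0],[1],[2],[1],[1],[],[3],[3],[0],[0],[2],[2],[2],[2],[],[3],[3],[2],[3],[2],[3],[2]]
      [Compare [(1,4,[0,0,3,1,2,4]), (1,3,[0,2,0,3,1,5]), (1,3,[2,3,0,0,1,5]),
      (0,3,[1,2,0,0,0,0,3]), (1,4,[0,0,0,1,2,4,3]), (1,4,[4,3,0,2,1]), (6,4,[6,4,2,1,3]),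
      (3,4,[2,3,6,0,1,4])] 5 4 [Colour [(0,3,[1,2,3]), (0,3,[1,0,0,2,0,0,3]), (1,0,[0,3,4,2,5]),
      (1,4,[3,2,0,0,4,1]), (1,4,[3,4,0,0,2,1]), (1,3,[0,0,2,0,3,5,1]), (1,3,[0,2,3,0,0,5,1]),
      (1,4,[0,4,3,0,2,0,1]), (0,3,[0,1,2,0,0,0,0,3]), (1,4,[0,0,3,1,4,0,0,2]),
      (1,4,[0,3,0,4,1,0,0,2]), (0,3,[1,0,2,0,3]), (1,4,[0,2,0,3,1,0,4]), (1,3,[0,3,2,0,0,1,5]),
      (1,4,[3,0,0,0,4,1,2]), (1,4,[0,2,3,0,4,1]), (1,4,[3,0,0,2,4,0,0,1]), (1,4,[3,0,4,0,0,1,2]),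
      (1,4,[3,0,0,4,2,0,0,1]), (0,3,[1,2,0,3]), (1,4,[3,0,0,0,2,1,4]), (1,4,[0,0,3,1,2,0,0,4]),
      (1,4,[0,0,0,3,1,4,2]), (1,4,[0,0,0,2,1,0,3,4]), (1,0,[3,0,4,2,0,0,0,5]),
      (5,4,[0,2,0,1,3,4,0,6]), (6,1,[4,1,5,0,6,3]), (2,2,[6,0,4,2,5,1]), (6,4,[0,6,2,4,3,1]),
      (5,5,[1,0,4,0,5,3,2])] [(0,3,2,[0,0,0,1,0,2]), (0,3,2,[0,0,0,0,0,0,1,2]), (0,3,2,[1,2]),
      (0,3,2,[1,0,2]), (1,4,3,[2,0,0,0,3,0,0,1]), (0,3,2,[1,0,0,2]), (1,4,3,[0,0,2,1,3]),
      (1,4,3,[0,0,1,2,0,3]), (0,3,2,[0,1,2]), (0,3,2,[0,0,1,0,2]), (1,4,3,[0,2,0,3,1])]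
      [3,1,2,2,1,1,1,0] [[3],[0],[3],[2],[0],[3],[0],[3],[0],[2],[1],[1],[1],[2],[2],[2]] []],
      Colour [(1,0,[4,2,5,3]), (1,4,[4,2,0,3,1]), (1,3,[0,2,0,3,1,5]), (1,3,[0,3,0,2,1,5]),
      (1,3,[0,2,0,3,5,1]), (1,3,[0,3,0,2,5,1]), (1,4,[0,0,4,1,0,3,2]), (1,4,[4,1,3,0,0,2]),
      (1,3,[2,0,0,3,1,5]), (1,3,[2,0,0,3,5,1]), (1,4,[0,3,1,4,0,0,2]), (1,4,[2,4,0,3,1]),
      (1,4,[2,1,3,0,4]), (1,4,[4,2,0,3,0,1]), (1,4,[0,0,2,1,0,3,4]), (1,4,[0,3,1,2,0,0,4]),
      (1,4,[0,0,0,1,2,4,3]), (6,4,[6,1,2,4,3]), (2,5,[0,4,2,5,1,3]), (5,4,[0,0,4,3,1,6,2]),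
      (6,4,[0,2,1,3,0,4,6]), (6,4,[6,1,2,4,0,3]), (5,4,[0,0,2,3,1,6,4]), (3,4,[2,0,6,3,4,1]),
      (2,4,[0,6,0,4,1,3,2]), (2,4,[6,0,0,4,1,3,2]), (6,4,[0,4,3,1,0,2,6])] [(0,3,2,[0,1,0,2]),
      (0,3,2,[0,0,1,0,2]), (0,3,2,[1,0,0,2]), (1,4,3,[0,3,1,2]), (0,3,2,[0,0,0,0,0,1,2]),
      (1,4,3,[2,1,3]), (1,4,3,[0,0,2,1,3]), (1,3,2,[2,1,0,0,5]), (0,3,2,[1,0,2]),
      (1,4,3,[0,2,0,3,1]), (5,4,3,[0,0,2,3,1,6]), (3,4,3,[2,1,3,6]), (3,4,3,[2,0,6,3,1]),
      (3,4,3,[6,0,2,1,3]), (5,5,4,[2,3,1,0,4]), (2,5,1,[4,0,0,5,1,3]), (6,4,3,[0,2,1,6,0,0,3])]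
      [1,1,0,0,1,1,0]
      [[1],[1],[1],[],[2],[2],[0],[3],[3],[2],[3],[3],[0],[2],[2],[2],[2],[0],[0],[3],[3],[2],[3],[3],[2],[2],[2],[3]]
      [Colour [(1,4,[2,4,1,3]), (1,4,[4,2,1,3]), (1,3,[0,0,3,0,2,1,5]), (1,3,[0,0,3,0,2,5,1]),
      (1,3,[0,2,0,0,3,1,5]), (1,3,[0,2,0,0,3,5,1]), (1,4,[0,4,2,0,3,1]), (1,4,[0,0,0,4,1,0,3,2]),
      (1,0,[0,4,2,5,3]), (1,4,[0,4,1,3,0,0,2]), (1,3,[0,0,2,0,3,1,5]), (1,3,[2,0,0,0,3,5,1]),
      (1,4,[4,2,0,0,3,1]), (1,4,[2,0,4,0,3,1]), (1,3,[2,0,0,0,3,1,5]), (1,4,[0,0,3,1,4,0,0,2]),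
      (1,4,[0,4,2,0,3,0,1]), (1,3,[0,0,2,0,3,5,1]), (1,4,[0,2,1,3,0,4]), (1,4,[4,0,2,0,3,0,1]),
      (1,4,[0,0,0,2,1,0,3,4]), (1,4,[0,0,3,1,2,0,0,4]), (1,4,[0,0,0,0,1,2,4,3]),
      (2,5,[0,0,4,2,5,1,3]), (5,4,[0,0,0,4,3,1,6,2]), (6,4,[0,6,1,2,4,3]),
      (6,4,[0,0,2,1,3,0,4,6]), (6,4,[6,0,1,2,4,0,3]), (5,4,[0,0,0,2,3,1,6,4]),
      (2,4,[0,6,0,0,4,1,3,2]), (3,4,[0,2,0,6,3,4,1]), (2,4,[0,0,6,0,4,1,3,2]),
      (2,4,[6,0,0,0,4,1,3,2]), (6,4,[0,0,4,3,1,0,2,6])] [(0,3,2,[0,0,1,0,2]),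
      (0,3,2,[0,0,0,1,0,0,2]), (0,3,2,[0,1,0,0,2]), (0,3,2,[1,0,0,2]), (1,3,2,[0,2,1,0,0,5]),
      (0,3,2,[0,0,0,0,0,0,1,2]), (1,4,3,[0,0,3,1,2]), (1,4,3,[0,0,0,2,1,3]),
      (1,3,2,[2,0,1,0,0,5]), (0,3,2,[0,1,0,2]), (1,4,3,[0,2,1,3]), (0,3,2,[1,0,0,0,2]),
      (1,3,2,[1,2,5]), (1,3,2,[2,1,5]), (1,3,2,[2,5,1]), (1,4,3,[0,0,2,0,3,1]),
      (5,4,3,[0,0,0,2,3,1,6]), (2,5,1,[0,4,0,0,5,1,3]), (4,3,1,[1,5,3,6]), (3,4,3,[0,2,0,6,3,1]),
      (3,4,3,[0,6,0,2,1,3]), (5,5,4,[0,2,3,1,0,4]), (2,5,1,[4,0,0,0,5,1,3]),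
      (6,4,3,[0,0,2,1,6,0,0,3])] [1,1,1,0,0,1,1,0]
      [[1],[1],[1],[],[3],[3],[0],[2],[2],[3],[2],[2],[3],[3],[3],[0],[2],[2],[3],[2],[2],[3],[3],[3],[0],[2],[2],[3],[2],[2],[0],[3],[3],[3],[3],[0],[0],[2],[2],[3],[3],[2],[2],[2],[3],[2]]
      [Compare [(1,4,[0,0,0,0,3,1,2,4]), (1,3,[0,0,0,2,0,3,1,5]), (1,3,[0,0,2,0,0,3,1,5]),
      (1,3,[0,0,0,3,0,2,1,5]), (1,4,[0,0,4,2,0,3,1]), (1,3,[0,2,0,0,0,3,1,5]),
      (1,4,[0,4,0,2,0,3,1]), (1,3,[2,0,0,0,0,3,1,5]), (1,4,[4,0,0,2,0,3,1]),
      (1,4,[0,0,0,0,0,1,2,4,3]), (6,4,[0,0,6,1,2,4,3]), (3,4,[0,0,2,0,6,3,1,4])] 7 6 [Colour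
      [(0,3,[1,0,0,0,2,0,3]), (0,3,[1,0,0,0,0,2,0,0,3]), (1,4,[0,0,2,4,1,3]), (1,4,[0,0,4,2,1,3]),
      (1,3,[0,0,0,0,3,0,2,5,1]), (1,4,[3,0,0,2,4,0,0,1]), (1,4,[3,2,0,4,0,0,0,1]),
      (1,4,[3,4,0,0,2,0,0,1]), (1,3,[0,0,0,0,2,0,3,5,1]), (1,0,[0,0,0,0,3,0,2,0,5,4]),
      (1,4,[0,0,0,0,0,3,1,2,4]), (1,4,[3,0,0,0,0,2,4,0,0,1]), (1,4,[0,0,0,0,0,2,1,0,3,4]),
      (1,4,[3,0,0,0,0,4,2,0,0,1]), (0,3,[1,0,0,2,0,3]), (1,4,[0,0,0,2,1,3,0,0,4]),
      (0,3,[1,0,2,0,0,0,3]), (1,3,[0,0,0,2,0,0,3,5,1]), (1,4,[3,0,0,0,0,0,4,1,2]),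
      (1,4,[0,0,4,2,0,0,3,0,1]), (1,4,[0,0,2,0,4,0,3,1]), (1,4,[3,0,0,0,2,0,0,1,4]),
      (1,3,[0,0,2,0,0,0,3,5,1]), (1,4,[0,2,0,4,1,3]), (1,4,[0,4,0,0,2,0,3,0,1]),
      (0,3,[1,2,0,0,0,0,3]), (1,4,[3,0,2,0,4,0,0,1]), (1,4,[0,2,0,4,0,0,3,0,1]),
      (1,3,[0,2,0,0,0,0,3,5,1]), (1,4,[0,0,0,0,3,1,2,0,0,4]), (1,0,[3,0,0,0,0,4,2,5]),
      (1,4,[3,0,0,0,0,0,2,1,4]), (1,4,[0,0,0,0,3,1,4,0,0,2]), (1,0,[3,0,0,0,4,2,0,0,0,5]),
      (6,4,[2,0,0,0,0,0,3,1,6,4]), (5,4,[0,0,0,0,0,2,3,1,6,4]), (6,2,[4,0,0,5,0,6,1,2]),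
      (5,5,[1,0,0,0,4,0,5,3,2]), (6,2,[4,0,5,0,0,6,1,2]), (3,4,[0,0,0,2,0,6,3,4,1]),
      (2,2,[6,0,0,0,4,2,5,1]), (6,2,[4,5,0,0,0,6,1,2]), (6,4,[0,0,0,6,1,2,4,0,3]),
      (6,4,[4,0,0,0,0,6,1,2,0,3])] [(0,3,2,[0,0,0,0,0,1,0,2]), (0,3,2,[0,0,0,0,0,0,0,1,0,2]),
      (0,3,2,[1,0,0,0,2]), (0,3,2,[0,0,0,0,1,0,2]), (0,3,2,[0,0,1,0,0,0,2]),
      (1,4,3,[0,0,0,0,3,1,2]), (1,4,3,[3,0,0,0,0,0,2,0,0,1]), (0,3,2,[0,0,0,1,0,0,2]),
      (0,3,2,[0,1,0,0,0,0,2]), (1,3,2,[0,0,1,2,5]), (0,3,2,[1,0,0,0,0,2]), (1,3,2,[0,0,2,1,5]),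
      (1,3,2,[0,2,1,0,5]), (1,4,3,[0,0,0,2,1,3]), (0,3,2,[1,2]), (1,3,2,[0,1,2,5]),
      (0,3,2,[1,0,0,0,0,0,2]), (6,4,3,[2,0,0,3,0,0,0,1,6]), (5,4,3,[0,0,0,0,0,2,3,1,6]),
      (6,4,3,[2,0,3,0,0,0,0,1,6]), (6,4,3,[2,3,0,0,0,0,0,1,6])] [2,1,1,1,1,0,0,1,1,0]
      [[2],[2],[3],[2],[2],[3],[2],[3],[2],[2],[3],[2],[2],[2],[2],[2],[2],[2],[2],[2],[3],[2],[3],[2],[2],[3],[2],[2],[2],[2],[2],[3],[2],[2],[2],[3],[2],[2],[0],[3],[2],[2],[2],[2],[1],[1],[1],[0],[0],[0],[0],[0],[0],[0],[0],[0],[0]]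
      [], Colour [(0,3,[1,0,0,0,0,0,0,0,2,3]), (0,3,[1,0,0,0,2,0,3]), (0,3,[1,0,0,2,0,3]),
      (1,4,[3,0,0,4,2,0,0,1]), (1,4,[3,0,0,2,0,0,0,1,4]), (1,4,[0,0,0,0,0,3,1,4,2]),
      (1,4,[3,0,0,0,4,0,0,1,2]), (1,3,[0,0,0,0,2,0,3,5,1]), (1,0,[0,0,0,3,0,0,2,0,5,4]),
      (1,4,[0,0,0,0,3,1,4,0,0,2]), (1,4,[0,0,0,0,0,0,1,2,4,3]), (1,4,[0,0,0,0,0,2,1,3,0,4]),
      (0,3,[1,0,2,0,0,3]), (1,4,[0,0,0,2,1,3,0,4]), (1,3,[0,0,0,2,0,0,3,5,1]),
      (1,3,[0,0,0,3,0,0,2,5,1]), (1,4,[0,0,2,4,1,3]), (1,4,[3,0,0,0,0,0,4,1,2]),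
      (1,4,[3,0,2,0,4,0,0,1]), (0,3,[1,2,0,0,0,3]), (1,3,[0,0,2,0,0,0,3,5,1]),
      (1,4,[0,2,4,0,1,3]), (1,4,[3,2,4,0,0,0,0,1]), (1,4,[0,4,0,2,0,0,3,0,1]),
      (1,4,[0,2,0,0,4,0,3,0,1]), (1,4,[0,4,0,0,1,3,0,2]), (0,3,[1,0,0,0,0,2,0,0,3]),
      (1,3,[0,2,0,0,0,0,3,5,1]), (1,4,[0,0,2,0,4,0,3,1]), (1,4,[3,0,0,0,0,0,2,1,4]),
      (1,4,[0,0,4,0,2,0,3,0,1]), (1,4,[0,0,0,0,3,1,2,0,0,4]), (6,1,[4,0,0,1,6,0,5,3]),
      (6,1,[4,0,1,6,0,0,5,3]), (6,1,[4,0,6,0,1,0,5,3]), (6,1,[4,1,0,0,6,0,5,3]),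
      (6,4,[0,0,0,0,2,1,3,4,0,6]), (5,5,[1,0,0,0,4,0,5,3,2]), (5,4,[0,0,0,0,0,4,3,1,6,2]),
      (6,4,[0,0,0,6,1,2,4,0,3]), (2,2,[6,0,0,0,4,2,5,1]), (5,4,[0,0,0,0,0,2,3,1,6,4])]
      [(0,3,2,[0,0,0,0,0,1,0,2]), (0,3,2,[0,0,0,0,1,0,2]), (0,3,2,[1,0,0,0,2]),
      (0,3,2,[0,0,0,1,0,0,2]), (1,4,3,[0,0,0,0,3,1,2]), (0,3,2,[0,0,0,0,0,0,0,0,1,2]),
      (0,3,2,[1,0,0,0,0,2]), (0,3,2,[0,0,1,0,0,0,2]), (1,4,3,[0,0,0,2,1,3]),
      (0,3,2,[0,1,0,0,0,0,2]), (0,3,2,[1,2]), (0,3,2,[1,0,0,0,0,0,2]), (1,4,3,[0,0,0,0,0,2,1,3]),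
      (5,4,3,[0,0,0,0,0,2,3,1,6]), (5,5,4,[0,0,0,2,3,1,0,4])] [2,1,1,1,1,0,0,1,1,0]
      [[2],[2],[3],[3],[3],[2],[2],[2],[3],[3],[2],[2],[2],[2],[3],[3],[2],[2],[2],[2],[3],[3],[2],[2],[2],[2],[3],[3],[2],[2],[2],[2],[3],[3],[2],[2],[2],[2],[3],[3],[2],[2],[2],[2],[2],[0],[3],[3],[2],[2],[2],[2],[2],[1],[1],[1],[1],[0],[0],[0],[0],[0],[0],[0],[0],[0],[0]]
      []]]]]),
    ([[0,0,0,1,1], [0,1,0,0], [0,0,0], [0,0], [1], []], [0,1,2,3,4,5],
      Colour [(0,3,[1,0,0,0,2,3]), (1,3,[1,2,5,3]), (1,3,[1,3,5,2]), (1,3,[2,0,1,5,3]),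
      (1,3,[3,0,1,5,2]), (1,3,[3,0,5,1,2]), (1,3,[5,3,1,2]), (1,3,[0,0,5,1,3,2]),
      (1,3,[2,5,1,0,0,3]), (1,3,[0,2,5,3,1]), (1,3,[0,0,1,5,3,2]), (1,3,[2,0,5,1,0,3]),
      (1,3,[0,3,1,2,5]), (1,3,[0,2,1,3,0,5]), (1,3,[0,1,5,0,3,2]), (3,5,[2,4,1,5,3]),
      (3,5,[3,4,1,5,2]), (4,4,[1,2,3,4,6]), (4,4,[6,2,3,4,1]), (4,4,[2,1,3,6,4]),
      (4,4,[2,6,3,1,4]), (2,1,[4,0,1,3,5,6]), (3,5,[0,4,1,5,2,3]), (4,4,[0,2,3,4,1,6]),
      (4,4,[0,2,3,4,6,1]), (5,2,[4,0,1,2,5,6])] [(0,3,2,[0,1,0,2])] [3,1,3,2,1,0] [[1,2],[3],[0]]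
      []),
    ([[0,1,0,1,0], [1,0,0,1], [0,0,0], [1,1], [1], []], [0,1,2,3,6,7,8],
      Colour [(0,3,[0,0,0,1,2,3]), (1,4,[2,4,3,1]), (1,4,[4,2,3,1]), (1,4,[2,1,0,4,3]),
      (1,0,[2,4,3,0,0,5]), (1,4,[4,1,0,2,3]), (1,4,[1,4,0,2,0,3]), (1,0,[4,2,3,0,5]),
      (1,4,[1,2,0,4,0,3]), (1,0,[3,0,2,0,4,5]), (1,0,[0,3,2,0,5,4]), (1,0,[2,5,0,0,3,4]),
      (5,4,[6,1,4,3,2]), (6,4,[6,2,4,3,1]), (5,4,[6,3,2,1,4]), (6,4,[6,3,1,2,4]),
      (5,4,[3,6,2,1,0,4]), (5,4,[1,6,4,3,0,2]), (6,4,[3,6,1,2,0,4]), (6,4,[2,6,4,3,0,1])]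
      [(0,3,2,[0,1,2]), (0,3,2,[0,0,0,1,0,2]), (0,3,2,[1,0,2]), (1,4,3,[0,2,3,1]),
      (1,4,3,[0,1,0,2,3]), (0,3,2,[0,0,0,0,1,2]), (1,3,2,[2,5,0,1]), (0,3,2,[0,0,0,1,2]),
      (0,3,2,[0,1,0,0,0,2]), (1,4,3,[1,0,0,2,0,3]), (1,4,3,[0,0,1,0,3,2]), (5,5,4,[1,0,4,2,0,3]),
      (3,4,3,[2,1,6,0,3]), (5,5,4,[0,1,4,2,3]), (3,4,3,[1,3,0,0,6,2]), (3,4,3,[0,6,1,0,3,2])]
      [2,2,0,2,1,0]
      [[2],[2],[2],[2],[1],[3],[3],[1],[3],[3],[],[],[1],[],[],[0],[1],[0],[3],[3],[1],[3]]
      [Colour [(0,3,[1,2,0,0,0,3]), (0,3,[0,0,0,0,1,2,3]), (0,3,[1,0,2,0,0,0,3]),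
      (1,4,[2,0,3,4,1]), (1,4,[3,2,4,0,1]), (1,4,[0,2,1,0,4,3]), (1,4,[2,0,0,1,4,0,3]),
      (1,0,[0,0,3,2,5,0,4]), (1,4,[4,3,0,2,1]), (1,4,[0,4,1,0,2,3]), (1,4,[2,0,0,1,4,3]),
      (1,4,[0,1,2,0,4,0,3]), (1,4,[0,1,4,0,2,0,3]), (1,4,[0,4,2,3,1]), (1,4,[4,0,0,1,2,3]),
      (1,0,[0,4,2,3,0,5]), (0,3,[1,0,0,0,0,2,3]), (1,0,[0,3,0,2,0,4,5]), (1,0,[0,0,3,2,0,5,4]),
      (1,0,[0,2,5,0,0,3,4]), (4,4,[2,1,6,4,3]), (5,1,[1,0,0,3,6,4,5]), (6,4,[0,6,2,4,3,1]),
      (5,4,[0,6,1,4,3,2]), (6,4,[0,6,3,1,2,4]), (6,4,[6,0,4,2,3,1]), (4,1,[1,0,0,3,6,4,5]),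
      (6,4,[0,3,6,1,2,0,4]), (6,4,[0,2,6,4,3,0,1]), (6,4,[6,4,0,2,3,0,1])] [(0,3,2,[0,0,1,2]),
      (0,3,2,[0,1,0,2]), (0,3,2,[0,0,0,0,0,1,2]), (0,3,2,[0,0,0,0,1,2])] [2,3,1,2,2,1,0]
      [[2],[3],[3],[1],[0],[2],[],[0],[3],[0],[1],[1],[0]] [Colour [(0,3,[1,0,0,2,3]),
      (0,3,[0,1,2,0,0,0,3]), (0,3,[0,0,0,0,0,1,2,3]), (1,4,[0,2,0,3,4,1]), (1,4,[0,0,2,4,3,1]),
      (1,4,[0,0,2,1,0,4,3]), (1,4,[0,2,0,0,1,4,0,3]), (1,0,[0,0,0,3,2,5,0,4]),
      (0,3,[0,1,0,2,0,0,0,3]), (1,4,[3,1,0,0,4,2]), (1,4,[0,0,4,1,0,2,3]), (1,4,[0,2,0,0,1,4,3]),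
      (1,4,[0,0,1,2,0,4,0,3]), (0,3,[1,0,2,0,3]), (1,0,[3,0,0,0,2,4,5]), (0,3,[0,1,0,0,0,0,2,3]),
      (1,0,[3,0,0,0,2,0,5,4]), (1,4,[0,0,4,2,3,1]), (1,4,[0,4,0,0,1,2,3]), (1,0,[3,0,0,2,0,4,5]),
      (1,0,[2,4,0,3,0,0,5]), (0,3,[1,0,0,2,0,0,0,3]), (1,4,[0,0,1,4,0,2,0,3]),
      (1,0,[4,2,0,3,0,5]), (1,0,[0,0,4,2,3,0,5]), (0,3,[1,0,0,0,0,2,0,3]),
      (1,0,[0,0,3,0,2,0,4,5]), (1,0,[0,0,0,3,2,0,5,4]), (1,0,[4,2,0,0,5,0,0,3]),
      (1,0,[0,0,2,5,0,0,3,4]), (6,4,[4,3,0,0,2,6,1]), (6,4,[0,0,3,6,1,2,0,4]),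
      (6,4,[0,0,2,6,4,3,0,1]), (6,4,[0,6,4,0,2,3,0,1]), (2,2,[4,2,0,6,5,0,1]),
      (5,4,[0,0,6,1,4,3,2]), (6,4,[0,6,0,4,2,3,1]), (4,1,[0,1,0,0,3,6,4,5])] [(0,3,2,[0,0,0,1,2]),
      (0,3,2,[0,0,1,0,2]), (0,3,2,[0,0,0,0,0,0,1,2]), (0,3,2,[0,0,0,0,0,1,2]),
      (1,4,3,[2,0,0,3,0,0,1])] [1,2,3,3,2,2,1,0] [[0],[0],[2],[0],[1],[0],[1],[1],[0],[2]] []],
      Colour [(0,3,[1,2,0,3]), (0,3,[0,0,0,0,1,2,3]), (1,4,[0,2,4,3,1]), (1,4,[0,4,2,3,1]),
      (1,4,[0,2,1,0,4,3]), (0,3,[1,0,0,0,2,3]), (1,0,[3,2,0,0,4,0,5]), (1,4,[3,4,1,0,2]),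
      (1,0,[3,0,0,2,0,4,5]), (1,0,[0,4,2,3,0,5]), (1,4,[3,2,1,0,4]), (1,4,[0,1,4,0,2,0,3]),
      (1,0,[4,0,2,3,5]), (0,3,[1,2,0,0,0,3]), (1,0,[4,0,2,3,0,5]), (1,0,[0,3,0,2,0,4,5]),
      (1,0,[3,0,0,2,4,0,5]), (1,0,[0,2,4,3,0,0,5]), (1,0,[2,0,4,3,0,0,5]), (1,0,[0,0,3,2,0,5,4]),
      (1,0,[0,2,5,0,0,3,4]), (1,0,[2,0,5,0,0,3,4]), (5,1,[4,1,3,0,6,5]), (5,1,[4,6,3,0,1,5]),
      (6,4,[0,6,2,4,3,1]), (6,4,[1,3,2,0,6,0,4]), (2,2,[6,0,1,2,4,5]), (4,1,[4,1,3,0,6,5]),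
      (6,4,[0,6,3,1,2,4]), (5,4,[0,3,6,2,1,0,4]), (5,4,[0,1,6,4,3,0,2]), (6,4,[4,2,3,0,6,0,1])]
      [(0,3,2,[0,0,1,2]), (0,3,2,[1,0,0,2]), (0,3,2,[0,0,0,0,0,1,2]), (0,3,2,[1,2]),
      (1,4,3,[3,2,1]), (1,4,3,[0,0,2,3,1]), (0,3,2,[0,0,0,0,1,2]), (0,3,2,[0,0,0,0,1,0,2]),
      (1,4,3,[0,0,0,1,0,2,3]), (1,4,3,[2,0,0,3,0,0,1])] [0,2,2,1,2,1,0]
      [[2],[3],[3],[1],[0],[3],[0],[3],[0],[2],[2],[2],[2],[3],[3],[3],[3],[1],[1]] [], Colour
      [(0,3,[0,0,0,0,1,2,3]), (0,3,[1,2,0,3]), (1,4,[0,2,4,3,1]), (1,4,[0,4,2,3,1]),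
      (1,4,[0,2,1,0,4,3]), (1,4,[1,0,4,0,0,2,3]), (1,4,[2,0,1,0,3,4]), (1,0,[0,2,4,3,0,0,5]),
      (1,4,[2,0,4,3,0,1]), (1,4,[4,0,1,0,3,2]), (1,4,[0,1,4,0,2,0,3]), (1,4,[3,4,1,0,2]),
      (1,4,[4,0,2,3,0,1]), (1,4,[1,0,2,0,0,4,3]), (1,0,[4,0,2,3,5]), (1,4,[0,1,2,0,4,0,3]),
      (1,0,[0,3,0,2,0,4,5]), (1,0,[2,3,0,0,0,4,5]), (1,0,[3,0,0,2,4,0,5]), (1,0,[2,0,4,3,0,0,5]),
      (6,4,[0,6,2,4,3,1]), (6,4,[3,1,2,0,0,6,4]), (5,4,[0,6,3,2,1,4]), (5,4,[0,6,1,4,3,2]),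
      (5,4,[6,0,1,4,2,3]), (6,4,[0,6,3,1,2,4]), (6,4,[6,0,3,1,4,2]), (6,0,[2,4,3,0,5,6]),
      (6,0,[4,2,3,0,6,5]), (5,4,[0,3,6,2,1,0,4]), (5,4,[1,0,6,4,0,3,2]), (5,4,[0,1,6,4,3,0,2]),
      (6,4,[2,4,3,0,0,6,1]), (6,4,[4,2,3,0,6,0,1]), (6,4,[0,3,6,1,2,0,4]), (6,4,[3,0,6,1,0,2,4]),
      (6,4,[2,0,6,4,0,3,1]), (6,4,[0,2,6,4,3,0,1])] [(0,3,2,[0,0,1,2]), (0,3,2,[0,1,0,2]),
      (0,3,2,[1,2]), (1,4,3,[3,2,1]), (0,3,2,[1,0,0,2]), (3,4,3,[2,0,1,6,3])] [1,2,2,0,2,1,0]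
      [[2],[3],[1],[3],[1],[3],[2],[3],[3],[3],[],[0]] [Colour [(0,3,[0,0,0,0,0,1,2,3]),
      (0,3,[1,2,3]), (0,3,[1,0,0,2,0,0,0,3]), (1,4,[0,3,4,1,0,2]), (1,0,[4,0,3,0,2,5]),
      (1,4,[0,0,2,1,0,4,3]), (1,4,[0,1,0,4,0,0,2,3]), (0,3,[0,1,2,0,3]), (1,4,[2,0,0,0,1,0,4,3]),
      (1,4,[0,2,3,1,0,0,4]), (1,4,[0,0,1,4,0,2,0,3]), (1,4,[2,3,0,0,4,0,1]),
      (1,4,[0,4,0,1,0,3,2]), (0,3,[1,2,0,0,0,3]), (1,4,[4,0,0,3,2,0,1]), (1,4,[0,2,0,4,3,0,1]),
      (1,4,[0,4,0,2,3,0,1]), (1,0,[0,2,0,4,3,0,0,5]), (1,4,[0,0,4,2,3,1]),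
      (0,3,[1,0,0,0,0,2,0,3]), (1,4,[0,0,1,2,0,4,0,3]), (1,0,[0,0,3,0,2,0,4,5]),
      (1,0,[0,2,3,0,0,0,4,5]), (1,0,[0,3,0,0,2,4,0,5]), (1,0,[0,0,2,4,3,0,0,5]),
      (4,4,[2,1,0,6,4,0,3]), (6,4,[0,3,1,2,0,0,6,4]), (6,4,[0,0,6,2,4,3,1]),
      (5,4,[0,0,1,6,4,3,0,2]), (6,4,[0,2,4,3,0,0,6,1]), (6,4,[0,0,6,3,1,2,4]),
      (6,4,[0,6,0,3,1,4,2]), (6,4,[6,0,0,4,2,1,3]), (6,0,[0,2,4,3,0,5,6]),
      (5,4,[0,0,3,6,2,1,0,4]), (6,4,[0,4,2,3,0,6,0,1]), (6,4,[0,3,0,6,1,0,2,4]),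
      (6,4,[0,2,0,6,4,0,3,1])] [(0,3,2,[0,0,0,1,2]), (0,3,2,[0,1,0,0,2]), (0,3,2,[0,1,2])]
      [1,0,2,2,1,2,1,0] [[3],[0],[2],[3],[3],[1],[3],[2]] []], Colour [(0,3,[0,0,0,0,1,2,3]),
      (0,3,[1,2,0,3]), (1,4,[0,2,4,3,1]), (1,4,[0,4,2,3,1]), (1,4,[0,2,1,0,4,3]),
      (1,3,[2,3,5,0,1]), (1,0,[0,2,4,3,0,0,5]), (1,3,[2,3,1,0,5]), (1,3,[3,2,5,0,1]),
      (1,0,[3,2,0,0,5,0,4]), (0,3,[1,2,0,0,0,3]), (1,4,[4,0,1,0,2,3]), (1,4,[0,4,1,0,2,3]),
      (0,3,[1,0,0,0,0,2,3]), (1,4,[0,1,2,0,4,0,3]), (1,0,[0,3,0,2,0,4,5]), (1,0,[0,4,2,3,0,5]),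
      (1,0,[0,0,3,2,0,5,4]), (6,1,[1,3,4,0,5,0,6]), (4,5,[4,5,2,1,3]), (3,4,[2,3,4,0,1,0,6]),
      (5,4,[0,3,6,2,1,0,4]), (4,5,[4,5,3,0,2,1]), (2,2,[6,4,0,5,1,0,2]), (5,0,[6,4,0,5,3,0,2]),
      (6,4,[0,3,6,1,2,0,4])] [(0,3,2,[0,0,1,2]), (1,4,3,[0,0,0,1,0,2,3]), (0,3,2,[0,0,0,0,0,1,2]),
      (0,3,2,[0,0,0,0,1,0,2]), (0,3,2,[1,0,0,2]), (1,4,3,[0,0,1,0,2,3]), (0,3,2,[1,2]),
      (3,4,3,[0,0,6,1,0,3,2]), (3,4,3,[0,2,1,6,0,3])] [2,0,2,1,2,1,0]
      [[2],[2],[3],[2],[1],[1],[],[3],[3],[3],[0],[0],[3],[3],[1],[1]] [Colour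
      [(0,3,[0,0,0,0,0,1,2,3]), (0,3,[0,1,2,0,3]), (1,4,[0,0,2,4,3,1]), (1,4,[0,0,4,2,3,1]),
      (1,4,[0,0,2,1,0,4,3]), (1,3,[0,2,3,5,0,1]), (1,4,[2,0,3,0,4,0,0,1]), (0,3,[1,0,0,0,0,2,3]),
      (1,0,[0,0,2,4,3,0,0,5]), (1,4,[2,0,0,0,1,0,3,4]), (1,4,[4,0,0,0,1,0,3,2]),
      (1,3,[0,3,2,5,0,1]), (1,3,[0,2,3,1,0,5]), (1,0,[4,2,3,0,0,5]), (0,3,[0,1,2,0,0,0,3]),
      (1,4,[0,0,4,1,0,2,3]), (1,4,[0,4,0,1,0,2,3]), (0,3,[0,1,0,0,0,0,2,3]),
      (1,0,[0,3,2,0,0,5,0,4]), (1,4,[1,3,0,0,4,0,0,2]), (0,3,[1,0,2,0,0,0,3]),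
      (1,0,[2,4,0,0,5,0,3]), (1,0,[0,0,4,2,3,0,5]), (1,0,[4,0,0,3,2,0,5]),
      (1,0,[0,0,3,0,2,0,4,5]), (1,0,[2,4,3,0,0,0,0,5]), (3,4,[6,3,2,4,0,1]), (4,5,[0,4,5,2,1,3]),
      (5,4,[4,3,0,6,2,1]), (2,2,[2,4,6,0,5,1]), (6,4,[4,3,0,6,1,2]), (6,1,[6,3,1,4,0,5]),
      (4,5,[0,4,5,3,0,2,1]), (5,4,[0,0,3,6,2,1,0,4]), (5,2,[0,4,1,2,0,0,5,6]),
      (6,4,[3,4,0,0,2,1,0,6]), (6,4,[0,0,3,6,1,2,0,4]), (6,4,[6,0,4,0,2,1,0,3])]
      [(0,3,2,[0,0,0,1,2]), (0,3,2,[1,0,0,2]), (0,3,2,[0,0,0,0,0,1,0,2]), (0,3,2,[0,1,2]),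
      (0,3,2,[1,0,0,0,0,0,2]), (3,4,3,[6,3,2,1])] [0,3,2,3,0,2,1,0]
      [[1],[1],[0],[3],[2],[1],[1],[1],[1],[1],[1]] []]]),
    ([[0,0,0,1,1], [0,0,0,0], [0,0,0], [1,1], [1], []], [0,1,2],
      Compare [(1,4,[2,0,1,4,3]), (0,3,[0,0,0,1,2,3]), (1,4,[2,1,0,4,0,3]), (1,4,[2,1,0,4,3]),
      (1,3,[2,5,1,0,3]), (2,1,[4,1,3,0,5,6]), (2,1,[4,1,3,0,6,5]), (2,1,[0,1,3,6,4,5])] 3 0 []),
    ([[0,1,0,1,1], [0,1,1,0], [0,0,0], [0,1], [1], []], [0,1,3,6,7,8,10],
      Colour [(0,3,[1,0,0,0,2,3]), (1,4,[3,0,2,1,4]), (1,4,[0,3,1,4,2]), (1,4,[3,0,4,1,2]),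
      (1,4,[0,4,1,0,3,2]), (1,4,[3,1,4,0,0,2]), (1,0,[2,4,0,5,3]), (1,4,[0,0,1,2,4,3]),
      (1,4,[0,2,1,0,3,4]), (1,4,[3,1,2,0,0,4]), (4,4,[2,4,3,1,6]), (6,5,[3,5,2,4,1]),
      (6,5,[5,3,4,2,1]), (3,4,[0,1,3,4,2,6]), (6,5,[5,2,4,3,0,1]), (4,4,[4,2,1,3,6]),
      (5,4,[1,4,3,2,6]), (5,4,[4,1,2,3,6]), (3,4,[0,4,3,1,6,2]), (4,4,[4,3,1,2,0,6]),
      (5,4,[1,2,3,4,0,6]), (6,5,[3,4,2,5,0,1])] [(0,3,2,[1,0,2]), (0,3,2,[0,0,0,0,1,2]),
      (0,3,2,[1,0,0,0,2]), (1,4,3,[0,3,1,2]), (0,3,2,[1,0,0,0,0,2]), (4,5,4,[4,3,1,2]),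
      (2,4,3,[6,3,1,0,2])] [2,0,1,1,1,0] [[],[2],[],[2],[2],[1],[0],[0],[0],[1],[3],[3],[3],[3]]
      [Colour [(0,3,[1,0,2,0,0,3]), (0,3,[0,1,0,0,0,2,3]), (1,0,[4,2,5,3]), (1,4,[4,1,3,0,2]),
      (1,4,[3,0,0,4,1,2]), (1,4,[0,0,4,1,0,3,2]), (1,4,[0,0,3,1,4,2]), (1,4,[3,0,2,4,0,0,1]),
      (1,4,[2,4,0,3,1]), (1,4,[4,2,0,0,1,3]), (1,4,[1,2,0,0,4,0,3]), (1,4,[2,1,3,0,4]),
      (1,4,[0,3,0,2,1,4]), (1,4,[0,3,1,4,0,0,2]), (1,4,[0,0,3,1,2,4]), (1,4,[0,0,2,1,0,3,4]),
      (1,4,[0,3,1,2,0,0,4]), (1,4,[3,0,4,2,0,0,1]), (1,4,[1,4,0,0,2,0,3]), (3,4,[1,6,0,4,3,2]),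
      (3,4,[0,0,1,3,4,2,6]), (6,5,[0,3,5,2,4,1]), (6,5,[0,5,3,4,2,1]), (4,4,[6,1,2,4,3]),
      (5,4,[6,2,1,4,3]), (5,4,[6,3,4,1,2]), (4,4,[0,2,4,3,1,6]), (5,4,[0,4,1,2,3,6]),
      (5,4,[0,1,2,3,4,0,6]), (5,4,[1,0,0,3,2,6,4]), (5,4,[4,0,0,2,3,6,1]), (6,5,[3,0,0,2,4,1,5]),
      (6,5,[5,0,0,4,2,1,3])] [(0,3,2,[0,1,0,2]), (0,3,2,[0,0,1,0,0,2]), (0,3,2,[0,1,0,0,0,2]),
      (0,3,2,[1,0,2])] [2,2,0,1,1,1,0] [[2],[2],[3],[3],[],[],[0],[0],[1],[3]] [Colour
      [(0,3,[1,2,0,0,3]), (0,3,[0,0,1,0,0,0,2,3]), (0,3,[0,1,0,2,0,0,3]), (0,3,[1,0,0,0,0,2,0,3]),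
      (1,4,[2,3,1,4]), (1,4,[0,2,4,0,0,1,3]), (1,4,[0,0,0,0,1,4,2,3]), (1,4,[3,0,0,1,4,0,0,2]),
      (1,0,[0,4,2,5,3]), (1,4,[0,4,2,0,3,1]), (1,4,[2,0,4,1,3]), (1,4,[0,0,3,0,4,1,2]),
      (1,4,[0,3,0,4,2,0,0,1]), (1,4,[0,3,0,2,4,0,0,1]), (0,3,[1,2,0,0,0,0,3]),
      (0,3,[1,0,0,0,0,0,2,3]), (1,4,[0,1,4,0,0,2,0,3]), (1,4,[0,2,1,3,0,4]),
      (1,4,[0,0,0,2,1,0,3,4]), (1,4,[0,1,2,0,0,4,0,3]), (1,4,[0,0,0,4,1,0,3,2]),
      (1,4,[0,4,1,3,0,2]), (1,4,[0,0,3,1,2,0,0,4]), (6,2,[5,4,2,0,0,1,6]), (3,4,[2,1,3,4,0,6]),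
      (3,4,[0,1,6,0,4,3,2]), (5,4,[0,6,2,1,4,3]), (5,4,[0,6,3,4,1,2]), (5,4,[6,0,3,2,1,4]),
      (6,5,[1,0,2,4,3,5]), (5,4,[0,0,4,1,2,3,6]), (6,5,[0,0,5,3,4,2,1]), (5,4,[0,1,0,0,3,2,6,4]),
      (5,4,[0,4,0,0,2,3,6,1]), (6,5,[0,5,0,0,4,2,1,3])] [(0,3,2,[0,0,1,0,2]), (0,3,2,[0,1,0,2]),
      (0,3,2,[0,1,0,0,2])] [3,0,3,3,2,2,1,0] [[0],[3],[3],[2],[1],[0],[0],[2]] [], Colour
      [(0,3,[0,1,0,2,0,0,3]), (0,3,[1,0,0,0,0,2,0,3]), (0,3,[1,2,0,0,3]), (0,3,[0,0,1,0,0,0,2,3]),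
      (1,4,[2,3,1,4]), (1,4,[1,0,4,2,0,0,3]), (1,0,[0,4,2,5,3]), (1,4,[0,3,0,2,4,0,0,1]),
      (1,4,[0,0,0,4,1,0,3,2]), (1,4,[0,4,1,3,0,2]), (1,4,[0,3,0,0,4,1,2]), (1,4,[0,2,4,0,3,1]),
      (1,4,[1,0,2,4,0,0,3]), (1,4,[0,0,0,3,1,4,2]), (1,4,[2,0,4,1,0,0,0,3]),
      (1,4,[0,3,0,4,2,0,0,1]), (1,4,[0,2,1,3,0,4]), (1,4,[3,0,0,0,2,4,1]), (1,4,[3,0,0,0,4,2,1]),
      (1,4,[0,1,2,0,0,4,0,3]), (1,4,[0,0,3,1,4,0,0,2]), (1,4,[0,1,4,0,0,2,0,3]), (1,4,[4,3,1,2]),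
      (1,4,[4,0,2,1,3]), (1,4,[0,4,2,0,3,1]), (1,4,[0,0,0,3,1,2,4]), (1,4,[0,0,3,0,2,1,4]),
      (1,4,[0,0,0,2,1,0,3,4]), (1,4,[0,0,3,1,2,0,0,4]), (5,4,[0,6,2,1,4,3]), (5,4,[0,6,3,4,1,2]),
      (5,4,[6,0,3,2,1,4]), (5,4,[0,0,4,1,2,3,6]), (5,4,[4,0,0,1,2,6,3]), (5,4,[3,0,2,6,0,1,4]),
      (6,5,[3,1,4,0,0,2,5]), (6,5,[5,1,2,0,0,4,3]), (5,4,[0,1,0,0,3,2,6,4]),
      (5,4,[0,4,0,0,2,3,6,1]), (6,5,[0,3,0,0,2,4,1,5]), (6,5,[0,5,0,0,4,2,1,3])]
      [(0,3,2,[0,0,1,0,2]), (0,3,2,[1,2]), (0,3,2,[1,0,0,0,2])] [1,2,2,0,3,2,1,0]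
      [[1],[1],[2],[],[0],[3]] [Colour [(0,3,[1,0,0,2,0,3]), (0,3,[0,0,1,0,2,0,0,3]),
      (0,3,[0,1,0,0,0,0,2,0,3]), (1,0,[4,3,2,5]), (1,4,[0,2,0,4,1,3]), (1,4,[0,0,4,1,3,0,2]),
      (1,4,[4,0,1,3,0,0,0,0,2]), (1,4,[3,0,1,4,0,0,2]), (1,4,[0,0,0,0,4,1,0,3,2]),
      (1,4,[3,0,0,0,2,4,0,0,1]), (1,4,[0,1,0,2,4,0,0,3]), (1,4,[0,0,3,0,0,2,1,4]),
      (0,3,[0,1,2,0,0,3]), (1,4,[0,0,0,0,3,1,4,2]), (1,4,[0,4,3,1,2]), (0,3,[0,0,0,1,0,0,0,2,3]),
      (0,3,[1,0,0,0,2,0,3]), (1,4,[2,0,4,0,0,3,0,0,1]), (1,4,[0,0,2,4,0,3,1]),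
      (1,4,[0,0,0,3,0,4,1,2]), (1,4,[0,0,0,3,1,2,0,0,4]), (0,3,[1,2,0,0,0,0,3]),
      (1,4,[3,0,1,2,0,0,4]), (1,4,[0,3,0,0,0,4,2,1]), (1,4,[0,0,2,1,3,0,4]),
      (1,4,[0,0,4,2,0,3,1]), (0,3,[1,0,0,0,2,0,0,3]), (1,4,[0,3,0,0,0,2,4,1]),
      (1,4,[0,1,0,4,2,0,0,3]), (1,4,[0,0,0,0,2,1,0,3,4]), (1,4,[2,0,1,0,0,0,3,0,4]),
      (1,4,[0,0,0,3,1,4,0,0,2]), (1,4,[0,0,3,0,4,2,0,0,1]), (0,3,[1,0,0,2,0,0,0,3]),
      (5,4,[0,4,0,0,1,2,6,3]), (5,4,[0,3,0,2,6,0,1,4]), (5,4,[0,0,6,2,1,4,3]),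
      (5,4,[0,0,6,3,4,1,2]), (5,4,[0,6,0,3,2,1,4]), (5,4,[0,0,0,4,1,2,3,6]),
      (6,5,[0,3,1,4,0,0,2,5]), (6,5,[0,5,1,2,0,0,4,3]), (3,4,[2,0,3,1,0,0,6,0,4]),
      (3,4,[2,0,4,0,1,6,0,0,3]), (5,4,[0,0,1,0,0,3,2,6,4]), (5,4,[0,0,4,0,0,2,3,6,1])]
      [(0,3,2,[0,0,1,0,2]), (0,3,2,[0,0,0,1,0,2])] [3,2,0,2,2,1,1,1,0] [[0],[3],[3],[1],[1]] []]],
      Colour [(0,3,[0,1,0,0,0,2,3]), (0,3,[1,0,0,0,2,0,3]), (1,4,[4,1,2,0,3]), (1,0,[4,2,0,3,5]),
      (1,4,[3,0,0,2,4,1]), (1,4,[3,0,0,4,2,1]), (1,4,[3,0,1,4,0,0,2]), (1,4,[0,0,4,1,3,0,2]),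
      (1,4,[2,4,1,3]), (1,4,[0,0,0,1,4,2,3]), (1,4,[4,2,1,0,0,0,3]), (1,4,[0,3,0,4,1,2]),
      (1,4,[1,2,4,0,0,3]), (1,4,[2,1,4,0,3]), (1,4,[0,0,3,1,2,4]), (1,4,[0,3,0,2,1,4]),
      (1,4,[1,4,2,0,0,3]), (1,4,[0,0,2,1,0,3,4]), (1,4,[0,3,1,2,0,0,4]), (3,4,[0,0,4,3,1,6,2]),
      (3,4,[1,6,3,4,0,0,2]), (6,5,[3,0,4,2,0,5,1]), (6,5,[5,0,2,4,0,3,1]), (4,4,[6,1,3,4,2]),
      (5,4,[6,3,2,1,4]), (5,4,[6,2,3,4,1]), (4,4,[0,2,4,3,1,6]), (5,4,[0,1,4,3,2,6]),
      (5,4,[0,4,1,2,3,6]), (5,4,[4,0,1,2,6,3]), (5,4,[3,2,6,0,1,4]), (6,5,[0,3,4,2,5,0,1]),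
      (6,5,[0,5,2,4,3,0,1])] [(0,3,2,[0,1,0,2]), (0,3,2,[0,0,0,0,0,1,2]), (0,3,2,[1,0,0,0,2]),
      (0,3,2,[0,1,0,0,0,0,2])] [2,2,0,1,1,1,0] [[2],[2],[3],[3],[],[0],[1],[3],[3]] [Colour
      [(0,3,[0,0,1,0,0,0,2,3]), (0,3,[1,2,0,0,3]), (0,3,[0,1,0,0,0,2,0,3]), (1,4,[2,3,1,0,0,4]),
      (1,4,[4,0,2,0,3,1]), (1,4,[0,3,0,0,4,2,1]), (1,0,[3,0,0,0,2,5,0,4]),
      (1,4,[0,0,0,0,1,4,2,3]), (0,3,[1,0,0,2,0,0,3]), (1,4,[0,3,0,1,4,0,0,2]), (1,4,[3,4,1,2]),
      (1,4,[0,2,4,1,3]), (1,4,[2,0,4,0,0,1,3]), (1,0,[0,4,2,0,3,5]), (1,4,[0,3,0,0,2,4,1]),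
      (0,3,[1,0,0,0,0,0,2,3]), (1,4,[0,0,3,0,4,1,2]), (1,4,[0,1,2,4,0,0,3]),
      (1,4,[0,1,4,2,0,0,3]), (0,3,[1,2,0,0,0,0,0,3]), (1,4,[0,0,0,4,1,0,3,2]), (1,4,[3,2,1,4]),
      (1,4,[0,4,2,1,3]), (1,4,[0,0,0,3,1,2,4]), (1,4,[0,0,3,0,2,1,4]), (6,2,[5,0,0,0,1,2,4,6]),
      (3,4,[2,0,4,0,1,3,6]), (3,4,[0,0,0,4,3,1,6,2]), (3,4,[2,1,3,6,0,4]), (5,4,[0,6,3,2,1,4]),
      (5,4,[0,6,2,3,4,1]), (5,4,[6,0,3,4,1,2]), (6,5,[1,0,4,3,5,2]), (5,4,[0,0,4,1,2,3,6]),
      (5,4,[0,4,0,1,2,6,3]), (5,4,[0,3,2,6,0,1,4]), (6,5,[1,3,4,0,0,2,5])] [(0,3,2,[0,0,1,0,2]),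
      (0,3,2,[0,1,0,0,0,2]), (0,3,2,[0,1,0,0,2])] [3,1,2,0,0,2,1,0] [[1],[3],[0],[3],[1],[1],[0]]
      []]]),
    ([[1,0,0,0,1], [1,0,0,1], [0,0,0], [1,1], [1], []], [0,1,2,3,4,6,8,10,12],
      Colour [(0,3,[0,0,0,1,2,3]), (0,3,[1,2,0,0,0,3]), (1,4,[2,3,4,1]), (1,4,[4,3,2,1]),
      (1,3,[1,0,5,3,2]), (1,4,[2,0,1,0,4,3]), (1,3,[5,0,1,3,2]), (1,3,[1,0,5,2,3]),
      (1,4,[2,0,1,4,0,3]), (1,4,[4,0,1,2,0,3]), (1,0,[0,3,2,0,5,4]), (6,5,[4,2,5,1,3]),
      (6,5,[4,2,5,3,1]), (5,5,[2,0,3,4,5,1]), (4,2,[1,6,5,2,4]), (2,2,[0,2,1,4,5,6]),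
      (3,1,[1,0,3,4,5,6]), (7,2,[4,5,1,0,2,6]), (8,3,[6,5,2,0,3,1])] [(0,3,2,[0,1,2]),
      (0,3,2,[0,1,0,0,0,2]), (1,4,3,[0,3,2,1]), (1,3,2,[1,0,2,5]), (0,3,2,[0,0,0,1,0,2]),
      (0,3,2,[0,0,0,1,2]), (1,4,3,[0,1,0,3,2]), (0,3,2,[0,0,0,0,1,2]), (0,3,2,[1,0,0,0,0,2]),
      (5,5,4,[2,1,4,3]), (6,5,4,[0,4,2,1,3])] [2,3,2,2,1,0]
      [[2],[1],[2],[2],[1],[1],[0],[1],[3],[0],[0],[0],[0]] []),
    ([[1,1,0,1,1], [0,0,0,1], [0,0,0], [1,1], [1], []], [0,1,2,3,6,7,8,10,12,13],
      Compare [(1,4,[3,2,4,1]), (1,3,[0,1,5,3,2]), (1,3,[0,1,5,2,3]), (0,3,[0,0,0,1,2,3]),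
      (3,4,[6,1,4,3,2]), (7,2,[5,4,1,2,0,6])] 2 1 [Colour [(0,3,[1,2,0,3]), (0,3,[0,0,0,0,1,2,3]),
      (0,3,[0,1,2,0,0,0,3]), (1,4,[0,3,2,4,1]), (1,4,[0,3,4,2,1]), (1,4,[0,0,2,1,0,4,3]),
      (1,0,[3,0,0,2,0,4,5]), (1,4,[3,0,1,4,0,2]), (0,3,[1,0,0,0,2,3]), (1,3,[0,0,5,1,3,2]),
      (1,0,[0,3,0,2,5,4]), (0,3,[0,1,0,0,0,2,3]), (1,4,[0,0,4,1,2,0,3]), (1,4,[3,0,1,2,4]),
      (1,3,[0,0,1,5,3,2]), (1,4,[0,0,2,1,4,0,3]), (1,4,[3,0,1,4,2]), (1,0,[4,3,2,0,5]),
      (8,3,[1,5,2,6,3]), (4,5,[1,0,3,2,4,5]), (6,1,[0,6,4,5,3,1]), (4,5,[0,0,2,3,4,5,1]),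
      (9,4,[6,2,3,1,4]), (5,2,[1,0,2,0,4,5,6]), (7,5,[3,0,4,2,0,1,5]), (7,5,[5,0,2,4,0,1,3]),
      (7,5,[5,0,2,4,1,0,3])] [(0,3,2,[1,2]), (0,3,2,[0,1,2]), (1,4,3,[3,0,1,2]),
      (0,3,2,[1,0,0,0,0,2]), (0,3,2,[0,0,0,0,1,2]), (0,3,2,[0,1,0,0,0,0,2]),
      (9,4,3,[1,2,0,6,0,0,3])] [0,3,1,1,2,1,0] [[3],[3],[1],[0],[0],[0],[2],[2],[],[1],[1],[1]]
      [Colour [(0,3,[0,1,2,0,3]), (0,3,[0,0,0,0,0,1,2,3]), (0,3,[1,0,0,2,0,0,0,3]),
      (1,4,[0,0,3,2,4,1]), (1,0,[4,0,2,0,3,5]), (1,4,[0,0,0,2,1,4,0,3]), (1,4,[0,0,0,4,1,0,2,3]),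
      (1,4,[0,3,0,1,4,0,2]), (0,3,[1,2,0,0,0,3]), (0,3,[0,0,1,0,0,0,2,3]),
      (1,0,[0,3,0,0,2,4,0,5]), (1,4,[3,0,0,4,2,0,1]), (0,3,[0,1,2,0,0,0,3]), (1,4,[0,3,0,1,2,4]),
      (1,0,[2,0,5,0,0,3,4]), (0,3,[0,1,0,0,0,2,3]), (1,0,[3,0,0,0,2,4,5]), (1,0,[2,0,4,3,0,0,5]),
      (1,0,[0,0,3,0,2,5,4]), (0,3,[1,2,0,0,3]), (1,4,[0,3,0,1,4,2]), (0,3,[0,0,1,2,0,0,0,3]),
      (1,0,[0,0,3,0,2,5,0,4]), (1,0,[0,4,3,2,0,5]), (8,3,[0,1,5,2,6,3]), (4,5,[0,1,0,3,2,4,5]),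
      (8,3,[5,1,0,2,6,0,3]), (4,5,[0,0,0,2,3,4,5,1]), (5,2,[0,1,0,2,0,4,5,6]),
      (7,5,[0,5,0,2,4,0,1,3]), (7,5,[0,5,0,2,4,1,0,3])] [(0,3,2,[1,0,0,2]), (0,3,2,[0,1,2]),
      (0,3,2,[0,0,1,2]), (1,4,3,[0,3,0,1,2]), (0,3,2,[0,1,0,0,0,0,2]), (0,3,2,[0,0,0,0,0,1,2]),
      (0,3,2,[0,0,1,0,0,0,0,2]), (7,2,1,[4,5,1,0,0,6])] [3,0,2,1,1,2,1,0]
      [[3],[3],[3],[2],[],[1],[0],[0],[1],[0],[0],[0],[2],[1],[1]] [Colour [(0,3,[0,0,1,2,0,3]),
      (0,3,[0,0,0,0,0,0,1,2,3]), (0,3,[0,1,0,0,2,0,0,0,3]), (0,3,[1,0,2,0,0,0,3]),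
      (1,4,[0,0,0,3,2,4,1]), (1,0,[0,4,0,2,0,3,5]), (1,0,[0,0,3,0,0,2,0,4,5]),
      (1,4,[0,0,3,0,1,4,0,2]), (1,4,[0,0,0,0,2,1,0,4,3]), (0,3,[0,0,0,1,0,0,0,2,3]),
      (1,4,[0,0,0,0,4,1,2,0,3]), (1,4,[2,4,0,0,0,3,0,1]), (1,4,[0,3,0,0,4,2,0,1]),
      (1,3,[1,5,0,2,0,0,0,3]), (1,4,[4,2,0,1,0,0,3]), (1,3,[5,1,0,3,0,0,0,2]),
      (1,0,[2,0,0,4,3,0,0,5]), (1,0,[2,0,0,5,0,0,3,4]), (0,3,[0,0,1,0,0,0,2,3]),
      (1,4,[0,0,3,0,1,2,4]), (1,4,[0,0,3,0,1,4,2]), (0,3,[0,1,2,0,0,3]), (1,3,[5,1,0,2,0,0,0,3]),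
      (1,0,[0,3,0,0,0,2,4,5]), (1,0,[0,0,0,3,0,2,5,4]), (1,3,[1,5,0,3,0,0,0,2]),
      (0,3,[0,0,0,1,2,0,0,0,3]), (1,0,[0,0,4,3,2,0,5]), (0,3,[1,0,0,0,0,0,2,0,3]),
      (1,4,[0,0,0,0,2,1,4,0,3]), (4,5,[0,0,1,0,3,2,4,5]), (4,5,[0,0,0,0,2,3,4,5,1]),
      (8,3,[0,5,1,0,2,6,0,3]), (8,3,[0,0,1,5,2,6,3]), (8,3,[5,0,0,0,6,2,0,3,1]),
      (2,4,[1,3,0,4,0,0,2,6]), (5,2,[0,0,1,0,2,0,4,5,6]), (7,5,[0,0,5,0,2,4,1,0,3])]
      [(0,3,2,[0,0,0,1,2]), (0,3,2,[0,1,0,0,2]), (0,3,2,[0,1,2]), (0,3,2,[1,0,0,0,2]),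
      (1,4,3,[0,0,3,0,1,2]), (0,3,2,[0,0,1,0,0,0,2]), (0,3,2,[0,0,0,0,0,0,1,2]),
      (0,3,2,[0,0,1,0,0,2]), (1,4,3,[0,2,0,1,0,0,3]), (0,3,2,[0,0,0,1,0,0,0,0,2]),
      (2,5,1,[1,3,0,4,0,0,0,5])] [1,1,0,3,2,2,2,1,0]
      [[3],[0],[3],[1],[1],[0],[0],[0],[0],[0],[0],[2],[0],[0],[0],[2],[2],[2]] []]]]),
    ([[1,1,0,1,1], [1,0,0,1], [0,0,0], [1,1], [1], []], [0,1,2,3,7,10,14],
      Colour [(0,3,[1,2,3]), (0,3,[0,0,0,1,2,3]), (1,0,[3,0,2,5,4]), (0,3,[1,0,0,0,2,3]),
      (1,0,[0,3,2,0,5,4]), (1,0,[3,2,0,5,4]), (0,3,[1,2,0,0,0,3]), (1,0,[0,3,2,5,0,4]),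
      (1,0,[3,0,2,5,0,4]), (4,0,[6,4,5,3,2]), (5,1,[5,4,6,3,1]), (5,1,[5,6,4,3,1]),
      (4,0,[0,2,3,4,5,6]), (5,1,[0,1,3,4,6,5]), (2,2,[6,4,5,1,2]), (3,0,[6,4,5,3,2]),
      (2,2,[0,2,1,4,5,6]), (5,1,[0,1,3,6,4,5]), (6,2,[1,2,0,4,5,6]), (6,2,[6,5,4,0,2,1]),
      (6,1,[1,0,3,4,6,5]), (6,1,[5,6,4,3,0,1])] [(0,3,2,[0,0,0,1,2]), (0,3,2,[0,1,2]),
      (0,3,2,[1,0,0,0,0,2]), (0,3,2,[1,2]), (1,4,3,[2,3,0,1]), (0,3,2,[0,0,0,0,1,2]),
      (1,4,3,[0,0,1,0,3,2]), (6,1,0,[0,0,3,6,5,4]), (6,1,0,[4,5,6,3])] [3,1,2,2,1,0]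
      [[3],[0],[0],[3],[3],[3],[3],[0],[1],[1],[1],[0],[0],[0]] []),
    ([[0,1,0,0,1], [1,0,0,1], [0,0,0], [1,1], [1], []], [0,1,2,3,4,7,8,10,13,15],
      Colour [(0,3,[0,0,0,1,2,3]), (1,4,[2,4,3,1]), (1,4,[4,2,3,1]), (1,3,[1,5,0,3,2]),
      (1,3,[5,1,0,3,2]), (1,3,[1,5,0,2,3]), (1,3,[5,1,0,2,3]), (1,0,[0,3,2,0,5,4]),
      (1,0,[0,3,2,5,0,4]), (6,5,[4,5,2,1,3]), (6,5,[4,5,2,3,1]), (5,0,[0,2,3,4,5,6]),
      (2,5,[1,3,2,4,5]), (4,2,[1,5,6,2,4]), (8,5,[1,3,2,4,5]), (8,5,[3,1,2,4,5]),
      (2,2,[0,2,1,4,5,6]), (5,0,[2,0,3,4,5,6]), (7,1,[0,1,3,4,6,5]), (7,1,[0,1,3,6,4,5]),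
      (8,0,[0,2,3,4,5,6]), (9,5,[0,5,4,2,3,1]), (9,5,[0,5,4,3,2,1]), (3,2,[1,2,0,4,5,6]),
      (3,2,[2,1,0,4,5,6])] [(0,3,2,[1,0,2]), (1,4,3,[1,0,0,2,3]), (1,4,3,[0,1,0,3,2]),
      (0,3,2,[0,0,0,0,1,2]), (0,3,2,[0,0,0,1,0,2]), (0,3,2,[0,1,2]), (0,3,2,[0,0,0,1,2]),
      (4,5,4,[3,1,0,2,4]), (3,2,1,[0,1,0,4,5,6])] [1,1,0,2,1,0]
      [[2],[1],[1,2],[1,2],[2],[1],[2],[3],[0],[3],[3],[3],[3],[3]] []),
    ([[0,0,1,1,1], [0,0,0,0], [0,0,0], [0,0], [0], []], [0,1,4,6,7,11,13,14,15,16],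
      Compare [(1,3,[2,1,5,3]), (1,3,[3,1,5,2]), (1,4,[3,1,0,2,4]), (1,3,[3,1,5,0,2]),
      (1,4,[3,1,0,0,2,4]), (1,3,[3,1,5,0,0,2]), (2,3,[6,3,2,1,5])] 2 1 [Colour [(0,3,[1,2,0,0,3]),
      (1,4,[3,2,1,4]), (1,4,[3,4,1,2]), (1,3,[0,3,1,5,2]), (1,3,[0,2,5,1,3]), (1,3,[0,3,5,1,2]),
      (1,4,[0,3,0,1,2,4]), (1,4,[0,3,1,0,4,2]), (0,3,[1,2,0,0,0,3]), (1,3,[0,2,1,5,0,3]),
      (1,4,[0,3,0,1,0,2,4]), (1,4,[3,0,1,0,4,0,2]), (1,3,[0,3,5,1,0,2]), (0,3,[1,2,0,0,0,0,3]),
      (1,4,[3,0,1,2,4]), (1,4,[3,0,1,0,4,2]), (1,4,[0,3,1,0,0,2,4]), (1,4,[0,3,0,1,0,4,2]),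
      (1,3,[0,3,5,1,0,0,2]), (6,1,[6,4,3,1,5]), (7,0,[6,4,3,2,5]), (2,3,[0,6,2,3,1,5]),
      (4,1,[4,5,3,0,1,6]), (4,1,[4,5,3,0,6,1]), (3,5,[1,4,3,2,5]), (7,0,[6,5,3,2,4]),
      (2,3,[0,6,3,2,1,5]), (5,2,[5,6,2,0,1,4]), (4,1,[4,5,3,0,0,1,6]), (4,1,[4,5,3,0,0,6,1])]
      [(0,3,2,[0,1,0,0,2]), (0,3,2,[0,1,0,0,0,2]), (0,3,2,[0,1,0,0,0,0,2]), (0,3,2,[1,2]),
      (0,3,2,[1,0,0,0,2]), (1,4,3,[0,3,0,1,2]), (1,3,2,[0,0,0,0,1,2,5]), (1,3,2,[0,0,0,0,2,1,5]),
      (1,3,2,[0,0,0,0,2,5,1]), (8,5,4,[3,1,4,0,2]), (4,4,3,[2,0,1,6,3]), (8,5,4,[3,2,4,0,1]),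
      (8,5,4,[3,2,4,0,0,1]), (9,5,4,[3,0,4,0,1,2]), (4,4,3,[2,3,1,6]), (4,5,1,[4,5,3,0,1]),
      (9,2,1,[6,4,0,1,5]), (2,3,1,[0,6,0,3,1,5])] [3,2,2,2,1,0,0]
      [[1],[3],[3],[3],[3],[3],[3],[3],[3],[3],[3],[1],[2],[1]] []]),
    ([[1,1,0,0,1], [1,0,0,1], [0,0,0], [1,1], [1], []], [0,1,2,7,9,10,13,14,16],
      Colour [(0,3,[1,2,3]), (0,3,[0,0,0,1,2,3]), (1,0,[0,3,2,0,5,4]), (0,3,[1,2,0,0,0,3]),
      (1,0,[3,0,2,5,0,4]), (1,0,[3,0,2,0,5,4]), (1,0,[0,3,2,5,0,4]), (3,5,[1,4,5,2,3]),
      (3,5,[1,4,5,3,2]), (3,5,[4,1,5,2,3]), (3,5,[4,1,5,3,2]), (3,0,[0,2,3,4,5,6]),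
      (7,1,[5,6,4,0,3,1]), (7,1,[6,5,4,0,3,1]), (8,1,[0,1,3,4,5,6]), (3,5,[4,5,1,2,3]),
      (3,5,[4,5,1,3,2]), (4,2,[1,5,6,2,4]), (2,2,[0,2,1,4,5,6]), (3,0,[2,0,3,4,5,6]),
      (5,1,[0,1,3,4,6,5]), (5,1,[0,1,3,6,4,5]), (6,2,[1,2,0,4,5,6]), (6,2,[2,1,0,4,5,6]),
      (7,1,[5,6,4,3,0,1]), (7,1,[6,5,4,3,0,1]), (8,1,[1,0,3,4,5,6])] [(0,3,2,[0,0,0,1,2]),
      (0,3,2,[0,0,0,1,0,2]), (0,3,2,[0,0,0,0,1,2]), (1,4,3,[0,1,0,2,3]), (6,1,0,[4,5,6,3]),
      (7,1,0,[4,5,6,3]), (7,1,0,[5,4,6,3]), (8,5,1,[0,1,3,4,5])] [3,1,2,2,1,0]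
      [[2],[1],[0,3],[3],[1],[3],[0],[0],[0]] []),
    ([[1,0,0,0,0], [1,1,1,1], [0,0,0], [0,1], [1], []], [0,1,4,6,7,8,10,11,13,14,15,16,17],
      Compare [(1,3,[1,0,5,0,2,3]), (1,3,[1,0,5,0,3,2]), (0,3,[0,1,0,0,2,3]), (1,4,[1,0,0,4,2,3]),
      (1,3,[1,0,5,2,0,3]), (2,3,[3,0,2,1,5,6])] 2 0 [Colour [(0,3,[0,0,1,0,0,2,3]),
      (0,3,[1,0,0,0,2,0,3]), (1,0,[2,5,4,3]), (1,4,[3,1,0,4,0,2]), (1,3,[0,1,0,5,0,3,2]),
      (1,3,[0,5,0,1,0,3,2]), (1,4,[0,0,0,1,4,2,3]), (1,3,[0,5,0,1,0,2,3]), (0,3,[1,0,0,0,0,2,3]),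
      (1,4,[0,0,0,1,2,4,3]), (1,3,[0,1,0,5,2,0,3]), (1,4,[3,1,0,2,4]), (1,4,[0,1,0,0,4,2,3]),
      (0,3,[0,0,1,0,2,0,3]), (1,4,[3,1,0,2,0,0,4]), (1,3,[0,5,0,1,2,0,3]), (2,3,[0,2,0,3,1,5,6]),
      (8,1,[6,3,0,1,0,4,5]), (9,0,[6,3,0,2,0,5,4]), (5,2,[2,1,6,0,4,5]), (11,4,[3,4,6,0,1,2]),
      (2,3,[0,3,0,2,1,5,6]), (4,1,[4,3,0,0,1,6,5]), (4,1,[4,3,0,0,6,1,5]), (9,0,[6,3,0,2,0,4,5]),
      (3,5,[1,3,0,2,0,4,5]), (7,2,[5,2,0,0,1,4,6]), (10,4,[3,4,6,0,0,1,2]),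
      (12,5,[0,2,0,3,4,5,1])] [(0,3,2,[0,0,0,0,0,1,2]), (0,3,2,[1,0,0,0,2]),
      (0,3,2,[0,0,0,0,1,0,2]), (1,4,3,[0,0,0,1,0,3,2]), (10,5,4,[3,4,0,0,0,1,2]),
      (2,3,1,[0,0,0,3,1,5,6]), (6,5,4,[3,4,0,0,1,2]), (4,4,3,[2,1,0,6,0,0,3]),
      (10,5,4,[3,4,0,0,1,0,2])] [2,0,2,1,1,1,0] [[2],[2],[2],[2],[2],[1],[0],[0],[0]] []]),
    ([[0,0,0,0,0], [1,1,1,1], [1,1,0], [0,1], [1], []], [0,1,2,4,6,7,8,11,15,16,18],
      Colour [(0,3,[0,1,2,3]), (0,3,[0,1,0,0,2,3]), (1,4,[1,3,0,2,4]), (1,4,[1,0,3,4,2]),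
      (1,4,[1,0,4,0,3,2]), (0,3,[0,1,2,0,3]), (1,4,[1,0,2,0,3,4]), (1,4,[1,0,3,2,4]),
      (1,4,[1,3,0,4,2]), (0,3,[0,1,0,2,0,3]), (1,4,[1,3,2,0,0,4]), (1,4,[1,3,4,0,0,2]),
      (5,1,[3,4,5,1,6]), (5,1,[3,4,5,6,1]), (5,1,[3,4,6,0,5,1]), (6,0,[3,0,2,4,5,6]),
      (4,1,[3,4,5,1,6]), (4,1,[3,4,1,0,5,6]), (5,1,[3,4,0,1,6,5]), (6,0,[3,0,4,2,6,5]),
      (6,0,[3,0,4,6,2,5]), (6,0,[3,0,6,4,5,2]), (7,2,[2,5,6,1,4])] [(0,3,2,[0,0,1,2]),
      (0,3,2,[0,0,0,0,1,2]), (0,3,2,[0,1,2]), (0,3,2,[0,1,0,2]), (0,3,2,[0,0,1,0,2]),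
      (0,3,2,[0,0,0,1,0,2]), (8,5,4,[4,3,1,2]), (8,5,4,[4,3,2,1]), (10,1,0,[3,4,5,6]),
      (10,1,0,[3,4,6,5]), (9,5,4,[4,3,0,1,2]), (6,5,0,[3,0,4,0,2,5]), (9,5,4,[4,0,1,0,3,2]),
      (5,5,1,[3,4,1,5]), (10,5,4,[4,1,3,2]), (10,1,0,[3,6,4,5]), (3,3,1,[3,0,6,1,5]),
      (6,5,0,[3,2,0,4,5]), (8,5,4,[4,3,2,0,1]), (6,5,0,[3,2,4,0,0,5]), (2,5,4,[4,2,0,1,3])]
      [2,3,0,2,1,0] [[3],[2],[0],[1],[0,1],[3],[3],[3],[3],[3],[3],[3],[1],[0],[1]] []),
    ([[0,1,0,1,1], [1,1,1,1], [0,0,0], [0,1], [1], []], [0,1,8,10,12,13,14,15,16,19],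
      Colour [(0,3,[0,1,0,0,2,3]), (1,0,[2,4,3,5]), (1,4,[3,0,4,1,2]), (0,3,[1,0,0,0,2,3]),
      (0,3,[0,1,0,2,0,3]), (1,4,[0,0,1,4,2,3]), (1,4,[0,0,1,2,4,3]), (1,0,[3,0,2,5,0,4]),
      (5,4,[6,0,4,3,1,2]), (6,4,[6,0,4,3,2,1]), (6,3,[0,1,3,5,2,6]), (6,2,[2,5,0,4,1,6]),
      (7,3,[5,2,0,3,6,1]), (7,3,[3,6,0,5,2,1]), (4,3,[1,0,3,2,6,5]), (3,2,[5,0,1,2,4,6]),
      (4,3,[5,0,2,3,6,1]), (9,2,[0,2,1,4,5,6])] [(0,3,2,[1,0,2]), (0,3,2,[0,0,0,0,1,2]),
      (0,3,2,[0,1,0,2]), (0,3,2,[0,0,0,1,0,2]), (0,3,2,[0,1,0,0,0,2]), (1,4,3,[1,2,0,3]),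
      (0,3,2,[0,1,0,0,2]), (0,3,2,[1,0,0,0,0,2]), (1,4,3,[3,0,2,1]), (6,4,3,[3,2,0,6,0,1]),
      (3,5,3,[5,3,0,2,1]), (8,4,3,[6,3,1,0,2]), (4,5,0,[0,0,3,5,4,2]), (5,4,3,[3,1,0,6,0,2]),
      (6,2,0,[0,6,2,0,5,4]), (7,5,3,[0,1,5,0,2,3]), (7,4,3,[6,3,0,0,1,2])] [2,2,1,1,1,0]
      [[2],[2],[2],[2],[2],[1],[0],[3],[1],[],[0],[3],[3],[1],[0],[0],[0],[3]] [Colour
      [(0,3,[1,2,0,0,0,3]), (0,3,[0,0,1,0,2,0,3]), (1,0,[2,3,5,4]), (1,4,[0,3,0,4,1,2]),
      (1,4,[4,0,0,1,0,3,2]), (1,4,[1,0,3,4,0,0,2]), (1,4,[0,3,0,2,1,4]), (0,3,[0,1,0,0,0,2,3]),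
      (1,4,[3,0,0,1,4,2]), (1,0,[2,0,4,5,3]), (1,0,[4,3,0,2,5]), (0,3,[0,0,1,0,0,2,3]),
      (1,0,[0,2,4,3,5]), (1,0,[3,2,5,0,4]), (1,4,[3,0,0,1,2,4]), (1,4,[2,0,0,1,0,3,4]),
      (6,4,[1,6,0,4,3,2]), (4,0,[5,0,0,3,6,2,4]), (6,4,[3,0,6,4,0,1,2]), (3,3,[5,1,2,3,6]),
      (5,4,[2,6,0,4,3,1]), (3,2,[5,6,0,2,1,4]), (4,3,[2,0,1,3,0,5,6]), (4,3,[0,1,0,3,2,6,5]),
      (4,3,[0,5,0,2,3,6,1]), (2,0,[4,0,0,3,6,2,5]), (4,3,[3,0,5,2,0,1,6]), (9,2,[0,0,2,1,4,5,6])]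
      [(0,3,2,[1,0,0,0,2]), (0,3,2,[0,1,0,0,0,2]), (0,3,2,[1,0,0,0,0,2]), (0,3,2,[0,0,1,0,0,0,2]),
      (0,3,2,[0,0,0,0,1,0,2]), (1,4,3,[3,2,1]), (1,4,3,[0,1,2,0,3])] [0,3,2,1,1,1,0]
      [[2],[0],[0],[3],[3],[2],[3],[1],[3],[2],[1]] []]),
    ([[1,0,1], [0,1], [0], []], [0,1,6,7,8,9,13,14,15,16,18,20],
      Colour [(0,3,[1,2,0,3])] [(1,4,3,[2,3,1]), (1,4,3,[3,2,1]), (1,4,3,[0,3,1,2]),
      (0,3,2,[1,2]), (0,3,2,[0,1,0,2]), (0,3,2,[1,0,0,2]), (1,4,3,[0,2,1,3]), (1,4,3,[2,0,1,3]),
      (1,4,3,[3,0,1,2]), (2,5,1,[1,4,3,5]), (2,5,1,[4,1,3,5]), (2,5,1,[4,5,3,1]),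
      (5,3,1,[1,5,3,6]), (6,1,0,[4,5,3,6]), (6,1,0,[4,6,3,5]), (6,1,0,[6,4,3,5]),
      (7,1,0,[4,5,3,6]), (7,1,0,[5,6,3,4]), (7,1,0,[6,4,3,5]), (8,5,4,[2,1,4,3]),
      (8,5,4,[1,3,4,2]), (8,5,4,[3,2,4,1]), (10,1,0,[4,5,3,6]), (10,1,0,[4,6,3,5]),
      (10,1,0,[6,4,3,5]), (11,5,4,[2,3,1,4]), (11,5,4,[3,2,1,4]), (11,5,4,[3,4,1,2])] [3,2,1,0]
      [[1],[1,3],[],[3],[0,1],[1],[0],[3],[1,2],[1],[2],[2],[1],[0]] [Colour [(0,3,[0,1,2,0,3]),
      (5,2,[2,1,5,4,6]), (10,5,[4,1,2,5,3]), (10,5,[4,1,3,5,2]), (10,5,[4,3,1,5,2]),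
      (3,5,[2,1,4,3,5]), (3,5,[3,1,4,2,5]), (3,5,[2,4,1,3,5]), (3,5,[3,4,1,2,5]),
      (3,5,[2,4,5,3,1]), (3,5,[3,4,5,2,1])] [(0,3,2,[1,0,0,2]), (1,4,3,[0,3,0,1,2]),
      (1,4,3,[0,2,3,1]), (1,4,3,[0,0,2,1,3]), (1,4,3,[1,2,0,0,3]), (1,4,3,[2,0,0,3,1]),
      (1,4,3,[3,1,0,2]), (0,3,2,[0,1,2]), (1,4,3,[1,3,2]), (1,4,3,[3,0,1,2]), (0,3,2,[0,0,1,0,2]),
      (0,3,2,[0,1,0,0,2]), (3,5,4,[1,3,2,4]), (2,5,1,[0,1,4,3,5]), (2,5,1,[0,4,1,3,5]),
      (3,5,4,[1,3,0,4,2]), (3,5,4,[4,3,0,1,2]), (6,1,0,[0,4,5,3,6]), (10,1,0,[0,4,5,3,6]),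
      (10,1,0,[0,4,6,3,5]), (10,1,0,[0,6,4,3,5]), (10,5,1,[4,1,3,5]), (5,3,1,[0,1,5,3,6]),
      (5,3,1,[3,1,5,0,6]), (10,1,0,[3,4,5,0,6]), (10,1,0,[3,4,6,0,5]), (10,1,0,[3,6,4,0,5]),
      (11,5,4,[0,3,4,1,2]), (4,5,4,[2,3,1,4]), (9,5,1,[4,1,3,5])] [2,3,2,1,0]
      [[1,2],[2],[3],[0,1],[1],[3],[1,2],[1],[0],[0],[1],[3],[3],[3],[1],[3],[1],[0]] []]),
    ([[0,0,0], [0,1], [0], []], [0,1,4,22],
      Compare [(1,3,[1,2,5,3]), (1,3,[1,3,5,2]), (3,3,[3,1,0,2])] 2 0 [Compare [(1,3,[2,5,0,3,1]),
      (1,3,[0,5,3,1,2]), (1,3,[3,5,1,2]), (3,3,[1,0,0,2,3])] 1 4 [Degree [(1,3,[0,2,1,0,3,5]),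
      (1,3,[2,0,3,0,1,5]), (1,3,[0,3,1,0,2,5]), (1,3,[1,0,0,2,5,3]), (1,3,[5,0,0,2,1,3]),
      (1,3,[2,1,3,5]), (1,3,[3,1,2,5]), (1,3,[3,5,2,1]), (1,3,[0,2,5,1,3]), (3,3,[0,0,0,1,3,2]),
      (3,3,[0,1,3,0,2]), (3,3,[1,3,2]), (3,3,[1,0,2,3]), (3,3,[3,1,0,0,2]), (2,4,[0,2,3,1,4,6])] 5
      [Colour [(0,3,[1,2,0,3]), (0,3,[1,0,2,0,0,3]), (0,3,[1,0,0,0,2,0,3]), (1,3,[0,2,1,3,5]),
      (1,3,[0,3,1,2,5]), (1,3,[0,2,5,3,1]), (1,3,[0,3,5,2,1]), (1,3,[0,0,3,1,5,2]),
      (1,3,[0,0,2,5,1,3]), (1,3,[0,0,2,1,0,3,5]), (1,3,[0,0,0,1,3,5,2]), (1,3,[0,0,0,5,2,1,3]),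
      (1,3,[0,0,0,5,3,1,2]), (1,3,[0,1,3,0,0,2,5]), (1,3,[0,5,2,0,0,3,1]), (1,3,[0,3,0,2,0,1,5]),
      (1,3,[0,0,3,5,1,2]), (1,3,[0,0,0,1,2,5,3]), (1,3,[0,1,0,0,3,5,2]), (3,2,[1,2,0,4]),
      (3,2,[1,0,2,0,0,4]), (3,3,[0,1,0,2,3]), (3,3,[0,1,3,2]), (2,4,[0,2,1,4,3,6]),
      (2,4,[0,1,2,6,3,4]), (2,4,[0,2,6,4,3,1]), (2,4,[0,6,2,1,3,4]), (3,3,[0,1,0,2,0,3]),
      (3,3,[0,0,1,3,0,2]), (3,3,[0,3,1,0,0,2]), (2,4,[0,0,2,3,1,4,6]), (2,4,[0,0,2,3,6,4,1]),
      (3,3,[0,0,1,0,0,2,3])] [(0,3,2,[0,1,0,2])] [3,1,2,0,1,1,0] [[3],[0,1]] []]]]),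
    ([[1,0,1], [1,1], [0], []], [0,1,21,22,23],
      Colour [(0,3,[1,2,0,3]), (3,2,[1,2,0,4]), (3,3,[1,0,3,2]), (4,2,[2,0,1,4])]
      [(0,3,2,[0,1,2]), (0,3,2,[1,2]), (0,3,2,[0,1,0,2]), (0,3,2,[1,0,0,2]), (3,3,1,[3,0,1]),
      (4,3,1,[1,0,3]), (3,3,1,[0,0,1,3]), (3,3,1,[1,0,3]), (2,4,0,[6,2,3,4]), (2,3,1,[6,1,3,5])]
      [3,2,1,0] [[1],[3],[1],[3],[3],[2],[0],[2],[0],[0]] []),
    ([[0,0,0], [1,1], [0], []], [0,1,22,23,24],
      Colour [(1,4,[1,3,2,4]), (1,4,[1,3,4,2]), (2,3,[3,1,2]), (4,1,[3,1,4]), (3,3,[2,0,1,3]),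
      (4,3,[0,2,3,1]), (3,2,[1,2,4])] [(4,3,0,[0,3,2]), (2,3,1,[1,3]), (2,3,1,[3,1])] [3,2,1,0]
      [[2],[3],[1],[2],[2]] []),
    ([[]], [0,1,22,23,24,25],
      Degree [] 0 [Colour [] [(0,3,2,[1,2]), (4,3,0,[2,3]), (4,3,0,[3,2])] [1,0] [[],[1],[0],[2]]
      [Colour [(4,1,[3,1,4]), (2,3,[3,1,2]), (3,2,[1,2,4]), (5,3,[1,2,3]), (5,3,[1,3,2])]
      [(2,3,1,[1,3]), (4,3,1,[1,3]), (2,3,1,[1,0,3])] [1,1,0] [[2],[2],[2]] []]])]"

lemma check_steps_steps: "check_steps [K4_rows, co_gem_rows] steps"
  by code_simp

text \<open>Absence of the one-vertex graph leaves no vertex at all, and the empty graph is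
  4-colourable.\<close>

lemma (in critical_graph) inconsistent: False
proof -
  have "known [K4_rows, co_gem_rows]"
    using absent_K4 absent_co_gem by (simp add: known_def K4_rows_def co_gem_rows_def)
  moreover have "fst (last steps) = [[]]" "steps \<noteq> []" by (simp_all add: steps_def)
  then obtain ps ch where "([[]], ps, ch) \<in> set steps"
    by (metis last_in_set prod.collapse)
  ultimately have "absent [[]]"
    using check_steps_sound[OF check_steps_steps] by fastforce
  then have "V = {}" by (auto simp: absent_def dest: spec[of _ "[_]"])
  then show False using not_four_colourable by (simp add: four_colourable_def)
qed

section \<open>The hypotheses of the theorem\<close>

lemma colourable_chromatic_number: "colourable k G \<Longrightarrow> colourable (chromatic_number G) G"
  unfolding chromatic_number_def by (rule LeastI)

lemma colourable_mono: "colourable k G \<Longrightarrow> k \<le> l \<Longrightarrow> colourable l G"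
  unfolding colourable_def by (meson less_le_trans)

lemma arcs_ends_del_vert:
  "arcs_ends (pre_digraph.del_vert G v) = {(a, b) \<in> arcs_ends G. a \<noteq> v \<and> b \<noteq> v}"
  by (auto simp: arcs_ends_conv pre_digraph.del_vert_def)

lemma colourable_del_vert: "colourable k G \<Longrightarrow> colourable k (pre_digraph.del_vert G v)"
  unfolding colourable_def by (auto simp: arcs_ends_del_vert pre_digraph.verts_del_vert)

definition edge :: "('a, 'b) pre_digraph \<Rightarrow> 'a \<Rightarrow> 'a \<Rightarrow> bool" where
  "edge G u v \<longleftrightarrow> (u, v) \<in> arcs_ends G"

lemma colourable_four_iff:
  assumes "wf_digraph G"
  shows "colourable 4 G \<longleftrightarrow> four_colourable (verts G) (edge G)"
proof -
  interpret wf_digraph G by fact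
  have "(\<forall>(u, v) \<in> arcs_ends G. c u \<noteq> c v) \<longleftrightarrow>
      (\<forall>u \<in> verts G. \<forall>v \<in> verts G. edge G u v \<longrightarrow> c u \<noteq> c v)" for c :: "'a \<Rightarrow> nat"
    unfolding edge_def using adj_in_verts by auto
  then show ?thesis
    unfolding colourable_def four_colourable_def by simp
qed

text \<open>\<open>induced_free\<close> speaks of isomorphisms of digraphs, which map arcs as well
  as vertices. Arcs of \<open>G\<close> are abstract, those of \<open>H\<close> are pairs; since
  \<open>G\<close> has no parallel arcs, an arc is determined by its ends and can be sent to the
  pair of their preimages.\<close>

lemma not_induced_freeI:
  fixes G :: "('a, 'b) pre_digraph" and H :: "'c pair_pre_digraph"
  assumes "graph G" "pair_wf_digraph H"
    and f: "inj_on f (pverts H)" "f ` pverts H \<subseteq> verts G"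
    and adj: "\<And>i j. i \<in> pverts H \<Longrightarrow> j \<in> pverts H \<Longrightarrow> (i, j) \<in> parcs H \<longleftrightarrow> edge G (f i) (f j)"
  shows "\<not> induced_free (with_proj H) G"
proof -
  interpret graph G by fact
  interpret H: pair_wf_digraph H by fact
  define I where "I = G \<restriction> f ` pverts H"
  define g where "g = the_inv_into (pverts H) f"
  have g: "g (f i) = i" if "i \<in> pverts H" for i
    using that f(1) by (simp add: g_def the_inv_into_f_f)
  have I: "induced_subgraph I G"
    unfolding I_def using f(2) by (rule induced_induce)
  interpret I: wf_digraph I
    unfolding I_def by (rule wellformed_induce_subgraph)
  \<comment> \<open>The isomorphism runs from the copy to \<open>H\<close>. The projections
    \<open>fst\<close> and \<open>snd\<close> are the tail and head functions of
    \<open>with_proj H\<close>.\<close>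
  define h where "h = \<lparr> iso_verts = g, iso_arcs = (\<lambda>a. (g (tail G a), g (head G a))),
    iso_head = snd, iso_tail = fst \<rparr>"
  have vI: "verts I = f ` pverts H" and tI: "tail I = tail G" and hI: "head I = head G"
    and aI: "arcs I = {e \<in> arcs G. tail G e \<in> f ` pverts H \<and> head G e \<in> f ` pverts H}"
    by (auto simp: I_def)
  have inj_g: "inj_on g (f ` pverts H)"
    using f(1) by (auto simp: g_def intro: inj_on_the_inv_into)
  have "pre_digraph.digraph_isomorphism I h"
    unfolding pre_digraph.digraph_isomorphism_def
  proof (intro conjI)
    show "inj_on (iso_arcs h) (arcs I)"
    proof (rule inj_onI)
      fix a b assume ab: "a \<in> arcs I" "b \<in> arcs I" "iso_arcs h a = iso_arcs h b"
      then have "arc_to_ends G a = arc_to_ends G b"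
        using inj_onD[OF inj_g] by (auto simp: aI h_def arc_to_ends_def)
      then show "a = b" using ab no_multi_arcs by (auto simp: aI)
    qed
  qed (use inj_g I.wf_digraph_axioms in \<open>auto simp: h_def vI tI hI\<close>)
  moreover have "with_proj H = app_iso h I"
  proof -
    have "g ` f ` pverts H = pverts H" using g by force
    moreover have "iso_arcs h ` arcs I = parcs H"
    proof (intro equalityI subsetI)
      fix e assume "e \<in> iso_arcs h ` arcs I"
      then obtain a where a: "a \<in> arcs I" "e = (g (tail G a), g (head G a))" by (auto simp: h_def)
      then obtain i j where ij: "i \<in> pverts H" "j \<in> pverts H" "tail G a = f i" "head G a = f j"
        by (auto simp: aI)
      then have "edge G (f i) (f j)" using a by (force simp: edge_def arcs_ends_conv aI)
      then show "e \<in> parcs H" using adj ij a g by simp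
    next
      fix e assume e: "e \<in> parcs H"
      obtain i j where ij: "e = (i, j)" "i \<in> pverts H" "j \<in> pverts H"
        using e H.wellformed' by (cases e) blast
      then have "edge G (f i) (f j)" using adj e by blast
      then obtain a where a: "a \<in> arcs G" "tail G a = f i" "head G a = f j"
        by (auto simp: edge_def arcs_ends_conv)
      then have "iso_arcs h a = e" "a \<in> arcs I" using ij g by (auto simp: h_def aI)
      then show "e \<in> iso_arcs h ` arcs I" by blast
    qed
    ultimately show ?thesis by (simp add: with_proj_def app_iso_def vI h_def)
  qed
  ultimately show ?thesis unfolding induced_free_def digraph_iso_def using I by blast
qed

lemma simple_graph_edge:
  assumes "graph G"
  shows "simple_graph (verts G) (edge G)"
proof -
  interpret graph G by fact
  show ?thesis
    by unfold_locales (auto simp: edge_def graph_symmetric dest: adj_not_same)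
qed

lemma absent_complete_graph_4:
  assumes "graph G" "induced_free (with_proj (complete_graph 4)) G"
  shows "simple_graph.absent (verts G) (edge G) K4_rows"
proof -
  interpret simple_graph "verts G" "edge G" using assms(1) by (rule simple_graph_edge)
  show ?thesis
    unfolding absent_def
  proof
    assume "\<exists>xs. realizes xs K4_rows"
    then obtain xs where xs: "realizes xs K4_rows" by blast
    note r = realizesD[OF xs]
    have len: "length xs = 4" using r(1) by (simp add: K4_rows_def)
    have "\<not> induced_free (with_proj (complete_graph 4)) G"
    proof (rule not_induced_freeI[OF assms(1)])
      show "pair_wf_digraph (complete_graph 4)"
        by unfold_locales (auto simp: complete_graph_def)
      show "inj_on ((!) xs) (pverts (complete_graph 4))"
        using r(2) len by (auto simp: complete_graph_def inj_on_def nth_eq_iff_index_eq)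
      show "(!) xs ` pverts (complete_graph 4) \<subseteq> verts G"
        using r(3) len by (auto simp: complete_graph_def)
      fix i j assume "i \<in> pverts (complete_graph 4)" "j \<in> pverts (complete_graph 4)"
      then have ij: "i \<in> {0, 1, 2, 3}" "j \<in> {0, 1, 2, 3}" by (auto simp: complete_graph_def)
      then have "(i, j) \<in> parcs (complete_graph 4) \<longleftrightarrow> adj K4_rows i j"
        by (auto simp: complete_graph_def K4_rows_def numeral_2_eq_2 numeral_3_eq_3)
      then show "(i, j) \<in> parcs (complete_graph 4) \<longleftrightarrow> edge G (xs ! i) (xs ! j)"
        using realizes_adj[OF xs, of i j] ij len by auto
    qed
    then show False using assms(2) by blast
  qed
qed

lemma absent_co_gem:
  assumes "graph G" "induced_free (with_proj co_gem) G"
  shows "simple_graph.absent (verts G) (edge G) co_gem_rows"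
proof -
  interpret simple_graph "verts G" "edge G" using assms(1) by (rule simple_graph_edge)
  have verts: "pverts co_gem = {Inl 0, Inl 1, Inl 2, Inl 3, Inr 0}"
    by (auto simp: co_gem_def disjoint_union_def path_graph_def)
  have wf: "pair_wf_digraph co_gem"
    using pair_graph_disjoint_union[OF pair_graph_path_graph pair_graph_path_graph]
    by (simp add: co_gem_def pair_graph_def pair_digraph_def pair_fin_digraph_def)
  \<comment> \<open>Follows the order of \<open>co_gem_rows\<close>: \<open>Inr 0\<close> is the
    isolated vertex at position 0, and the path vertex \<open>Inl i\<close> is at position
    \<open>Suc i\<close>.\<close>
  define pos :: "nat + nat \<Rightarrow> nat" where "pos = case_sum Suc (\<lambda>_. 0)"
  show ?thesis
    unfolding absent_def
  proof
    assume "\<exists>xs. realizes xs co_gem_rows"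
    then obtain xs where xs: "realizes xs co_gem_rows" by blast
    note r = realizesD[OF xs]
    have len: "length xs = 5" using r(1) by (simp add: co_gem_rows_def)
    have pos: "pos x < 5" if "x \<in> pverts co_gem" for x
      using that by (auto simp: verts pos_def)
    have "\<not> induced_free (with_proj co_gem) G"
    proof (rule not_induced_freeI[OF assms(1) wf])
      have "inj_on pos (pverts co_gem)" by (auto simp: verts pos_def inj_on_def)
      then show "inj_on (\<lambda>x. xs ! pos x) (pverts co_gem)"
        using r(2) len pos by (auto simp: inj_on_def nth_eq_iff_index_eq)
      show "(\<lambda>x. xs ! pos x) ` pverts co_gem \<subseteq> verts G"
        using r(3) len pos by force
      fix x y assume xy: "x \<in> pverts co_gem" "y \<in> pverts co_gem"
      then have "(x, y) \<in> parcs co_gem \<longleftrightarrow> adj co_gem_rows (pos x) (pos y)"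
        unfolding verts
        by (elim insertE emptyE; simp add: pos_def co_gem_def disjoint_union_def path_graph_def
            co_gem_rows_def image_iff numeral_2_eq_2 numeral_3_eq_3)
      then show "(x, y) \<in> parcs co_gem \<longleftrightarrow> edge G (xs ! pos x) (xs ! pos y)"
        using realizes_adj[OF xs, of "pos x" "pos y"] pos xy len by auto
    qed
    then show False using assms(2) by blast
  qed
qed

lemma critical_graph_edge:
  assumes "graph G" "vertex_critical 5 G" "induced_free (with_proj co_gem) G"
    "induced_free (with_proj (complete_graph 4)) G"
  shows "critical_graph (verts G) (edge G)"
proof -
  interpret graph G by fact
  interpret simple_graph "verts G" "edge G" using assms(1) by (rule simple_graph_edge)
  show ?thesis
  proof unfold_locales
    show "absent K4_rows" using absent_complete_graph_4[OF assms(1,4)] .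
    show "absent co_gem_rows" using absent_co_gem[OF assms(1,3)] .
    \<comment> \<open>4 lies below the least number of colours, which is 5.\<close>
    have "\<not> colourable 4 G"
      using assms(2) not_less_Least[of 4 "\<lambda>k. colourable k G"]
      by (auto simp: vertex_critical_def chromatic_number_def)
    then show "\<not> four_colourable (verts G) (edge G)"
      using colourable_four_iff[OF wf_digraph_axioms] by simp
    show "four_colourable (verts G - {v}) (edge G)" if v: "v \<in> verts G" for v
    proof -
      have "chromatic_number (del_vert v) \<le> 4"
        using assms(2) v by (auto simp: vertex_critical_def)
      \<comment> \<open>The least number of colours is attained only if some number suffices; a
        colouring of \<open>G\<close> with one colour per vertex, restricted to the smaller graph,
        ensures this.\<close>
      then have "colourable 4 (del_vert v)"
        using colourable_chromatic_number[OF colourable_del_vert[OF colourable_card_verts[OF assms(1)]]]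
          colourable_mono by blast
      then have "four_colourable (verts (del_vert v)) (edge (del_vert v))"
        using colourable_four_iff[OF wf_digraph_del_vert] by simp
      moreover have "verts (del_vert v) = verts G - {v}" by (simp add: del_vert_def)
      moreover have "edge (del_vert v) x y = edge G x y" if "x \<noteq> v" "y \<noteq> v" for x y
        using that by (simp add: edge_def arcs_ends_del_vert)
      ultimately show ?thesis by (simp add: four_colourable_def)
    qed
  qed
qed

theorem theorem5p1:
  shows "\<not> (\<exists>G :: ('a, 'b) pre_digraph.
            graph G \<and> vertex_critical 5 G \<and>
            induced_free (with_proj co_gem) G \<and>
            induced_free (with_proj (complete_graph 4)) G)"
  using critical_graph_edge critical_graph.inconsistent by blast

end
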